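(* Let $M$ be a smooth, orientable, connected manifold of finite type with $\dim M\geq 2$, and suppose $M$ admits a nowhere-vanishing vector field. Then, for all $i$ and all $n$, $$\dim H^i(\mathrm{Conf}^n M,\mathbb{Q})\leq \dim H^i(\mathrm{Conf}^{n+1} M,\mathbb{Q}).$$
   Context: $\mathrm{PConf}^n M\subseteq M^n$ is the space of ordered $n$-tuples of distinct points of $M$, and $\mathrm{Conf}^n M=(\mathrm{PConf}^n M)/S_n$ is the unordered configuration space, where $S_n$ acts freely by permuting the points. $H^i(-,\mathbb{Q})$ is singular cohomology. "Finite type" means that the cohomology groups of $M$ are finitely generated. *)

theory Defs
  imports
    "HOL-Analysis.Analysis"
    "HOL-Homology.Homology"
    "HOL-Algebra.Module"
    "HOL-Algebra.AbelCoset"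
    "HOL-Library.Extended_Nat"
begin

section \<open>Smooth manifolds\<close>

text \<open>Used for open \<open>S\<close> only, where \<open>frechet_derivative f (at x)\<close> is the derivative within \<open>S\<close>.\<close>

fun Ck_on :: "nat \<Rightarrow> 'a::real_normed_vector set \<Rightarrow> ('a \<Rightarrow> 'b::real_normed_vector) \<Rightarrow> bool" where
  "Ck_on 0 S f \<longleftrightarrow> continuous_on S f"
| "Ck_on (Suc k) S f \<longleftrightarrow>
     (\<forall>x\<in>S. f differentiable at x) \<and> (\<forall>v. Ck_on k S (\<lambda>x. frechet_derivative f (at x) v))"

definition smooth_on :: "'a::real_normed_vector set \<Rightarrow> ('a \<Rightarrow> 'b::real_normed_vector) \<Rightarrow> bool" where
  "smooth_on S f \<longleftrightarrow> (\<forall>k. Ck_on k S f)"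

text \<open>A chart is a pair of its domain and its coordinate map; the values of the latter outside the
  domain play no role. The dimension of the manifold is \<open>CARD('n)\<close>.\<close>

type_synonym ('a, 'n) chart = "'a set \<times> ('a \<Rightarrow> real ^ 'n)"

definition is_chart :: "'a topology \<Rightarrow> ('a, 'n::finite) chart \<Rightarrow> bool" where
  "is_chart X c \<longleftrightarrow> openin X (fst c) \<and> open (snd c ` fst c) \<and>
     homeomorphic_map (subtopology X (fst c)) (top_of_set (snd c ` fst c)) (snd c)"

text \<open>\<open>transition c d\<close> is meaningful on \<open>snd c ` (fst c \<inter> fst d)\<close>.\<close>

definition transition ::
    "('a, 'n::finite) chart \<Rightarrow> ('a, 'n) chart \<Rightarrow> real ^ 'n \<Rightarrow> real ^ 'n" where
  "transition c d = snd d \<circ> inv_into (fst c) (snd c)"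

definition smooth_atlas :: "'a topology \<Rightarrow> ('a, 'n::finite) chart set \<Rightarrow> bool" where
  "smooth_atlas X A \<longleftrightarrow>
     (\<forall>c\<in>A. is_chart X c) \<and> (\<Union>c\<in>A. fst c) = topspace X \<and>
     (\<forall>c\<in>A. \<forall>d\<in>A. smooth_on (snd c ` (fst c \<inter> fst d)) (transition c d))"

definition smooth_manifold :: "'a topology \<Rightarrow> ('a, 'n::finite) chart set \<Rightarrow> bool" where
  "smooth_manifold X A \<longleftrightarrow> Hausdorff_space X \<and> second_countable X \<and> smooth_atlas X A"

text \<open>The smooth structure defined by \<open>A\<close> also contains the charts of \<open>B\<close> iff \<open>A \<union> B\<close> is an atlas.\<close>

definition orientable_manifold :: "'a topology \<Rightarrow> ('a, 'n::finite) chart set \<Rightarrow> bool" where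
  "orientable_manifold X A \<longleftrightarrow>
     (\<exists>B. smooth_atlas X B \<and> smooth_atlas X (A \<union> B) \<and>
       (\<forall>c\<in>B. \<forall>d\<in>B. \<forall>x\<in>snd c ` (fst c \<inter> fst d).
         det (matrix (frechet_derivative (transition c d) (at x))) > 0))"

text \<open>A tangent vector at \<open>p\<close> is given by its coordinates in all charts of \<open>A\<close> around \<open>p\<close>, which
  transform by the derivatives of the transition maps.\<close>

definition charts_at :: "('a, 'n::finite) chart set \<Rightarrow> 'a \<Rightarrow> ('a, 'n) chart set" where
  "charts_at A p = {c \<in> A. p \<in> fst c}"

definition tangent_space ::
    "('a, 'n::finite) chart set \<Rightarrow> 'a \<Rightarrow> (('a, 'n) chart \<Rightarrow> real ^ 'n) set" where
  "tangent_space A p = {v \<in> extensional (charts_at A p).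
     \<forall>c\<in>charts_at A p. \<forall>d\<in>charts_at A p.
       v d = frechet_derivative (transition c d) (at (snd c p)) (v c)}"

definition zero_tangent ::
    "('a, 'n::finite) chart set \<Rightarrow> 'a \<Rightarrow> ('a, 'n) chart \<Rightarrow> real ^ 'n" where
  "zero_tangent A p = (\<lambda>c\<in>charts_at A p. 0)"

text \<open>A vector field is a continuous section of the tangent bundle; over the domain of a chart the
  bundle is trivialised by the coordinates in that chart.\<close>

definition vector_field ::
    "'a topology \<Rightarrow> ('a, 'n::finite) chart set \<Rightarrow> ('a \<Rightarrow> ('a, 'n) chart \<Rightarrow> real ^ 'n) \<Rightarrow> bool" where
  "vector_field X A \<xi> \<longleftrightarrow>
     (\<forall>p\<in>topspace X. \<xi> p \<in> tangent_space A p) \<and>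
     (\<forall>c\<in>A. continuous_map (subtopology X (fst c)) euclidean (\<lambda>p. \<xi> p c))"

definition nowhere_vanishing ::
    "'a topology \<Rightarrow> ('a, 'n::finite) chart set \<Rightarrow> ('a \<Rightarrow> ('a, 'n) chart \<Rightarrow> real ^ 'n) \<Rightarrow> bool" where
  "nowhere_vanishing X A \<xi> \<longleftrightarrow> (\<forall>p\<in>topspace X. \<xi> p \<noteq> zero_tangent A p)"


section \<open>Configuration spaces\<close>

definition quotient_topology :: "'a topology \<Rightarrow> ('a \<Rightarrow> 'b) \<Rightarrow> 'b topology" where
  "quotient_topology X q =
     topology (\<lambda>U. U \<subseteq> q ` topspace X \<and> openin X {x \<in> topspace X. q x \<in> U})"

lemma openin_quotient_topology:
  "openin (quotient_topology X q) U \<longleftrightarrow>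
     U \<subseteq> q ` topspace X \<and> openin X {x \<in> topspace X. q x \<in> U}"
proof -
  let ?P = "\<lambda>U. U \<subseteq> q ` topspace X \<and> openin X {x \<in> topspace X. q x \<in> U}"
  have "istopology ?P"
    unfolding istopology_def
  proof (intro conjI allI impI; (elim conjE)?)
    fix S T
    assume "openin X {x \<in> topspace X. q x \<in> S}" "openin X {x \<in> topspace X. q x \<in> T}"
    then have "openin X ({x \<in> topspace X. q x \<in> S} \<inter> {x \<in> topspace X. q x \<in> T})"
      by blast
    then show "openin X {x \<in> topspace X. q x \<in> S \<inter> T}"
      by (rule back_subst[where P = "openin X"]) blast
  next
    fix \<K> assume *: "\<forall>K\<in>\<K>. ?P K"
    then have "openin X (\<Union>K\<in>\<K>. {x \<in> topspace X. q x \<in> K})"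
      by blast
    then show "openin X {x \<in> topspace X. q x \<in> \<Union>\<K>}"
      by (rule back_subst[where P = "openin X"]) blast
    show "\<Union>\<K> \<subseteq> q ` topspace X"
      using * by blast
  qed blast
  then show ?thesis
    by (simp add: quotient_topology_def)
qed

lemma topspace_quotient_topology: "topspace (quotient_topology X q) = q ` topspace X"
proof
  show "topspace (quotient_topology X q) \<subseteq> q ` topspace X"
    using openin_quotient_topology openin_topspace by metis
  have "openin (quotient_topology X q) (q ` topspace X)"
    by (auto simp: openin_quotient_topology intro: back_subst[where P = "openin X", OF openin_topspace])
  then show "q ` topspace X \<subseteq> topspace (quotient_topology X q)"
    by (rule openin_subset)
qed

lemma quotient_map_quotient_topology: "quotient_map X (quotient_topology X q) q"
  by (simp add: quotient_map_def topspace_quotient_topology openin_quotient_topology)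

definition PConf :: "nat \<Rightarrow> 'a topology \<Rightarrow> (nat \<Rightarrow> 'a) topology" where
  "PConf n X = subtopology (product_topology (\<lambda>_. X) {..<n}) {f. inj_on f {..<n}}"

definition perm_orbit :: "nat \<Rightarrow> (nat \<Rightarrow> 'a) \<Rightarrow> (nat \<Rightarrow> 'a) set" where
  "perm_orbit n f = {f \<circ> \<sigma> | \<sigma>. \<sigma> permutes {..<n}}"

definition Conf :: "nat \<Rightarrow> 'a topology \<Rightarrow> (nat \<Rightarrow> 'a) set topology" where
  "Conf n X = quotient_topology (PConf n X) (perm_orbit n)"


section \<open>Dimension and quotients of modules\<close>

definition module_independent ::
    "('k, 'r) ring_scheme \<Rightarrow> ('k, 'v, 'm) module_scheme \<Rightarrow> 'v set \<Rightarrow> bool" where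
  "module_independent R M S \<longleftrightarrow> S \<subseteq> carrier M \<and>
     (\<forall>T a. finite T \<and> T \<subseteq> S \<and> a \<in> T \<rightarrow> carrier R \<and> (\<Oplus>\<^bsub>M\<^esub>v\<in>T. a v \<odot>\<^bsub>M\<^esub> v) = \<zero>\<^bsub>M\<^esub>
       \<longrightarrow> (\<forall>v\<in>T. a v = \<zero>\<^bsub>R\<^esub>))"

definition module_dim :: "('k, 'r) ring_scheme \<Rightarrow> ('k, 'v, 'm) module_scheme \<Rightarrow> enat" where
  "module_dim R M = (SUP S\<in>{S. finite S \<and> module_independent R M S}. enat (card S))"

definition module_fin_gen :: "('k, 'r) ring_scheme \<Rightarrow> ('k, 'v, 'm) module_scheme \<Rightarrow> bool" where
  "module_fin_gen R M \<longleftrightarrow> (\<exists>S. finite S \<and> S \<subseteq> carrier M \<and>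
     (\<forall>x\<in>carrier M. \<exists>a\<in>S \<rightarrow> carrier R. x = (\<Oplus>\<^bsub>M\<^esub>v\<in>S. a v \<odot>\<^bsub>M\<^esub> v)))"

text \<open>The ring multiplication and unit that the record type carries along are irrelevant for
  modules. The summand \<open>N\<close> in the scalar multiplication matters for the scalar \<open>0\<close> only.\<close>

definition quotient_module ::
    "('k, 'v, 'm) module_scheme \<Rightarrow> 'v set \<Rightarrow> ('k, 'v set) module" where
  "quotient_module M N =
     \<lparr>carrier = a_rcosets\<^bsub>M\<^esub> N, mult = undefined, one = undefined,
      zero = N, add = set_add M,
      smult = (\<lambda>a C. N <+>\<^bsub>M\<^esub> (\<lambda>x. a \<odot>\<^bsub>M\<^esub> x) ` C)\<rparr>"


section \<open>Singular cohomology with rational coefficients\<close>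

definition rat_ring :: "rat ring" where
  "rat_ring = \<lparr>carrier = UNIV, mult = (*), one = 1, zero = 0, add = (+)\<rparr>"

type_synonym 'a cochain = "((nat \<Rightarrow> real) \<Rightarrow> 'a) \<Rightarrow> rat"

text \<open>The homomorphisms from the free group on the singular simplices to the rationals, given by
  their values on simplices and by \<open>0\<close> on all other functions.\<close>

definition singular_cochain :: "nat \<Rightarrow> 'a topology \<Rightarrow> 'a cochain \<Rightarrow> bool" where
  "singular_cochain p X \<phi> \<longleftrightarrow> (\<forall>s. \<not> singular_simplex p X s \<longrightarrow> \<phi> s = 0)"

definition coboundary :: "nat \<Rightarrow> 'a topology \<Rightarrow> 'a cochain \<Rightarrow> 'a cochain" where
  "coboundary p X \<phi> = (\<lambda>s. if singular_simplex (Suc p) X s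
     then (\<Sum>k\<le>Suc p. (-1) ^ k * \<phi> (singular_face (Suc p) k s)) else 0)"

definition cocycle_module :: "nat \<Rightarrow> 'a topology \<Rightarrow> (rat, 'a cochain) module" where
  "cocycle_module p X =
     \<lparr>carrier = {\<phi>. singular_cochain p X \<phi> \<and> coboundary p X \<phi> = (\<lambda>s. 0)},
      mult = undefined, one = undefined,
      zero = (\<lambda>s. 0), add = (\<lambda>\<phi> \<psi> s. \<phi> s + \<psi> s),
      smult = (\<lambda>a \<phi> s. a * \<phi> s)\<rparr>"

definition coboundaries :: "nat \<Rightarrow> 'a topology \<Rightarrow> 'a cochain set" where
  "coboundaries p X = (case p of
     0 \<Rightarrow> {\<lambda>s. 0}
   | Suc q \<Rightarrow> coboundary q X ` {\<phi>. singular_cochain q X \<phi>})"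

definition singular_cohomology :: "nat \<Rightarrow> 'a topology \<Rightarrow> (rat, 'a cochain set) module" where
  "singular_cohomology p X = quotient_module (cocycle_module p X) (coboundaries p X)"

definition betti :: "nat \<Rightarrow> 'a topology \<Rightarrow> enat" where
  "betti p X = module_dim rat_ring (singular_cohomology p X)"

definition finite_type :: "'a topology \<Rightarrow> bool" where
  "finite_type X \<longleftrightarrow> (\<forall>p. module_fin_gen rat_ring (singular_cohomology p X))"


subsection \<open>The cohomology is a vector space over the rationals\<close>

lemma cring_rat_ring: "cring rat_ring"
proof -
  have "\<exists>y. x + y = 0" for x :: rat
    using add.right_inverse by blast
  then show ?thesis
    unfolding rat_ring_def using add.right_inverse
    by unfold_locales (auto simp: algebra_simps Units_def)
qed

definition cochain_pairing :: "'a cochain \<Rightarrow> 'a chain \<Rightarrow> rat" where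
  "cochain_pairing \<phi> c = (\<Sum>s\<in>Poly_Mapping.keys c. of_int (Poly_Mapping.lookup c s) * \<phi> s)"

lemma cochain_pairing_eq:
  assumes "finite K" "Poly_Mapping.keys c \<subseteq> K"
  shows "cochain_pairing \<phi> c = (\<Sum>s\<in>K. of_int (Poly_Mapping.lookup c s) * \<phi> s)"
  unfolding cochain_pairing_def
  by (rule sum.mono_neutral_left) (use assms in \<open>auto simp: in_keys_iff\<close>)

lemma cochain_pairing_0 [simp]: "cochain_pairing \<phi> 0 = 0"
  by (simp add: cochain_pairing_def)

lemma cochain_pairing_of [simp]: "cochain_pairing \<phi> (frag_of s) = \<phi> s"
  by (simp add: cochain_pairing_def)

lemma cochain_pairing_add: "cochain_pairing \<phi> (a + b) = cochain_pairing \<phi> a + cochain_pairing \<phi> b"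
proof -
  let ?K = "Poly_Mapping.keys a \<union> Poly_Mapping.keys b"
  have "Poly_Mapping.keys (a + b) \<subseteq> ?K"
    by (rule Poly_Mapping.keys_add)
  then show ?thesis
    by (simp add: cochain_pairing_eq[of ?K] lookup_add algebra_simps sum.distrib)
qed

lemma cochain_pairing_cmul: "cochain_pairing \<phi> (frag_cmul k c) = of_int k * cochain_pairing \<phi> c"
proof -
  have "Poly_Mapping.keys (frag_cmul k c) \<subseteq> Poly_Mapping.keys c"
    by (rule keys_cmul)
  then show ?thesis
    by (simp add: cochain_pairing_eq[of "Poly_Mapping.keys c"] sum_distrib_left mult.assoc)
qed

lemma cochain_pairing_sum: "cochain_pairing \<phi> (sum g I) = (\<Sum>i\<in>I. cochain_pairing \<phi> (g i))"
  by (induction I rule: infinite_finite_induct) (simp_all add: cochain_pairing_add)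

lemma coboundary_eq_pairing:
  assumes "singular_simplex (Suc p) X s"
  shows "coboundary p X \<phi> s = cochain_pairing \<phi> (chain_boundary (Suc p) (frag_of s))"
  using assms
  by (simp add: coboundary_def chain_boundary_of cochain_pairing_sum cochain_pairing_cmul del: sum.atMost_Suc)

lemma cochain_pairing_coboundary:
  assumes "singular_chain (Suc p) X c"
  shows "cochain_pairing (coboundary p X \<phi>) c = cochain_pairing \<phi> (chain_boundary (Suc p) c)"
proof -
  have "Poly_Mapping.keys c \<subseteq> singular_simplex_set (Suc p) X"
    using assms by (simp add: singular_chain_def)
  then show ?thesis
  proof (induction c rule: frag_induction)
    case (diff a b)
    have diff': "cochain_pairing \<psi> (x - y) = cochain_pairing \<psi> x - cochain_pairing \<psi> y"
      for \<psi> :: "'a cochain" and x y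
      using cochain_pairing_add[of \<psi> "x - y" y] by simp
    show ?case
      by (simp add: diff' chain_boundary_diff diff)
  qed (simp_all add: coboundary_eq_pairing)
qed

lemma singular_cochain_coboundary: "singular_cochain (Suc p) X (coboundary p X \<phi>)"
  by (simp add: singular_cochain_def coboundary_def)

lemma coboundary_coboundary: "coboundary (Suc p) X (coboundary p X \<phi>) = (\<lambda>s. 0)"
proof
  fix s
  show "coboundary (Suc p) X (coboundary p X \<phi>) s = 0"
  proof (cases "singular_simplex (Suc (Suc p)) X s")
    case True
    then have c: "singular_chain (Suc (Suc p)) X (frag_of s)"
      by (simp add: singular_chain_of)
    have "coboundary (Suc p) X (coboundary p X \<phi>) s =
        cochain_pairing \<phi> (chain_boundary (Suc p) (chain_boundary (Suc (Suc p)) (frag_of s)))"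
      using singular_chain_boundary[OF c]
      by (simp add: coboundary_eq_pairing[OF True] cochain_pairing_coboundary)
    also have "\<dots> = 0"
      using chain_boundary_boundary[OF c] by simp
    finally show ?thesis .
  qed (simp add: coboundary_def)
qed

lemma coboundary_add:
  "coboundary p X (\<lambda>s. \<phi> s + \<psi> s) = (\<lambda>s. coboundary p X \<phi> s + coboundary p X \<psi> s)"
  by (auto simp: coboundary_def algebra_simps sum.distrib)

lemma coboundary_smult: "coboundary p X (\<lambda>s. a * \<phi> s) = (\<lambda>s. a * coboundary p X \<phi> s)"
  by (auto simp: coboundary_def algebra_simps sum_distrib_left)

lemma coboundary_0: "coboundary p X (\<lambda>s. 0) = (\<lambda>s. 0)"
  by (auto simp: coboundary_def)

lemma coboundaries_subset: "coboundaries p X \<subseteq> carrier (cocycle_module p X)"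
  by (auto simp: coboundaries_def cocycle_module_def singular_cochain_coboundary
      coboundary_coboundary coboundary_0 split: nat.splits) (simp add: singular_cochain_def)

lemma coboundaries_closed:
  "(\<lambda>s. 0) \<in> coboundaries p X"
  "\<phi> \<in> coboundaries p X \<Longrightarrow> \<psi> \<in> coboundaries p X \<Longrightarrow> (\<lambda>s. \<phi> s + \<psi> s) \<in> coboundaries p X"
  "\<phi> \<in> coboundaries p X \<Longrightarrow> (\<lambda>s. a * \<phi> s) \<in> coboundaries p X"
proof -
  show "(\<lambda>s. 0) \<in> coboundaries p X"
    by (auto simp: coboundaries_def singular_cochain_def coboundary_0 split: nat.splits
        intro!: image_eqI[where x = "\<lambda>s. 0"])
  show "(\<lambda>s. \<phi> s + \<psi> s) \<in> coboundaries p X"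
    if "\<phi> \<in> coboundaries p X" "\<psi> \<in> coboundaries p X"
    using that
    by (auto simp: coboundaries_def singular_cochain_def simp flip: coboundary_add split: nat.splits)
  show "(\<lambda>s. a * \<phi> s) \<in> coboundaries p X" if "\<phi> \<in> coboundaries p X"
    using that
    by (auto simp: coboundaries_def singular_cochain_def simp flip: coboundary_smult split: nat.splits)
qed

lemma cocycle_module_simps:
  "\<phi> \<in> carrier (cocycle_module p X) \<longleftrightarrow> singular_cochain p X \<phi> \<and> coboundary p X \<phi> = (\<lambda>s. 0)"
  "\<zero>\<^bsub>cocycle_module p X\<^esub> = (\<lambda>s. 0)"
  "\<phi> \<oplus>\<^bsub>cocycle_module p X\<^esub> \<psi> = (\<lambda>s. \<phi> s + \<psi> s)"
  "a \<odot>\<^bsub>cocycle_module p X\<^esub> \<phi> = (\<lambda>s. a * \<phi> s)"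
  by (simp_all add: cocycle_module_def)

lemma module_cocycle_module: "module rat_ring (cocycle_module p X)"
proof (rule moduleI)
  show "abelian_group (cocycle_module p X)"
  proof (rule abelian_groupI)
    fix \<phi> assume "\<phi> \<in> carrier (cocycle_module p X)"
    then show "\<exists>\<psi>\<in>carrier (cocycle_module p X). \<psi> \<oplus>\<^bsub>cocycle_module p X\<^esub> \<phi> = \<zero>\<^bsub>cocycle_module p X\<^esub>"
      using coboundary_smult[of p X "-1" \<phi>]
      by (intro bexI[where x = "\<lambda>s. - 1 * \<phi> s"])
        (auto simp: cocycle_module_simps singular_cochain_def)
  qed (auto simp: cocycle_module_simps singular_cochain_def coboundary_add coboundary_0 algebra_simps)
qed (use cring_rat_ring in \<open>auto simp: cocycle_module_simps singular_cochain_def coboundary_smult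
      rat_ring_def algebra_simps\<close>)

lemma module_quotient_module:
  assumes "module R M" and sub: "subgroup N (add_monoid M)"
    and smult: "\<And>a x. a \<in> carrier R \<Longrightarrow> x \<in> N \<Longrightarrow> a \<odot>\<^bsub>M\<^esub> x \<in> N"
  shows "module R (quotient_module M N)"
proof -
  interpret module R M by fact
  interpret N: abelian_subgroup N M
    using sub M.abelian_group_axioms
    by (intro abelian_subgroupI3 additive_subgroup.intro)
  let ?Q = "quotient_module M N"
  have NM: "x \<in> carrier M" if "x \<in> N" for x
    using that N.a_subset by blast
  have sm: "N <+>\<^bsub>M\<^esub> (\<lambda>x. a \<odot>\<^bsub>M\<^esub> x) ` (N +>\<^bsub>M\<^esub> x) = N +>\<^bsub>M\<^esub> (a \<odot>\<^bsub>M\<^esub> x)"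
    if a: "a \<in> carrier R" and x: "x \<in> carrier M" for a x
  proof
    show "N <+>\<^bsub>M\<^esub> (\<lambda>x. a \<odot>\<^bsub>M\<^esub> x) ` (N +>\<^bsub>M\<^esub> x) \<subseteq> N +>\<^bsub>M\<^esub> (a \<odot>\<^bsub>M\<^esub> x)"
    proof
      fix y assume "y \<in> N <+>\<^bsub>M\<^esub> (\<lambda>x. a \<odot>\<^bsub>M\<^esub> x) ` (N +>\<^bsub>M\<^esub> x)"
      then obtain h k where hk: "h \<in> N" "k \<in> N" "y = h \<oplus>\<^bsub>M\<^esub> a \<odot>\<^bsub>M\<^esub> (k \<oplus>\<^bsub>M\<^esub> x)"
        by (auto simp: set_add_def' a_r_coset_def')
      then have "y = (h \<oplus>\<^bsub>M\<^esub> a \<odot>\<^bsub>M\<^esub> k) \<oplus>\<^bsub>M\<^esub> a \<odot>\<^bsub>M\<^esub> x"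
        using a x by (simp add: NM smult_r_distr M.a_assoc)
      moreover have "h \<oplus>\<^bsub>M\<^esub> a \<odot>\<^bsub>M\<^esub> k \<in> N"
        using hk a smult N.a_closed by auto
      ultimately show "y \<in> N +>\<^bsub>M\<^esub> (a \<odot>\<^bsub>M\<^esub> x)"
        by (auto simp: a_r_coset_def')
    qed
    show "N +>\<^bsub>M\<^esub> (a \<odot>\<^bsub>M\<^esub> x) \<subseteq> N <+>\<^bsub>M\<^esub> (\<lambda>x. a \<odot>\<^bsub>M\<^esub> x) ` (N +>\<^bsub>M\<^esub> x)"
    proof
      fix y assume "y \<in> N +>\<^bsub>M\<^esub> (a \<odot>\<^bsub>M\<^esub> x)"
      then obtain h where h: "h \<in> N" "y = h \<oplus>\<^bsub>M\<^esub> a \<odot>\<^bsub>M\<^esub> x"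
        by (auto simp: a_r_coset_def')
      have "\<zero>\<^bsub>M\<^esub> \<oplus>\<^bsub>M\<^esub> x \<in> N +>\<^bsub>M\<^esub> x"
        unfolding a_r_coset_def' using N.zero_closed by blast
      then have "x \<in> N +>\<^bsub>M\<^esub> x"
        using x by simp
      then show "y \<in> N <+>\<^bsub>M\<^esub> (\<lambda>x. a \<odot>\<^bsub>M\<^esub> x) ` (N +>\<^bsub>M\<^esub> x)"
        unfolding set_add_def' using h by blast
    qed
  qed
  have Q: "carrier ?Q = a_rcosets\<^bsub>M\<^esub> N" "\<And>C D. C \<oplus>\<^bsub>?Q\<^esub> D = C <+>\<^bsub>M\<^esub> D"
    "\<And>a C. a \<odot>\<^bsub>?Q\<^esub> C = N <+>\<^bsub>M\<^esub> (\<lambda>x. a \<odot>\<^bsub>M\<^esub> x) ` C"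
    by (simp_all add: quotient_module_def)
  have sum: "(N +>\<^bsub>M\<^esub> x) <+>\<^bsub>M\<^esub> (N +>\<^bsub>M\<^esub> y) = N +>\<^bsub>M\<^esub> (x \<oplus>\<^bsub>M\<^esub> y)"
    if "x \<in> carrier M" "y \<in> carrier M" for x y
    using N.a_rcos_sum that by blast
  have rep: "\<exists>x\<in>carrier M. C = N +>\<^bsub>M\<^esub> x" if "C \<in> carrier ?Q" for C
    using that by (auto simp: Q A_RCOSETS_def')
  have mem: "N +>\<^bsub>M\<^esub> x \<in> carrier ?Q" if "x \<in> carrier M" for x
    using that by (auto simp: Q A_RCOSETS_def')
  have Q0: "\<zero>\<^bsub>?Q\<^esub> = N +>\<^bsub>M\<^esub> \<zero>\<^bsub>M\<^esub>"
    using N.a_subset by (simp add: quotient_module_def)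
  have ag: "abelian_group ?Q"
  proof (rule abelian_groupI)
    fix C D E assume C: "C \<in> carrier ?Q"
    obtain x where x: "x \<in> carrier M" "C = N +>\<^bsub>M\<^esub> x"
      using rep[OF C] by blast
    show "\<zero>\<^bsub>?Q\<^esub> \<oplus>\<^bsub>?Q\<^esub> C = C"
      using x by (simp add: Q0 Q(2) sum)
    show "\<exists>D\<in>carrier ?Q. D \<oplus>\<^bsub>?Q\<^esub> C = \<zero>\<^bsub>?Q\<^esub>"
      using x by (intro bexI[OF _ mem[of "\<ominus>\<^bsub>M\<^esub> x"]]) (simp_all add: Q0 Q(2) sum M.l_neg)
    assume D: "D \<in> carrier ?Q"
    obtain y where y: "y \<in> carrier M" "D = N +>\<^bsub>M\<^esub> y"
      using rep[OF D] by blast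
    show "C \<oplus>\<^bsub>?Q\<^esub> D \<in> carrier ?Q"
      using x y mem by (simp add: Q(2) sum)
    show "C \<oplus>\<^bsub>?Q\<^esub> D = D \<oplus>\<^bsub>?Q\<^esub> C"
      using x y by (simp add: Q(2) sum M.a_comm)
    assume E: "E \<in> carrier ?Q"
    show "C \<oplus>\<^bsub>?Q\<^esub> D \<oplus>\<^bsub>?Q\<^esub> E = C \<oplus>\<^bsub>?Q\<^esub> (D \<oplus>\<^bsub>?Q\<^esub> E)"
      using rep[OF E] x y by (auto simp: Q(2) sum M.a_assoc)
  qed (simp add: Q0 mem)
  show ?thesis
  proof (rule moduleI)
    fix a b C D
    assume a: "a \<in> carrier R" and C: "C \<in> carrier ?Q"
    obtain x where x: "x \<in> carrier M" "C = N +>\<^bsub>M\<^esub> x"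
      using rep[OF C] by blast
    show "a \<odot>\<^bsub>?Q\<^esub> C \<in> carrier ?Q"
      using a x mem by (simp add: sm Q(2,3))
    show "a \<odot>\<^bsub>?Q\<^esub> (C \<oplus>\<^bsub>?Q\<^esub> D) = a \<odot>\<^bsub>?Q\<^esub> C \<oplus>\<^bsub>?Q\<^esub> a \<odot>\<^bsub>?Q\<^esub> D" if D: "D \<in> carrier ?Q"
      using rep[OF D] a x by (auto simp: Q(2,3) sum sm smult_r_distr)
    show "(a \<oplus>\<^bsub>R\<^esub> b) \<odot>\<^bsub>?Q\<^esub> C = a \<odot>\<^bsub>?Q\<^esub> C \<oplus>\<^bsub>?Q\<^esub> b \<odot>\<^bsub>?Q\<^esub> C" if "b \<in> carrier R"
      using that a x by (simp add: Q(2,3) sum sm smult_l_distr)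
    show "(a \<otimes>\<^bsub>R\<^esub> b) \<odot>\<^bsub>?Q\<^esub> C = a \<odot>\<^bsub>?Q\<^esub> (b \<odot>\<^bsub>?Q\<^esub> C)" if "b \<in> carrier R"
      using that a x by (simp add: Q(2,3) sm smult_assoc1)
  next
    fix C assume C: "C \<in> carrier ?Q"
    then show "\<one>\<^bsub>R\<^esub> \<odot>\<^bsub>?Q\<^esub> C = C"
      using rep[OF C] by (auto simp: Q(3) sm)
  qed (use ag in \<open>auto intro: R.is_cring\<close>)
qed

lemma module_singular_cohomology: "module rat_ring (singular_cohomology p X)"
  unfolding singular_cohomology_def
proof (rule module_quotient_module[OF module_cocycle_module])
  interpret module rat_ring "cocycle_module p X" by (rule module_cocycle_module)
  show "subgroup (coboundaries p X) (add_monoid (cocycle_module p X))"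
  proof (rule M.add.subgroupI)
    fix \<phi> assume \<phi>: "\<phi> \<in> coboundaries p X"
    have "(\<lambda>s. - 1 * \<phi> s) \<in> coboundaries p X"
      by (rule coboundaries_closed(3)[OF \<phi>])
    moreover have "\<ominus>\<^bsub>cocycle_module p X\<^esub> \<phi> = (\<lambda>s. - 1 * \<phi> s)"
      by (rule M.minus_equality)
        (use \<phi> calculation coboundaries_subset[of p X] in \<open>auto simp: cocycle_module_simps(2,3)\<close>)
    ultimately show "\<ominus>\<^bsub>cocycle_module p X\<^esub> \<phi> \<in> coboundaries p X"
      by simp
  next
    show "coboundaries p X \<noteq> {}"
      using coboundaries_closed(1) by fast
  qed (use coboundaries_subset[of p X] coboundaries_closed in \<open>auto simp: cocycle_module_simps(3)\<close>)
qed (auto simp: cocycle_module_simps coboundaries_closed)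

end

theory Submission
  imports Defs "HOL-Library.Function_Algebras" "HOL-Combinatorics.Permutations"
begin

text \<open>The field yields a map \<open>\<Phi> : M \<times> [0,1] \<rightarrow> M\<close> with \<open>\<Phi>(x,0) = x\<close> and \<open>\<Phi>(x,t) \<noteq> x\<close> for \<open>t > 0\<close>: the field
  is merely continuous and need not have a flow, so \<open>\<Phi>\<close> is composed of small pushes along the field in the charts of
  a locally finite family. Doubling the point \<open>x\<^sub>j\<close> of a configuration into \<open>x\<^sub>j, \<Phi>(x\<^sub>j,\<epsilon>)\<close> gives maps
  \<open>PConf n M \<rightarrow> PConf (n+1) M\<close>. On the homology of \<open>PConf n M\<close>, the sum \<open>D\<close> of the \<open>n\<close> doubling maps and
  the sum \<open>T\<close> of the \<open>n+1\<close> maps that drop a point satisfy \<open>T D = D T + 2 n\<close>: dropping either half of a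
  doubled point is homotopic to the identity, and dropping any other point commutes with doubling up to
  homotopy. Hence \<open>T D\<close> is rationally invertible and \<open>T\<close> is rationally surjective for \<open>n \<ge> 1\<close>; for \<open>n = 0\<close>
  it has a section. Lifting singular simplices along the covering \<open>PConf \<rightarrow> Conf\<close> makes \<open>T\<close> a chain map from
  \<open>Conf (n+1) M\<close> to \<open>Conf n M\<close>, still rationally surjective by transfer, and rational cohomology is dual to
  homology.\<close>

section \<open>Betti numbers and rationally surjective chain maps\<close>

text \<open>A closed manifold offers no end from which a new point could be brought in. The field
  only lets a chosen point split, and summing over the points removes the choice. Only
  \<open>T\<close> has to descend to \<open>Conf\<close>, so doubling is studied on
  \<open>PConf\<close> and needs no equivariance. The number \<open>2 n\<close> counts the two
  halves of each of the \<open>n\<close> doubled points. It makes \<open>T D\<close> positive, at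
  least heuristically: the nonzero eigenvalues of \<open>D T\<close> are those of \<open>T D\<close>
  with one point fewer, so by induction every eigenvalue of \<open>T D\<close> is at least
  \<open>2 n\<close>. Homology is integral here and its rank is not controlled, so no spectrum is
  used. Instead \<open>(T D + r) d = N c\<close> is solved with a nonzero integer \<open>N\<close>.
  The shift \<open>r\<close> makes the induction on \<open>n\<close> go through, since passing to
  one point fewer turns \<open>T D + r\<close> into \<open>T D + 2 n + r\<close>.\<close>

text \<open>Chains have integer coefficients and cochains rational values; this turns a rational
  relation between simplices into an integral chain.\<close>

lemma common_denominator:
  fixes r :: "'s \<Rightarrow> rat"
  assumes "finite F"
  shows "\<exists>N m. N \<noteq> 0 \<and> (\<forall>s\<in>F. of_int N * r s = of_int (m s :: int))"
  using assms
proof (induction F)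
  case empty
  show ?case by (rule exI[of _ 1]) simp
next
  case (insert x F)
  then obtain N m where N: "N \<noteq> 0" "\<forall>s\<in>F. of_int N * r s = of_int (m s)"
    by blast
  obtain a b where ab: "r x = of_int a / of_int b" "b > 0"
    by (metis quotient_of_div quotient_of_denom_pos surj_pair)
  have "of_int (N * b) * r s = of_int (if s = x then N * a else b * m s)" if "s \<in> insert x F" for s
    using that N ab by (auto simp: algebra_simps)
  with N ab show ?case
    by (intro exI[of _ "N * b"] exI[of _ "\<lambda>s. if s = x then N * a else b * m s"]) auto
qed

text \<open>A basis is chosen among the vectors \<open>e s\<close> and \<psi> is prescribed on it.
  The hypothesis on relations then forces the right value on every other \<open>e s\<close>. Two
  indices with the same vector are also a relation, so \<open>e\<close> need not be
  injective.\<close>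

lemma rat_functional_extension:
  fixes e :: "'s \<Rightarrow> 'v \<Rightarrow> rat" and \<phi> :: "'s \<Rightarrow> rat"
  assumes rel: "\<And>F r. finite F \<Longrightarrow> F \<subseteq> S \<Longrightarrow> (\<And>v. (\<Sum>s\<in>F. r s * e s v) = 0) \<Longrightarrow>
    (\<Sum>s\<in>F. r s * \<phi> s) = 0"
  obtains \<psi> :: "('v \<Rightarrow> rat) \<Rightarrow> rat" where
    "\<And>x y. \<psi> (x + y) = \<psi> x + \<psi> y" "\<And>s. s \<in> S \<Longrightarrow> \<psi> (e s) = \<phi> s"
proof -
  define sc :: "rat \<Rightarrow> ('v \<Rightarrow> rat) \<Rightarrow> ('v \<Rightarrow> rat)" where "sc a f = (\<lambda>x. a * f x)" for a f
  interpret vector_space_pair sc "(*) :: rat \<Rightarrow> rat \<Rightarrow> rat"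
    by unfold_locales (auto simp: sc_def fun_eq_iff algebra_simps)
  obtain B where B: "B \<subseteq> e ` S" "vs1.independent B" "e ` S \<subseteq> vs1.span B"
    by (rule vs1.maximal_independent_subset[of "e ` S"]) blast
  \<comment> \<open>One index is picked for each basis vector, because several indices may give the
    same vector.\<close>
  define k where "k b = (SOME s. s \<in> S \<and> e s = b)" for b
  have k: "k b \<in> S \<and> e (k b) = b" if "b \<in> B" for b
    unfolding k_def by (rule someI_ex) (use B that in auto)
  obtain \<psi> where \<psi>: "Vector_Spaces.linear sc (*) \<psi>" "\<forall>b\<in>B. \<psi> b = \<phi> (k b)"
    using linear_independent_extend[OF B(2), of "\<lambda>b. \<phi> (k b)"] by blast
  interpret \<psi>: Vector_Spaces.linear sc "(*)" \<psi> by fact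
  show ?thesis
  proof
    show "\<psi> (x + y) = \<psi> x + \<psi> y" for x y by (rule \<psi>.add)
    fix s assume s: "s \<in> S"
    then have "e s \<in> vs1.span B" using B by blast
    then obtain T r where T: "finite T" "T \<subseteq> B" "e s = (\<Sum>b\<in>T. sc (r b) b)"
      unfolding vs1.span_explicit by blast
    have inj: "inj_on k T"
      by (rule inj_on_inverseI[where g = e]) (use k T in auto)
    let ?F = "insert s (k ` T)"
    define c where "c x = (if x \<in> k ` T then r (e x) else 0) - (if x = s then 1 else 0)" for x
    have sumc: "(\<Sum>x\<in>?F. c x * g x) = (\<Sum>b\<in>T. r b * g (k b)) - g s" for g :: "'s \<Rightarrow> rat"
    proof -
      have "(\<Sum>x\<in>?F. c x * g x) =
          (\<Sum>x\<in>?F. if x \<in> k ` T then r (e x) * g x else 0) - (\<Sum>x\<in>?F. if x = s then g x else 0)"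
        unfolding sum_subtractf[symmetric] c_def by (intro sum.cong) (auto simp: algebra_simps)
      also have "(\<Sum>x\<in>?F. if x = s then g x else 0) = g s"
        using T by (subst sum.delta) auto
      also have "(\<Sum>x\<in>?F. if x \<in> k ` T then r (e x) * g x else 0) = (\<Sum>x\<in>k ` T. r (e x) * g x)"
        using T by (intro sum.mono_neutral_cong_right) auto
      also have "\<dots> = (\<Sum>b\<in>T. r b * g (k b))"
        unfolding sum.reindex[OF inj] using k T by (intro sum.cong) auto
      finally show ?thesis .
    qed
    have "(\<Sum>x\<in>?F. c x * e x v) = 0" for v
    proof -
      have "e s v = (\<Sum>b\<in>T. r b * b v)"
        unfolding T(3) by (induction T rule: infinite_finite_induct) (simp_all add: sc_def)
      also have "\<dots> = (\<Sum>b\<in>T. r b * e (k b) v)"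
        using k T by (intro sum.cong) auto
      finally show ?thesis
        using sumc[of "\<lambda>x. e x v"] by simp
    qed
    then have "(\<Sum>x\<in>?F. c x * \<phi> x) = 0"
      by (intro rel) (use T k s in auto)
    then have "\<phi> s = (\<Sum>b\<in>T. r b * \<phi> (k b))"
      by (simp add: sumc)
    also have "\<dots> = (\<Sum>b\<in>T. r b * \<psi> b)"
      using \<psi>(2) T by (intro sum.cong) auto
    also have "\<dots> = \<psi> (e s)"
      by (simp add: T(3) \<psi>.sum \<psi>.scale)
    finally show "\<psi> (e s) = \<phi> s" by simp
  qed
qed

lemma cochain_pairing_diff: "cochain_pairing \<phi> (a - b) = cochain_pairing \<phi> a - cochain_pairing \<phi> b"
  using cochain_pairing_add[of \<phi> "a - b" b] by simp

lemma cochain_pairing_sum_smult: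
  "cochain_pairing (\<lambda>s. \<Sum>v\<in>T. a v * f v s) c = (\<Sum>v\<in>T. a v * cochain_pairing (f v) c)"
  unfolding cochain_pairing_def sum_distrib_left
  by (subst sum.swap) (simp add: algebra_simps)

text \<open>The boundaries of the simplices satisfy no more relations than the values of \<open>\<phi>\<close>, so
  \<open>\<phi>\<close> factors through the boundary operator by a functional on the rational chains.\<close>

lemma coboundary_if_vanishes_on_cycles:
  assumes \<phi>: "singular_cochain p X \<phi>"
    and van: "\<And>c. singular_relcycle p X {} c \<Longrightarrow> cochain_pairing \<phi> c = 0"
  shows "\<phi> \<in> coboundaries p X"
proof (cases p)
  case 0
  have "\<phi> s = 0" for s
  proof (cases "singular_simplex p X s")
    case True
    then have "singular_relcycle p X {} (frag_of s)"
      by (simp add: singular_cycle singular_chain_of chain_boundary_of 0)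
    from van[OF this] show ?thesis by simp
  qed (use \<phi> in \<open>simp add: singular_cochain_def\<close>)
  then show ?thesis by (auto simp: coboundaries_def 0)
next
  case (Suc q)
  define emb :: "'a chain \<Rightarrow> ((nat \<Rightarrow> real) \<Rightarrow> 'a) \<Rightarrow> rat"
    where "emb c = (\<lambda>v. of_int (Poly_Mapping.lookup c v))" for c
  define e where "e s = emb (chain_boundary p (frag_of s))" for s
  have emb_diff: "emb (a - b) = emb a - emb b" for a b
    by (auto simp: emb_def lookup_minus fun_eq_iff)
  have rel: "(\<Sum>s\<in>F. r s * \<phi> s) = 0"
    if F: "finite F" "F \<subseteq> singular_simplex_set p X" and r: "\<And>v. (\<Sum>s\<in>F. r s * e s v) = 0" for F r
  proof -
    \<comment> \<open>Multiplying the relation by \<open>N\<close> gives an integral chain with zero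
      boundary, on which \<phi> vanishes by assumption.\<close>
    obtain N m where N: "N \<noteq> 0" "\<And>s. s \<in> F \<Longrightarrow> of_int N * r s = of_int (m s)"
      using common_denominator[OF F(1), of r] by blast
    define c where "c = (\<Sum>s\<in>F. frag_cmul (m s) (frag_of s))"
    have "chain_boundary p c = 0"
    proof (rule poly_mapping_eqI)
      fix v
      have "rat_of_int (Poly_Mapping.lookup (chain_boundary p c) v) = (\<Sum>s\<in>F. of_int (m s) * e s v)"
        using F(1) by (simp add: c_def chain_boundary_sum chain_boundary_cmul lookup_sum e_def emb_def)
      also have "\<dots> = (\<Sum>s\<in>F. of_int N * (r s * e s v))"
        by (intro sum.cong) (simp_all flip: N(2) mult.assoc)
      also have "\<dots> = 0"
        by (simp add: r flip: sum_distrib_left)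
      finally show "Poly_Mapping.lookup (chain_boundary p c) v = Poly_Mapping.lookup 0 v"
        by simp
    qed
    moreover have "singular_chain p X c"
      unfolding c_def
      by (intro singular_chain_sum singular_chain_cmul) (use F in \<open>auto simp: singular_chain_of\<close>)
    ultimately have "0 = cochain_pairing \<phi> c"
      by (simp add: van singular_cycle)
    also have "\<dots> = (\<Sum>s\<in>F. of_int (m s) * \<phi> s)"
      by (simp add: c_def cochain_pairing_sum cochain_pairing_cmul)
    also have "\<dots> = (\<Sum>s\<in>F. of_int N * (r s * \<phi> s))"
      by (intro sum.cong) (simp_all flip: N(2) mult.assoc)
    finally show ?thesis
      using N(1) by (simp flip: sum_distrib_left)
  qed
  \<comment> \<open>Additivity without homogeneity is enough, since \<psi> is evaluated only on
    integral chains, which arise from simplices by differences.\<close>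
  obtain \<psi> where add: "\<And>x y. \<psi> (x + y) = \<psi> x + \<psi> y"
      and \<psi>: "\<And>s. singular_simplex p X s \<Longrightarrow> \<psi> (e s) = \<phi> s"
    by (rule rat_functional_extension[where S = "singular_simplex_set p X" and e = e and \<phi> = \<phi>])
      (use rel in auto)
  have diff: "\<psi> (x - y) = \<psi> x - \<psi> y" for x y
    using add[of "x - y" y] by simp
  have \<psi>_diff: "\<psi> (emb (a - b)) = \<psi> (emb a) - \<psi> (emb b)" for a b
    unfolding emb_diff by (rule diff)
  define \<psi>' where "\<psi>' t = (if singular_simplex q X t then \<psi> (emb (frag_of t)) else 0)" for t
  have pair: "cochain_pairing \<psi>' c = \<psi> (emb c)" if "singular_chain q X c" for c
  proof -
    have "Poly_Mapping.keys c \<subseteq> singular_simplex_set q X"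
      using that by (simp add: singular_chain_def)
    then show ?thesis
    proof (induction c rule: frag_induction)
      case zero
      have "\<psi> (emb 0) = 0"
        using diff[of 0 0] by (simp add: emb_def zero_fun_def)
      then show ?case by simp
    qed (auto simp: \<psi>'_def cochain_pairing_diff \<psi>_diff)
  qed
  have "coboundary q X \<psi>' = \<phi>"
  proof
    fix s show "coboundary q X \<psi>' s = \<phi> s"
    proof (cases "singular_simplex p X s")
      case True
      then have "singular_chain q X (chain_boundary p (frag_of s))"
        using singular_chain_boundary[of p X "frag_of s"] Suc by (simp add: singular_chain_of)
      with True show ?thesis
        using \<psi>[OF True] by (simp add: coboundary_eq_pairing Suc pair e_def)
    qed (use \<phi> in \<open>simp add: singular_cochain_def coboundary_def Suc\<close>)
  qed
  moreover have "singular_cochain q X \<psi>'"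
    by (simp add: singular_cochain_def \<psi>'_def)
  ultimately show ?thesis
    by (auto simp: coboundaries_def Suc)
qed

section \<open>Arithmetic of cohomology classes\<close>

definition cohomology_class :: "nat \<Rightarrow> 'a topology \<Rightarrow> 'a cochain \<Rightarrow> 'a cochain set" where
  "cohomology_class p X \<phi> = coboundaries p X +>\<^bsub>cocycle_module p X\<^esub> \<phi>"

lemma abelian_subgroup_coboundaries: "abelian_subgroup (coboundaries p X) (cocycle_module p X)"
proof -
  interpret module rat_ring "cocycle_module p X" by (rule module_cocycle_module)
  have "subgroup (coboundaries p X) (add_monoid (cocycle_module p X))"
  proof (rule M.add.subgroupI)
    fix \<phi> assume \<phi>: "\<phi> \<in> coboundaries p X"
    have "(\<lambda>s. - 1 * \<phi> s) \<in> coboundaries p X"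
      by (rule coboundaries_closed(3)[OF \<phi>])
    moreover have "\<ominus>\<^bsub>cocycle_module p X\<^esub> \<phi> = (\<lambda>s. - 1 * \<phi> s)"
      by (rule M.minus_equality)
        (use \<phi> calculation coboundaries_subset[of p X] in \<open>auto simp: cocycle_module_simps(2,3)\<close>)
    ultimately show "\<ominus>\<^bsub>cocycle_module p X\<^esub> \<phi> \<in> coboundaries p X"
      by simp
  next
    show "coboundaries p X \<noteq> {}"
      using coboundaries_closed(1) by fast
  qed (use coboundaries_subset[of p X] coboundaries_closed in \<open>auto simp: cocycle_module_simps(3)\<close>)
  then show ?thesis
    using M.abelian_group_axioms by (intro abelian_subgroupI3 additive_subgroup.intro)
qed

lemma carrier_singular_cohomology:
  "carrier (singular_cohomology p X) = cohomology_class p X ` carrier (cocycle_module p X)"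
  by (auto simp: singular_cohomology_def quotient_module_def A_RCOSETS_def' cohomology_class_def)

lemma cohomology_class_eq_zero:
  assumes "\<phi> \<in> carrier (cocycle_module p X)"
  shows "cohomology_class p X \<phi> = \<zero>\<^bsub>singular_cohomology p X\<^esub> \<longleftrightarrow> \<phi> \<in> coboundaries p X"
proof -
  interpret N: abelian_subgroup "coboundaries p X" "cocycle_module p X"
    by (rule abelian_subgroup_coboundaries)
  have "cohomology_class p X \<phi> = \<zero>\<^bsub>singular_cohomology p X\<^esub> \<longleftrightarrow>
      coboundaries p X +>\<^bsub>cocycle_module p X\<^esub> \<phi> = coboundaries p X"
    by (simp add: singular_cohomology_def quotient_module_def cohomology_class_def)
  also have "\<dots> \<longleftrightarrow> \<phi> \<in> coboundaries p X"
    using assms N.a_coset_join1[OF _ assms N.a_subgroup] N.a_coset_join2[OF assms N.a_subgroup] by blast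
  finally show ?thesis .
qed

lemma cohomology_class_add:
  assumes "\<phi> \<in> carrier (cocycle_module p X)" "\<psi> \<in> carrier (cocycle_module p X)"
  shows "cohomology_class p X \<phi> \<oplus>\<^bsub>singular_cohomology p X\<^esub> cohomology_class p X \<psi> =
    cohomology_class p X (\<lambda>s. \<phi> s + \<psi> s)"
proof -
  interpret N: abelian_subgroup "coboundaries p X" "cocycle_module p X"
    by (rule abelian_subgroup_coboundaries)
  show ?thesis
    using N.a_rcos_sum[OF assms]
    by (simp add: singular_cohomology_def quotient_module_def cohomology_class_def cocycle_module_simps)
qed

text \<open>The scalar multiple of a coset is formed with an extra summand from the coboundaries, so
  an element carries two coboundaries \<open>b\<close> and \<open>a * c\<close>. They merge into
  one; for \<open>a = 0\<close> only \<open>b\<close> keeps the result a full coset.\<close>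

lemma cohomology_class_smult:
  "a \<odot>\<^bsub>singular_cohomology p X\<^esub> cohomology_class p X \<phi> = cohomology_class p X (\<lambda>s. a * \<phi> s)"
proof -
  let ?B = "coboundaries p X"
  have "{h. \<exists>b\<in>?B. \<exists>c\<in>?B. h = (\<lambda>s. b s + a * (c s + \<phi> s))} = {h. \<exists>b\<in>?B. h = (\<lambda>s. b s + a * \<phi> s)}"
  proof (intro Collect_cong iffI)
    fix h assume "\<exists>b\<in>?B. \<exists>c\<in>?B. h = (\<lambda>s. b s + a * (c s + \<phi> s))"
    then obtain b c where bc: "b \<in> ?B" "c \<in> ?B" "h = (\<lambda>s. b s + a * (c s + \<phi> s))" by blast
    then have "(\<lambda>s. b s + a * c s) \<in> ?B"
      by (intro coboundaries_closed)
    with bc(3) show "\<exists>b\<in>?B. h = (\<lambda>s. b s + a * \<phi> s)"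
      by (intro bexI[of _ "\<lambda>s. b s + a * c s"]) (auto simp: algebra_simps)
  next
    fix h assume "\<exists>b\<in>?B. h = (\<lambda>s. b s + a * \<phi> s)"
    then show "\<exists>b\<in>?B. \<exists>c\<in>?B. h = (\<lambda>s. b s + a * (c s + \<phi> s))"
      using coboundaries_closed(1)[of p X] by force
  qed
  moreover have "a \<odot>\<^bsub>singular_cohomology p X\<^esub> cohomology_class p X \<phi> =
      {h. \<exists>b\<in>?B. \<exists>c\<in>?B. h = (\<lambda>s. b s + a * (c s + \<phi> s))}"
    by (auto simp: singular_cohomology_def quotient_module_def cohomology_class_def a_r_coset_def'
        set_add_def' cocycle_module_simps)
  moreover have "cohomology_class p X (\<lambda>s. a * \<phi> s) = {h. \<exists>b\<in>?B. h = (\<lambda>s. b s + a * \<phi> s)}"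
    by (auto simp: cohomology_class_def a_r_coset_def' cocycle_module_simps)
  ultimately show ?thesis by simp
qed

lemma cocycle_sum:
  assumes "\<And>v. v \<in> T \<Longrightarrow> f v \<in> carrier (cocycle_module p X)"
  shows "(\<lambda>s. \<Sum>v\<in>T. a v * f v s) \<in> carrier (cocycle_module p X)"
  using assms
proof (induction T rule: infinite_finite_induct)
  case (insert x T)
  then show ?case
    by (auto simp: cocycle_module_simps singular_cochain_def coboundary_add coboundary_smult)
qed (auto simp: cocycle_module_simps singular_cochain_def coboundary_0)

lemma finsum_cohomology_class:
  assumes "finite T" "\<And>v. v \<in> T \<Longrightarrow> f v \<in> carrier (cocycle_module p X)"
  shows "(\<Oplus>\<^bsub>singular_cohomology p X\<^esub>v\<in>T. a v \<odot>\<^bsub>singular_cohomology p X\<^esub> cohomology_class p X (f v)) =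
    cohomology_class p X (\<lambda>s. \<Sum>v\<in>T. a v * f v s)"
proof -
  interpret H: module rat_ring "singular_cohomology p X" by (rule module_singular_cohomology)
  have mem: "cohomology_class p X (\<lambda>s. a v * f v s) \<in> carrier (singular_cohomology p X)"
    if "f v \<in> carrier (cocycle_module p X)" for v
    using cocycle_sum[of "{v}" f p X a] that by (simp add: carrier_singular_cohomology)
  show ?thesis
    using assms
  proof (induction T)
    case empty
    have "(\<lambda>s. 0) \<in> carrier (cocycle_module p X)"
      by (auto simp: cocycle_module_simps singular_cochain_def coboundary_0)
    then show ?case
      using cohomology_class_eq_zero[of "\<lambda>s. 0" p X] coboundaries_closed(1)[of p X] by simp
  next
    case (insert x T)
    have fx: "f x \<in> carrier (cocycle_module p X)" "(\<lambda>s. a x * f x s) \<in> carrier (cocycle_module p X)"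
      using insert.prems cocycle_sum[of "{x}" f p X a] by auto
    show ?case
      using insert fx
      by (simp add: Pi_I mem H.finsum_insert cohomology_class_smult cohomology_class_add cocycle_sum)
  qed
qed

text \<open>The dual of \<tau> is injective on cohomology: if the pullback of a cocycle \<phi> is a
  coboundary, then \<phi> vanishes on every \<open>\<tau> i c'\<close>, hence on a nonzero multiple
  of every cycle, hence on every cycle, and so it is a coboundary. Finite independent sets of
  classes are carried to independent sets of the same size, which also covers infinite Betti
  numbers.\<close>

lemma betti_le_if_rationally_surjective:
  fixes \<tau> :: "nat \<Rightarrow> 'b chain \<Rightarrow> 'a chain"
  assumes diff: "\<And>q a b. \<tau> q (a - b) = \<tau> q a - \<tau> q b"
    and chain: "\<And>q c. singular_chain q Y c \<Longrightarrow> singular_chain q X (\<tau> q c)"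
    and boundary: "\<And>q c. singular_chain (Suc q) Y c \<Longrightarrow>
      chain_boundary (Suc q) (\<tau> (Suc q) c) = \<tau> q (chain_boundary (Suc q) c)"
    and surj: "\<And>c. singular_relcycle i X {} c \<Longrightarrow>
      \<exists>N c'. N \<noteq> 0 \<and> singular_relcycle i Y {} c' \<and> homologous_rel i X {} (\<tau> i c') (frag_cmul N c)"
  shows "betti i X \<le> betti i Y"
proof -
  define F where "F \<phi> s = (if singular_simplex i Y s then cochain_pairing \<phi> (\<tau> i (frag_of s)) else 0)"
    for \<phi> s
  have pairF: "cochain_pairing (F \<phi>) c = cochain_pairing \<phi> (\<tau> i c)" if "singular_chain i Y c" for \<phi> c
  proof -
    have "Poly_Mapping.keys c \<subseteq> singular_simplex_set i Y"
      using that by (simp add: singular_chain_def)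
    then show ?thesis
    proof (induction c rule: frag_induction)
      case zero
      show ?case using diff[of i 0 0] by simp
    qed (auto simp: F_def cochain_pairing_diff diff)
  qed
  have F: "F \<phi> \<in> carrier (cocycle_module i Y)" if "\<phi> \<in> carrier (cocycle_module i X)" for \<phi>
  proof -
    have "coboundary i Y (F \<phi>) s = 0" for s
    proof (cases "singular_simplex (Suc i) Y s")
      case True
      then have s: "singular_chain (Suc i) Y (frag_of s)"
        by (simp add: singular_chain_of)
      have "coboundary i Y (F \<phi>) s = cochain_pairing \<phi> (chain_boundary (Suc i) (\<tau> (Suc i) (frag_of s)))"
        using True singular_chain_boundary[OF s]
        by (simp add: coboundary_eq_pairing pairF boundary[OF s])
      also have "\<dots> = cochain_pairing (coboundary i X \<phi>) (\<tau> (Suc i) (frag_of s))"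
        by (rule cochain_pairing_coboundary[symmetric]) (rule chain[OF s])
      finally show ?thesis
        using that by (simp add: cocycle_module_simps cochain_pairing_def)
    qed (simp add: coboundary_def)
    then show ?thesis
      by (auto simp: cocycle_module_simps singular_cochain_def F_def)
  qed
  have cyc0: "cochain_pairing \<phi> c = 0"
    if \<phi>: "\<phi> \<in> coboundaries q Z" and c: "singular_relcycle q Z {} c" for \<phi> q c and Z :: "'c topology"
  proof (cases q)
    case (Suc q')
    then obtain \<psi> where "\<phi> = coboundary q' Z \<psi>"
      using \<phi> by (auto simp: coboundaries_def)
    with c show ?thesis
      by (simp add: Suc singular_cycle cochain_pairing_coboundary)
  qed (use \<phi> in \<open>simp add: coboundaries_def cochain_pairing_def\<close>)
  have Finj: "\<phi> \<in> coboundaries i X"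
    if \<phi>: "\<phi> \<in> carrier (cocycle_module i X)" and "F \<phi> \<in> coboundaries i Y" for \<phi>
  proof (rule coboundary_if_vanishes_on_cycles)
    show "singular_cochain i X \<phi>" using \<phi> by (simp add: cocycle_module_simps)
    fix c assume "singular_relcycle i X {} c"
    then obtain N c' where N: "N \<noteq> 0" and c': "singular_relcycle i Y {} c'"
        and h: "homologous_rel i X {} (\<tau> i c') (frag_cmul N c)"
      using surj by blast
    obtain d where d: "singular_chain (Suc i) X d" "chain_boundary (Suc i) d = \<tau> i c' - frag_cmul N c"
      using h by (auto simp: homologous_rel_def singular_boundary)
    have "cochain_pairing \<phi> (\<tau> i c') = cochain_pairing (F \<phi>) c'"
      using c' by (simp add: pairF singular_cycle)
    also have "\<dots> = 0"
      by (rule cyc0) fact+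
    finally have "cochain_pairing \<phi> (chain_boundary (Suc i) d) = - (of_int N * cochain_pairing \<phi> c)"
      by (simp add: d(2) cochain_pairing_diff cochain_pairing_cmul)
    moreover have "cochain_pairing \<phi> (chain_boundary (Suc i) d) = 0"
      using \<phi> d(1) by (simp flip: cochain_pairing_coboundary) (simp add: cocycle_module_simps cochain_pairing_def)
    ultimately show "cochain_pairing \<phi> c = 0"
      using N by simp
  qed
  have Fsum: "F (\<lambda>s. \<Sum>v\<in>T. a v * f v s) = (\<lambda>s. \<Sum>v\<in>T. a v * F (f v) s)" for T :: "'z set" and a f
    by (auto simp: F_def cochain_pairing_sum_smult)
  let ?HX = "singular_cohomology i X" and ?HY = "singular_cohomology i Y"
  interpret HX: module rat_ring ?HX by (rule module_singular_cohomology)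
  interpret HY: module rat_ring ?HY by (rule module_singular_cohomology)
  show ?thesis
    unfolding betti_def module_dim_def
  proof (rule SUP_mono)
    fix S assume "S \<in> {S. finite S \<and> module_independent rat_ring ?HX S}"
    then have S: "finite S" "S \<subseteq> carrier ?HX" and S_ind: "module_independent rat_ring ?HX S"
      by (auto simp: module_independent_def)
    have ind: "\<forall>v\<in>T. a v = 0"
      if "T \<subseteq> S" "(\<Oplus>\<^bsub>?HX\<^esub>v\<in>T. a v \<odot>\<^bsub>?HX\<^esub> v) = \<zero>\<^bsub>?HX\<^esub>" for T a
    proof -
      have "finite T \<and> T \<subseteq> S \<and> a \<in> T \<rightarrow> carrier rat_ring \<and> (\<Oplus>\<^bsub>?HX\<^esub>v\<in>T. a v \<odot>\<^bsub>?HX\<^esub> v) = \<zero>\<^bsub>?HX\<^esub>"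
        using that finite_subset[OF that(1) S(1)] by (simp add: rat_ring_def)
      then have "\<forall>v\<in>T. a v = \<zero>\<^bsub>rat_ring\<^esub>"
        using S_ind unfolding module_independent_def by blast
      then show ?thesis by (simp add: rat_ring_def)
    qed
    define r where "r C = (SOME \<phi>. \<phi> \<in> carrier (cocycle_module i X) \<and> cohomology_class i X \<phi> = C)" for C
    have r: "r C \<in> carrier (cocycle_module i X)" "cohomology_class i X (r C) = C" if "C \<in> S" for C
    proof -
      have "\<exists>\<phi>. \<phi> \<in> carrier (cocycle_module i X) \<and> cohomology_class i X \<phi> = C"
        using that S by (auto simp: carrier_singular_cohomology)
      from someI_ex[OF this] show "r C \<in> carrier (cocycle_module i X)" "cohomology_class i X (r C) = C"
        unfolding r_def by blast+
    qed
    define im where "im C = cohomology_class i Y (F (r C))" for C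
    have im: "im C \<in> carrier ?HY" if "C \<in> S" for C
      using r[OF that] F by (auto simp: im_def carrier_singular_cohomology)
    have key: "\<forall>C\<in>T. a C = 0"
      if T: "T \<subseteq> S" and zero: "(\<Oplus>\<^bsub>?HY\<^esub>C\<in>T. a C \<odot>\<^bsub>?HY\<^esub> im C) = \<zero>\<^bsub>?HY\<^esub>" for T a
    proof (rule ind[OF T])
      have fin: "finite T" using T S finite_subset by blast
      have rT: "r C \<in> carrier (cocycle_module i X)" "F (r C) \<in> carrier (cocycle_module i Y)" if "C \<in> T" for C
        using r T F that by blast+
      have "cohomology_class i Y (\<lambda>s. \<Sum>C\<in>T. a C * F (r C) s) = \<zero>\<^bsub>?HY\<^esub>"
        using zero rT fin unfolding im_def by (subst (asm) finsum_cohomology_class) auto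
      then have "F (\<lambda>s. \<Sum>C\<in>T. a C * r C s) \<in> coboundaries i Y"
        using rT by (simp add: cohomology_class_eq_zero cocycle_sum Fsum)
      then have "(\<lambda>s. \<Sum>C\<in>T. a C * r C s) \<in> coboundaries i X"
        using rT by (intro Finj cocycle_sum)
      then have "cohomology_class i X (\<lambda>s. \<Sum>C\<in>T. a C * r C s) = \<zero>\<^bsub>?HX\<^esub>"
        using rT by (simp add: cohomology_class_eq_zero cocycle_sum)
      then have "(\<Oplus>\<^bsub>?HX\<^esub>C\<in>T. a C \<odot>\<^bsub>?HX\<^esub> cohomology_class i X (r C)) = \<zero>\<^bsub>?HX\<^esub>"
        using rT fin by (subst finsum_cohomology_class) auto
      moreover have "(\<Oplus>\<^bsub>?HX\<^esub>C\<in>T. a C \<odot>\<^bsub>?HX\<^esub> cohomology_class i X (r C)) = (\<Oplus>\<^bsub>?HX\<^esub>C\<in>T. a C \<odot>\<^bsub>?HX\<^esub> C)"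
        by (rule HX.finsum_cong')
          (use T S r in \<open>auto intro!: HX.smult_closed simp: rat_ring_def subset_eq\<close>)
      ultimately show "(\<Oplus>\<^bsub>?HX\<^esub>C\<in>T. a C \<odot>\<^bsub>?HX\<^esub> C) = \<zero>\<^bsub>?HX\<^esub>"
        by simp
    qed
    \<comment> \<open>Needed besides \<open>key\<close>, because independence of a set does not
      notice that two members of \<open>S\<close> were identified. Such a coincidence would be a
      relation with coefficients 1 and -1.\<close>
    have inj: "inj_on im S"
    proof (rule inj_onI, rule ccontr)
      fix C D assume CD: "C \<in> S" "D \<in> S" "im C = im D" "C \<noteq> D"
      define a :: "'a cochain set \<Rightarrow> rat" where "a E = (if E = C then 1 else - 1)" for E
      have "(\<Oplus>\<^bsub>?HY\<^esub>E\<in>{C, D}. a E \<odot>\<^bsub>?HY\<^esub> im E) = \<one>\<^bsub>rat_ring\<^esub> \<odot>\<^bsub>?HY\<^esub> im C \<oplus>\<^bsub>?HY\<^esub> (- 1) \<odot>\<^bsub>?HY\<^esub> im C"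
        using CD im by (simp add: a_def HY.finsum_insert HY.smult_closed rat_ring_def)
      also have "\<dots> = (\<one>\<^bsub>rat_ring\<^esub> \<oplus>\<^bsub>rat_ring\<^esub> (- 1)) \<odot>\<^bsub>?HY\<^esub> im C"
        using CD im by (subst HY.smult_l_distr) (auto simp: rat_ring_def)
      also have "\<dots> = \<zero>\<^bsub>rat_ring\<^esub> \<odot>\<^bsub>?HY\<^esub> im C"
        by (simp add: rat_ring_def)
      also have "\<dots> = \<zero>\<^bsub>?HY\<^esub>"
        using CD im by simp
      finally have "\<forall>E\<in>{C, D}. a E = 0"
        using CD by (intro key) auto
      then show False by (simp add: a_def)
    qed
    have "module_independent rat_ring ?HY (im ` S)"
      unfolding module_independent_def
    proof (intro conjI allI impI)
      show "im ` S \<subseteq> carrier ?HY" using im by blast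
      fix T' a assume *: "finite T' \<and> T' \<subseteq> im ` S \<and> a \<in> T' \<rightarrow> carrier rat_ring \<and>
        (\<Oplus>\<^bsub>?HY\<^esub>v\<in>T'. a v \<odot>\<^bsub>?HY\<^esub> v) = \<zero>\<^bsub>?HY\<^esub>"
      obtain T where T: "T \<subseteq> S" "T' = im ` T"
        using * by (meson subset_imageE)
      have "(\<Oplus>\<^bsub>?HY\<^esub>C\<in>T. a (im C) \<odot>\<^bsub>?HY\<^esub> im C) = (\<Oplus>\<^bsub>?HY\<^esub>v\<in>T'. a v \<odot>\<^bsub>?HY\<^esub> v)"
        unfolding T(2)
        by (rule HY.finsum_reindex[symmetric])
          (use T S im inj in \<open>auto intro: inj_on_subset intro!: HY.smult_closed simp: rat_ring_def subset_eq\<close>)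
      then have "\<forall>C\<in>T. a (im C) = 0"
        using * T by (intro key) auto
      then show "\<forall>v\<in>T'. a v = \<zero>\<^bsub>rat_ring\<^esub>"
        using T by (auto simp: rat_ring_def)
    qed
    then show "\<exists>m\<in>{S. finite S \<and> module_independent rat_ring ?HY S}. enat (card S) \<le> enat (card m)"
      using S inj by (intro bexI[of _ "im ` S"]) (auto simp: card_image)
  qed
qed

section \<open>Locally finite families of bump functions\<close>

lemma continuous_map_locally:
  assumes "\<And>x. x \<in> topspace X \<Longrightarrow> \<exists>U. openin X U \<and> x \<in> U \<and> continuous_map (subtopology X U) Y f"
  shows "continuous_map X Y f"
  unfolding continuous_map_def
proof (intro conjI allI impI)
  show "f \<in> topspace X \<rightarrow> topspace Y"
  proof
    fix x assume x: "x \<in> topspace X"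
    obtain U where "openin X U" "x \<in> U" "continuous_map (subtopology X U) Y f"
      using assms[OF x] by blast
    with x show "f x \<in> topspace Y"
      by (force simp: continuous_map_def)
  qed
  fix V assume V: "openin Y V"
  show "openin X {x \<in> topspace X. f x \<in> V}"
  proof (subst openin_subopen, intro ballI)
    fix x assume x: "x \<in> {x \<in> topspace X. f x \<in> V}"
    then obtain U where U: "openin X U" "x \<in> U" "continuous_map (subtopology X U) Y f"
      using assms by blast
    then have "openin (subtopology X U) {x \<in> topspace (subtopology X U). f x \<in> V}"
      using V by (simp add: continuous_map_def)
    then have "openin X {x \<in> topspace (subtopology X U). f x \<in> V}"
      using U(1) openin_trans_full by blast
    then show "\<exists>T. openin X T \<and> x \<in> T \<and> T \<subseteq> {x \<in> topspace X. f x \<in> V}"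
      using x U by (intro exI[of _ "{x \<in> topspace (subtopology X U). f x \<in> V}"]) auto
  qed
qed

text \<open>Subtracting from \<open>f\<^sub>k\<close> the multiple \<open>k (f\<^sub>0 + \<dots> + f\<^sub>k\<^sub>-\<^sub>1)\<close> makes a countable family locally finite:
  where some \<open>f\<^sub>j\<close> is at least \<open>1/m\<close>, all the later functions from \<open>m\<close> on are cut off.\<close>

lemma locally_finite_bumps:
  fixes f :: "'a \<Rightarrow> 'a \<Rightarrow> real"
  assumes "Lindelof_space X" "topspace X \<noteq> {}"
    and cont: "\<And>p. p \<in> topspace X \<Longrightarrow> continuous_map X euclideanreal (f p)"
    and f: "\<And>p x. 0 \<le> f p x" "\<And>p x. f p x \<le> 1" "\<And>p. p \<in> topspace X \<Longrightarrow> 0 < f p p"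
  obtains P :: "nat \<Rightarrow> 'a" and \<rho> :: "nat \<Rightarrow> 'a \<Rightarrow> real" where
    "\<And>k. P k \<in> topspace X" "\<And>k. continuous_map X euclideanreal (\<rho> k)"
    "\<And>k x. 0 \<le> \<rho> k x" "\<And>k x. \<rho> k x \<le> f (P k) x"
    "\<And>x. x \<in> topspace X \<Longrightarrow> \<exists>k. 0 < \<rho> k x"
    "\<And>x. x \<in> topspace X \<Longrightarrow> \<exists>U K. openin X U \<and> x \<in> U \<and> (\<forall>k\<ge>K. \<forall>y\<in>U. \<rho> k y = 0)"
proof -
  define O' where "O' p = {x \<in> topspace X. f p x \<in> {0<..}}" for p
  have "openin X (O' p)" if "p \<in> topspace X" for p
    unfolding O'_def by (rule openin_continuous_map_preimage[OF cont[OF that]]) simp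
  then have "\<And>U. U \<in> O' ` topspace X \<Longrightarrow> openin X U" by blast
  moreover have "\<Union>(O' ` topspace X) = topspace X"
    using f(3) by (auto simp: O'_def)
  ultimately obtain \<V> where \<V>: "countable \<V>" "\<V> \<subseteq> O' ` topspace X" "\<Union>\<V> = topspace X"
    using Lindelof_spaceD[OF assms(1), of "O' ` topspace X"] by metis
  then obtain S where S: "countable S" "S \<subseteq> topspace X" "\<V> = O' ` S"
    by (meson countable_subset_image)
  have "S \<noteq> {}" using \<V>(3) S(3) assms(2) by (metis Union_empty image_empty)
  with S(1) obtain P :: "nat \<Rightarrow> 'a" where P: "range P = S"
    by (metis uncountable_def)
  have PX: "P k \<in> topspace X" for k
    using P S(2) by blast
  define s where "s k x = (\<Sum>j<k. f (P j) x)" for k x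
  define \<rho> where "\<rho> k x = max 0 (f (P k) x - real k * s k x)" for k x
  have s0: "0 \<le> s k x" for k x by (simp add: s_def f sum_nonneg)
  have act: "\<exists>k. 0 < f (P k) x" if "x \<in> topspace X" for x
    using that \<V>(3) S(3) P by (auto simp: O'_def)
  show ?thesis
  proof (rule that[of P \<rho>])
    show "P k \<in> topspace X" for k by (rule PX)
    show "continuous_map X euclideanreal (\<rho> k)" for k
      unfolding \<rho>_def s_def
      by (intro continuous_map_real_max continuous_map_diff continuous_map_real_mult continuous_map_sum
          cont PX continuous_map_const[THEN iffD2]) auto
    show "0 \<le> \<rho> k x" for k x by (simp add: \<rho>_def)
    show "\<rho> k x \<le> f (P k) x" for k x by (simp add: \<rho>_def f s0)
    fix x assume x: "x \<in> topspace X"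
    \<comment> \<open>At the first index whose function is positive at \<open>x\<close> nothing has
      been subtracted yet, so positivity survives the cut-off.\<close>
    define j where "j = (LEAST k. 0 < f (P k) x)"
    have j: "0 < f (P j) x" unfolding j_def by (rule LeastI_ex) (rule act[OF x])
    have "f (P k) x = 0" if "k < j" for k
      using not_less_Least[OF that[unfolded j_def]] f(1)[of "P k" x] by linarith
    then have "s j x = 0" by (simp add: s_def)
    with j show "\<exists>k. 0 < \<rho> k x"
      by (intro exI[of _ j]) (simp add: \<rho>_def)
    obtain m :: nat where m: "0 < m" "1 / m < f (P j) x"
      using j nat_approx_posE[OF j] by (metis zero_less_Suc)
    define U where "U = {y \<in> topspace X. f (P j) y \<in> {1 / m<..}}"
    have "openin X U"
      unfolding U_def by (rule openin_continuous_map_preimage[OF cont[OF PX]]) simp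
    moreover have "\<rho> k y = 0" if k: "max m (Suc j) \<le> k" and y: "y \<in> U" for k y
    proof -
      have "1 / m \<le> f (P j) y" using y by (simp add: U_def)
      also have "\<dots> \<le> s k y"
        unfolding s_def by (rule member_le_sum) (use k f in auto)
      finally have "1 \<le> real m * s k y" using m(1) by (simp add: field_simps)
      also have "\<dots> \<le> real k * s k y"
        using k s0 by (intro mult_right_mono) auto
      finally show ?thesis
        using f(2)[of "P k" y] by (simp add: \<rho>_def)
    qed
    ultimately show "\<exists>U K. openin X U \<and> x \<in> U \<and> (\<forall>k\<ge>K. \<forall>y\<in>U. \<rho> k y = 0)"
      using x m by (intro exI[of _ U] exI[of _ "max m (Suc j)"]) (auto simp: U_def)
  qed
qed

section \<open>Continuous positive functions below local bounds\<close>

text \<open>Locally finite bumps replace a partition of unity: \<epsilon> is a sum of bumps weighted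
  by the local bounds, small enough that \<open>\<epsilon> x\<close> cannot exceed all the bounds
  \<open>\<delta> (P k)\<close> of the bumps active at \<open>x\<close>. Hence each
  \<open>t \<le> \<epsilon> x\<close> lies below the bound of one of them, and \<open>x\<close> lies
  in the corresponding neighbourhood.\<close>

lemma continuous_positive_below:
  fixes G :: "'a \<Rightarrow> real \<Rightarrow> bool"
  assumes "Lindelof_space X" "completely_regular_space X"
    and loc: "\<And>x. x \<in> topspace X \<Longrightarrow>
      \<exists>V \<delta>. openin X V \<and> x \<in> V \<and> 0 < \<delta> \<and> (\<forall>y\<in>V. \<forall>t. 0 < t \<and> t \<le> \<delta> \<longrightarrow> G y t)"
  obtains \<epsilon> :: "'a \<Rightarrow> real" where "continuous_map X euclideanreal \<epsilon>"
    "\<And>x. x \<in> topspace X \<Longrightarrow> 0 < \<epsilon> x"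
    "\<And>x t. x \<in> topspace X \<Longrightarrow> 0 < t \<Longrightarrow> t \<le> \<epsilon> x \<Longrightarrow> G x t"
proof (cases "topspace X = {}")
  case True
  show ?thesis
    by (rule that[of "\<lambda>x. 1"]) (auto simp: True)
next
  case False
  obtain V \<delta> where V: "\<And>x. x \<in> topspace X \<Longrightarrow> openin X (V x) \<and> x \<in> V x \<and> 0 < \<delta> x \<and>
      (\<forall>y\<in>V x. \<forall>t. 0 < t \<and> t \<le> \<delta> x \<longrightarrow> G y t)"
    using loc by metis
  have "\<exists>f. continuous_map X (top_of_set {0..1::real}) f \<and> f p = 1 \<and> (\<forall>x\<in>topspace X - V p. f x = 0)"
    if "p \<in> topspace X" for p
  proof -
    have "closedin X (topspace X - V p)" "p \<in> topspace X - (topspace X - V p)"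
      using V that by auto
    then obtain f where f: "continuous_map X (top_of_set {0..1::real}) f" "f p = 0"
        "f ` (topspace X - V p) \<subseteq> {1}"
      using assms(2) unfolding completely_regular_space_def by metis
    have "continuous_map X (top_of_set {0..1::real}) (\<lambda>x. 1 - f x)"
      using f(1) by (auto simp: continuous_map_in_subtopology intro!: continuous_map_diff)
    with f show ?thesis
      by (intro exI[of _ "\<lambda>x. 1 - f x"]) auto
  qed
  then obtain f where f: "\<And>p. p \<in> topspace X \<Longrightarrow> continuous_map X (top_of_set {0..1::real}) (f p) \<and>
      f p p = 1 \<and> (\<forall>x\<in>topspace X - V p. f p x = 0)"
    by metis
  \<comment> \<open>The bounds 0 and 1 are demanded at all arguments, so the Urysohn functions are
    extended by 0 where nothing is known about them.\<close>
  define f' where "f' p x = (if x \<in> topspace X \<and> p \<in> topspace X then f p x else 0)" for p x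
  have f01: "0 \<le> f' p x" "f' p x \<le> 1" for p x
    using f[of p] by (force simp: f'_def continuous_map_in_subtopology)+
  have f'pp: "0 < f' p p" if "p \<in> topspace X" for p
    using f[OF that] that by (simp add: f'_def)
  have contf': "continuous_map X euclideanreal (f' p)" if "p \<in> topspace X" for p
    by (rule continuous_map_eq[of _ _ "f p"])
      (use f[OF that] that in \<open>auto simp: f'_def continuous_map_in_subtopology\<close>)
  obtain P :: "nat \<Rightarrow> 'a" and \<rho> :: "nat \<Rightarrow> 'a \<Rightarrow> real" where P: "\<And>k. P k \<in> topspace X" and cont: "\<And>k. continuous_map X euclideanreal (\<rho> k)"
    and \<rho>0: "\<And>k x. 0 \<le> \<rho> k x" and \<rho>f: "\<And>k x. \<rho> k x \<le> f' (P k) x"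
    and act: "\<And>x. x \<in> topspace X \<Longrightarrow> \<exists>k. 0 < \<rho> k x"
    and lf: "\<And>x. x \<in> topspace X \<Longrightarrow> \<exists>U K. openin X U \<and> x \<in> U \<and> (\<forall>k\<ge>K. \<forall>y\<in>U. \<rho> k y = 0)"
    by (rule locally_finite_bumps[OF assms(1) False contf' f01 f'pp]) (assumption, assumption, (rule that; assumption))
  \<comment> \<open>The powers of 1/2 sum to 1, so \<epsilon> is bounded by a weighted average of
    the \<delta>'s; the minimum with 1 makes the series converge.\<close>
  define w where "w k = (1 / 2) ^ Suc k * min 1 (\<delta> (P k))" for k
  have w0: "0 < w k" for k using V[OF P[of k]] by (simp add: w_def)
  have \<rho>1: "\<rho> k x \<le> 1" for k x using \<rho>f f01 order_trans by blast
  define \<epsilon> where "\<epsilon> x = suminf (\<lambda>k. w k * \<rho> k x)" for x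
  have summ: "summable (\<lambda>k. w k * \<rho> k x)" for x
  proof (rule summable_comparison_test')
    show "summable (\<lambda>k. (1 / 2) ^ Suc k :: real)"
      by (simp add: summable_geometric)
    have "w k * \<rho> k x \<le> (1 / 2) ^ Suc k * 1" for k
      using \<rho>1 \<rho>0 V[OF P[of k]] unfolding w_def
      by (intro mult_mono) (auto intro: mult_left_le)
    then show "norm (w k * \<rho> k x) \<le> (1 / 2) ^ Suc k" for k
      using w0[of k] \<rho>0 by simp
  qed
  show ?thesis
  proof (rule that[of \<epsilon>])
    show "continuous_map X euclideanreal \<epsilon>"
    proof (rule continuous_map_locally)
      fix x assume "x \<in> topspace X"
      then obtain U K where U: "openin X U" "x \<in> U" "\<And>k y. K \<le> k \<Longrightarrow> y \<in> U \<Longrightarrow> \<rho> k y = 0"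
        using lf by metis
      have "continuous_map (subtopology X U) euclideanreal (\<lambda>y. \<Sum>k<K. w k * \<rho> k y)"
        by (intro continuous_map_sum continuous_map_real_mult continuous_map_from_subtopology cont
            continuous_map_const[THEN iffD2]) auto
      then have "continuous_map (subtopology X U) euclideanreal \<epsilon>"
      proof (rule continuous_map_eq)
        fix y assume "y \<in> topspace (subtopology X U)"
        then have "w k * \<rho> k y = 0" if "k \<notin> {..<K}" for k
          using U(3)[of k y] that by auto
        then show "(\<Sum>k<K. w k * \<rho> k y) = \<epsilon> y"
          unfolding \<epsilon>_def by (intro suminf_finite[symmetric]) auto
      qed
      with U show "\<exists>U. openin X U \<and> x \<in> U \<and> continuous_map (subtopology X U) euclideanreal \<epsilon>"
        by blast
    qed
    fix x assume x: "x \<in> topspace X"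
    obtain j where j: "0 < \<rho> j x" using act[OF x] by blast
    show "0 < \<epsilon> x"
      unfolding \<epsilon>_def by (rule suminf_pos2[OF summ, of _ j]) (use w0 \<rho>0 j in \<open>auto simp: less_imp_le\<close>)
    fix t assume t: "0 < t" "t \<le> \<epsilon> x"
    have "\<exists>k. 0 < \<rho> k x \<and> t \<le> \<delta> (P k)"
    proof (rule ccontr)
      assume neg: "\<nexists>k. 0 < \<rho> k x \<and> t \<le> \<delta> (P k)"
      have le: "w k * \<rho> k x \<le> (1 / 2) ^ Suc k * t" for k
      proof (cases "\<rho> k x = 0")
        case False
        then have "0 < \<rho> k x" using \<rho>0[of k x] by (simp add: less_le)
        then have "\<delta> (P k) < t" using neg by (meson not_le)
        then have "w k * \<rho> k x \<le> ((1 / 2) ^ Suc k * t) * 1"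
          using \<rho>1 \<rho>0 V[OF P[of k]] t unfolding w_def by (intro mult_mono) auto
        then show ?thesis by simp
      qed (use t in auto)
      \<comment> \<open>All active bounds being below \<open>t\<close> gives only
        \<open>\<epsilon> x \<le> t\<close>. The strict inequality at the active index
        \<open>j\<close> yields the contradiction with \<open>t \<le> \<epsilon> x\<close>.\<close>
      have lt: "w j * \<rho> j x < (1 / 2) ^ Suc j * t"
      proof -
        have "\<delta> (P j) < t" using neg j by (meson not_le)
        then have "w j < (1 / 2) ^ Suc j * t"
          unfolding w_def by (intro mult_strict_left_mono) auto
        moreover have "w j * \<rho> j x \<le> w j * 1"
          using \<rho>1 w0[of j] by (intro mult_left_mono) auto
        ultimately show ?thesis by simp
      qed
      have sm: "(\<lambda>k. (1 / 2) ^ Suc k * t) sums (1 * t)"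
        by (rule sums_mult2) (rule power_half_series)
      have "0 < suminf (\<lambda>k. (1 / 2) ^ Suc k * t - w k * \<rho> k x)"
        by (rule suminf_pos2[of _ j])
          (use le lt summ sm in \<open>auto intro!: summable_diff intro: sums_summable\<close>)
      also have "\<dots> = t - \<epsilon> x"
        using sm summ by (subst suminf_diff[symmetric]) (auto simp: \<epsilon>_def sums_iff)
      finally show False using t by simp
    qed
    then obtain k where k: "0 < \<rho> k x" "t \<le> \<delta> (P k)" by blast
    then have "0 < f' (P k) x" using \<rho>f[of k x] by linarith
    then have "x \<in> V (P k)" using f[OF P[of k]] x P by (force simp: f'_def)
    with V[OF P[of k]] k t show "G x t" by blast
  qed
qed

section \<open>Pushing along a nonvanishing vector field\<close>

lemma continuous_map_scaleR:
  fixes g :: "'a \<Rightarrow> 'b::real_normed_vector"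
  shows "continuous_map X euclideanreal f \<Longrightarrow> continuous_map X euclidean g \<Longrightarrow>
    continuous_map X euclidean (\<lambda>x. f x *\<^sub>R g x)"
  by (simp add: continuous_map_atin tendsto_scaleR)

lemma continuous_map_inner:
  fixes f g :: "'a \<Rightarrow> 'b::real_inner"
  shows "continuous_map X euclidean f \<Longrightarrow> continuous_map X euclidean g \<Longrightarrow>
    continuous_map X euclideanreal (\<lambda>x. f x \<bullet> g x)"
  by (simp add: continuous_map_atin tendsto_inner)

lemma openin_continuous_map_preimage_subtopology:
  assumes "continuous_map (subtopology X W) Y f" "openin X W" "openin Y V"
  shows "openin X {x \<in> topspace X \<inter> W. f x \<in> V}"
  using openin_continuous_map_preimage[OF assms(1,3)] assms(2) openin_trans_full by fastforce

locale nonvanishing_vector_field =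
  fixes M :: "'a topology" and A :: "('a, 'n::finite) chart set"
    and \<xi> :: "'a \<Rightarrow> ('a, 'n) chart \<Rightarrow> real ^ 'n"
  assumes manifold: "smooth_manifold M A"
    and field: "vector_field M A \<xi>"
    and nonvanishing: "nowhere_vanishing M A \<xi>"
begin

section \<open>Charts and bump functions on the manifold\<close>

lemma Hausdorff: "Hausdorff_space M" and second_countable: "second_countable M"
  and atlas: "smooth_atlas M A"
  using manifold by (auto simp: smooth_manifold_def)

abbreviation coord :: "('a, 'n) chart \<Rightarrow> 'a \<Rightarrow> real ^ 'n" where "coord \<equiv> snd"

abbreviation param :: "('a, 'n) chart \<Rightarrow> real ^ 'n \<Rightarrow> 'a" where
  "param c \<equiv> inv_into (fst c) (snd c)"

lemma chart:
  assumes "c \<in> A"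
  shows open_chart_domain: "openin M (fst c)"
    and open_chart_image: "open (coord c ` fst c)"
    and continuous_coord: "continuous_map (subtopology M (fst c)) euclidean (coord c)"
    and continuous_param: "continuous_map (top_of_set (coord c ` fst c)) M (param c)"
    and inj_on_coord: "inj_on (coord c) (fst c)"
    and open_coord_image: "\<And>W. openin M W \<Longrightarrow> W \<subseteq> fst c \<Longrightarrow> open (coord c ` W)"
proof -
  have c: "openin M (fst c)" "open (coord c ` fst c)"
    "homeomorphic_map (subtopology M (fst c)) (top_of_set (coord c ` fst c)) (coord c)"
    using assms atlas by (auto simp: smooth_atlas_def is_chart_def)
  show "openin M (fst c)" "open (coord c ` fst c)" by fact+
  have sub: "fst c \<subseteq> topspace M" using c(1) openin_subset by blast
  then have ts: "topspace (subtopology M (fst c)) = fst c" by auto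
  have e: "continuous_map (subtopology M (fst c)) (top_of_set (coord c ` fst c)) (coord c)"
    "open_map (subtopology M (fst c)) (top_of_set (coord c ` fst c)) (coord c)"
    "inj_on (coord c) (fst c)"
    using c(3) ts by (auto simp: homeomorphic_eq_everything_map)
  show "continuous_map (subtopology M (fst c)) euclidean (coord c)" "inj_on (coord c) (fst c)"
    using e by (auto simp: continuous_map_in_subtopology)
  show "open (coord c ` W)" if "openin M W" "W \<subseteq> fst c" for W
  proof -
    have "openin (subtopology M (fst c)) W"
      using that c(1) by (simp add: openin_open_subtopology)
    then have "openin (top_of_set (coord c ` fst c)) (coord c ` W)"
      using e(2) by (simp add: open_map_def)
    then show ?thesis
      using c(2) by (simp add: openin_open_eq)
  qed
  obtain g where g: "homeomorphic_maps (subtopology M (fst c)) (top_of_set (coord c ` fst c)) (coord c) g"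
    using c(3) homeomorphic_map_maps by blast
  have "continuous_map (top_of_set (coord c ` fst c)) (subtopology M (fst c)) (param c)"
  proof (rule continuous_map_eq)
    show "continuous_map (top_of_set (coord c ` fst c)) (subtopology M (fst c)) g"
      using g by (simp add: homeomorphic_maps_def)
    fix y assume "y \<in> topspace (top_of_set (coord c ` fst c))"
    then obtain x where "x \<in> fst c" "y = coord c x" by auto
    then show "g y = param c y"
      using g ts e(3) by (simp add: homeomorphic_maps_def)
  qed
  then show "continuous_map (top_of_set (coord c ` fst c)) M (param c)"
    by (simp add: continuous_map_in_subtopology)
qed

text \<open>A tent function in coordinates. The preimage \<open>K\<close> of a closed ball is
  compact, hence closed in the Hausdorff space \<open>M\<close>, and therefore the extension by 0 is
  continuous across the edge of the chart.\<close>

lemma chart_bump: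
  assumes U: "openin M U" "p \<in> U"
  shows "\<exists>c \<rho> K. c \<in> A \<and> continuous_map M euclideanreal \<rho> \<and> (\<forall>q. 0 \<le> \<rho> q \<and> \<rho> q \<le> 1) \<and> \<rho> p = 1 \<and>
    closedin M K \<and> K \<subseteq> fst c \<inter> U \<and> (\<forall>q. q \<notin> K \<longrightarrow> \<rho> q = 0)"
proof -
  have p: "p \<in> topspace M" using U openin_subset by blast
  have "p \<in> (\<Union>c\<in>A. fst c)"
    using p atlas by (simp add: smooth_atlas_def)
  then obtain c where c: "c \<in> A" "p \<in> fst c" by blast
  note ch = chart[OF c(1)]
  have "open (coord c ` (fst c \<inter> U))"
    using ch(1) U(1) by (intro ch(6)) auto
  then obtain r where r: "0 < r" "cball (coord c p) r \<subseteq> coord c ` (fst c \<inter> U)"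
    using c(2) U(2) open_contains_cball[of "coord c ` (fst c \<inter> U)"] by blast
  define K where "K = param c ` cball (coord c p) r"
  define \<rho> where "\<rho> q = (if q \<in> fst c then max 0 (1 - dist (coord c q) (coord c p) / r) else 0)" for q
  have K: "K \<subseteq> fst c \<inter> U"
  proof
    fix x assume "x \<in> K"
    then obtain y where y: "y \<in> cball (coord c p) r" "x = param c y"
      unfolding K_def by blast
    then obtain z where "z \<in> fst c \<inter> U" "y = coord c z" using r(2) by blast
    with y ch(5) show "x \<in> fst c \<inter> U" by simp
  qed
  have "compactin M K"
    unfolding K_def
    by (rule image_compactin[OF _ ch(4)]) (use r(2) in \<open>auto simp: compactin_subtopology\<close>)
  then have closed: "closedin M K"
    using Hausdorff by (rule compactin_imp_closedin[rotated])
  have out: "\<rho> q = 0" if "q \<notin> K" for q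
  proof (cases "q \<in> fst c")
    case True
    have "coord c q \<notin> cball (coord c p) r"
      using that True ch(5) unfolding K_def by (metis image_eqI inv_into_f_f)
    then show ?thesis
      using r(1) by (simp add: \<rho>_def dist_commute field_simps)
  qed (simp add: \<rho>_def)
  have "continuous_map M euclideanreal \<rho>"
  proof (rule continuous_map_locally)
    fix x assume x: "x \<in> topspace M"
    show "\<exists>U. openin M U \<and> x \<in> U \<and> continuous_map (subtopology M U) euclideanreal \<rho>"
    proof (cases "x \<in> fst c")
      case True
      have "continuous_map (subtopology M (fst c)) euclideanreal
          (\<lambda>q. max 0 (1 - dist (coord c q) (coord c p) / r))"
        using ch(3) by (simp add: continuous_map_atin) (intro tendsto_intros ballI; (use r in simp)?)
      then have "continuous_map (subtopology M (fst c)) euclideanreal \<rho>"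
        by (rule continuous_map_eq) (auto simp: \<rho>_def)
      with True ch(1) show ?thesis by blast
    next
      case False
      have "continuous_map (subtopology M (topspace M - K)) euclideanreal \<rho>"
        by (rule continuous_map_eq[of _ _ "\<lambda>q. 0"]) (auto simp: out)
      with False K closed x show ?thesis by blast
    qed
  qed
  moreover have "0 \<le> \<rho> q \<and> \<rho> q \<le> 1" for q
    using r(1) by (simp add: \<rho>_def)
  moreover have "\<rho> p = 1"
    using c by (simp add: \<rho>_def)
  ultimately show ?thesis
    using c(1) closed K out by blast
qed

lemma completely_regular: "completely_regular_space M"
  unfolding completely_regular_space_def
proof (intro allI impI, elim conjE)
  fix S x assume S: "closedin M S" "x \<in> topspace M - S"
  obtain c \<rho> K where \<rho>: "continuous_map M euclideanreal \<rho>" "\<forall>q. 0 \<le> \<rho> q \<and> \<rho> q \<le> 1" "\<rho> x = 1"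
      "K \<subseteq> topspace M - S" "\<forall>q. q \<notin> K \<longrightarrow> \<rho> q = 0"
    using chart_bump[OF openin_diff[OF openin_topspace S(1)] S(2)] by auto
  have "continuous_map M (top_of_set {0..1}) (\<lambda>q. 1 - \<rho> q)"
    using \<rho>(1,2) by (auto simp: continuous_map_in_subtopology intro!: continuous_map_diff)
  then show "\<exists>f. continuous_map M (top_of_set {0..1}) f \<and> f x = 0 \<and> f ` S \<subseteq> {1::real}"
    using \<rho>(3-5) by (intro exI[of _ "\<lambda>q. 1 - \<rho> q"]) auto
qed

section \<open>Local pushes along the field\<close>

text \<open>Time runs over all reals, so that points \<open>(p, 0)\<close> have open boxes around
  them; the restriction to the unit interval comes only at the end.\<close>

abbreviation MR :: "('a \<times> real) topology" where
  "MR \<equiv> prod_topology M euclideanreal"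

lemma continuous_MR_of_fst:
  assumes "continuous_map (subtopology M U) Y f" "W \<subseteq> U \<times> UNIV"
  shows "continuous_map (subtopology MR W) Y (\<lambda>z. f (fst z))"
proof -
  have "continuous_map (subtopology MR W) (subtopology M U) fst"
    using assms(2) by (auto simp: continuous_map_in_subtopology intro: continuous_map_from_subtopology continuous_map_fst)
  from continuous_map_compose[OF this assms(1)] show ?thesis by (simp add: o_def)
qed

lemma continuous_MR_snd: "continuous_map (subtopology MR W) euclideanreal snd"
  by (intro continuous_map_from_subtopology continuous_map_snd)

text \<open>A straight move in the coordinates of one chart, with speed \<open>\<rho>\<close> times
  the field. The identity is a default for moves that leave the coordinate image; it may cause
  jumps, but not near time 0.\<close>

definition push :: "('a, 'n) chart \<Rightarrow> ('a \<Rightarrow> real) \<Rightarrow> 'a \<times> real \<Rightarrow> 'a" where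
  "push c \<rho> z =
    (let y = coord c (fst z) + (snd z * \<rho> (fst z)) *\<^sub>R \<xi> (fst z) c
     in if fst z \<in> fst c \<and> y \<in> coord c ` fst c then param c y else fst z)"

lemma push_fixed:
  assumes "c \<in> A" "\<rho> q = 0 \<or> t = 0"
  shows "push c \<rho> (q, t) = q"
  using assms inj_on_coord[OF assms(1)] by (auto simp: push_def Let_def dest: inj_onD)

lemma continuous_field: "c \<in> A \<Longrightarrow> continuous_map (subtopology M (fst c)) euclidean (\<lambda>p. \<xi> p c)"
  using field by (auto simp: vector_field_def)

text \<open>Continuity can be expected only near time 0. If \<open>p\<close> is in the chart, the
  endpoint of a short move stays in the open coordinate image. Otherwise \<open>p\<close> lies
  outside the closed set \<open>K\<close>, and the push is the projection nearby.\<close>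

lemma push_continuous:
  assumes c: "c \<in> A" and \<rho>: "continuous_map M euclideanreal \<rho>"
    and K: "closedin M K" "K \<subseteq> fst c" "\<And>q. q \<notin> K \<Longrightarrow> \<rho> q = 0" and p: "p \<in> topspace M"
  shows "\<exists>W. openin MR W \<and> (p, 0) \<in> W \<and> continuous_map (subtopology MR W) M (push c \<rho>)"
proof (cases "p \<in> fst c")
  case True
  note ch = chart[OF c]
  define F where "F z = coord c (fst z) + (snd z * \<rho> (fst z)) *\<^sub>R \<xi> (fst z) c" for z :: "'a \<times> real"
  define W1 where "W1 = fst c \<times> (UNIV :: real set)"
  have W1: "openin MR W1"
    using ch(1) by (simp add: W1_def openin_prod_Times_iff)
  have F: "continuous_map (subtopology MR W1) euclidean F"
    unfolding F_def
    by (intro continuous_map_add continuous_map_scaleR continuous_map_real_mult continuous_MR_snd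
        continuous_MR_of_fst[of "fst c"] continuous_map_from_subtopology[OF \<rho>] ch(3) continuous_field c)
      (auto simp: W1_def)
  define W where "W = {z \<in> topspace MR \<inter> W1. F z \<in> coord c ` fst c}"
  have W: "openin MR W"
    unfolding W_def by (rule openin_continuous_map_preimage_subtopology[OF F W1]) (use ch(2) in simp)
  have "continuous_map (subtopology MR W) (top_of_set (coord c ` fst c)) F"
    unfolding continuous_map_in_subtopology
    using continuous_map_from_subtopology_mono[OF F, of W] by (auto simp: W_def)
  from continuous_map_compose[OF this ch(4)]
  have "continuous_map (subtopology MR W) M (push c \<rho>)"
    by (rule continuous_map_eq) (auto simp: push_def F_def W_def W1_def)
  moreover have "(p, 0) \<in> W"
    using True p by (simp add: W_def W1_def F_def)
  ultimately show ?thesis using W by blast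
next
  case False
  let ?W = "(topspace M - K) \<times> (UNIV :: real set)"
  have "continuous_map (subtopology MR ?W) M fst"
    by (intro continuous_map_from_subtopology continuous_map_fst)
  moreover have "fst z = push c \<rho> z" if "fst z \<notin> K" for z
    using push_fixed[OF c, of \<rho> "fst z" "snd z"] K(3)[OF that] by simp
  ultimately have "continuous_map (subtopology MR ?W) M (push c \<rho>)"
    by (elim continuous_map_eq) auto
  moreover have "openin MR ?W"
    using openin_diff[OF openin_topspace K(1)] by (simp add: openin_prod_Times_iff)
  ultimately show ?thesis using False K(2) p by blast
qed

lemma smooth_transition:
  assumes "c \<in> A" "d \<in> A" "y \<in> coord d ` (fst d \<inter> fst c)"
  shows "transition d c differentiable at y"
    and "continuous_on (coord d ` (fst d \<inter> fst c)) (\<lambda>y. frechet_derivative (transition d c) (at y) b)"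
proof -
  have "Ck_on (Suc 0) (coord d ` (fst d \<inter> fst c)) (transition d c)"
    using assms atlas unfolding smooth_atlas_def smooth_on_def by blast
  with assms show "transition d c differentiable at y"
    "continuous_on (coord d ` (fst d \<inter> fst c)) (\<lambda>y. frechet_derivative (transition d c) (at y) b)"
    by auto
qed

lemma field_transition:
  assumes "c \<in> A" "d \<in> A" "p \<in> fst c" "p \<in> fst d"
  shows "frechet_derivative (transition d c) (at (coord d p)) (\<xi> p d) = \<xi> p c"
proof -
  have "p \<in> topspace M"
    using assms open_chart_domain openin_subset by blast
  then have "\<xi> p \<in> tangent_space A p"
    using field by (auto simp: vector_field_def)
  then have "\<forall>c\<in>charts_at A p. \<forall>d\<in>charts_at A p.
      \<xi> p d = frechet_derivative (transition c d) (at (coord c p)) (\<xi> p c)"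
    unfolding tangent_space_def by blast
  moreover have "c \<in> charts_at A p" "d \<in> charts_at A p"
    using assms by (auto simp: charts_at_def)
  ultimately show ?thesis by metis
qed

text \<open>Along the pushing segment, the derivative of the potential \<open>coord c \<bullet> \<xi> p c\<close> is close to its value
  \<open>|\<xi> p c|\<^sup>2\<close> at \<open>p\<close>, because the field transforms by the derivatives of the transition maps.\<close>

lemma push_increases_potential:
  assumes c: "c \<in> A" "p \<in> fst c" "\<xi> p c \<noteq> 0"
    and d: "d \<in> A" and \<rho>: "\<And>q. 0 \<le> \<rho> q" "\<And>q. \<rho> q \<le> 1"
    and K: "closedin M K" "K \<subseteq> fst d" "\<And>q. q \<notin> K \<Longrightarrow> \<rho> q = 0"
  shows "\<exists>W. openin MR W \<and> (p, 0) \<in> W \<and> (\<forall>q t. (q, t) \<in> W \<and> 0 < t \<longrightarrow> q \<in> fst c \<and>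
    push d \<rho> (q, t) \<in> fst c \<and>
    (0 < \<rho> q \<longrightarrow> coord c q \<bullet> \<xi> p c < coord c (push d \<rho> (q, t)) \<bullet> \<xi> p c))"
proof (cases "p \<in> fst d")
  case True
  note chd = chart[OF d] and chc = chart[OF c(1)]
  define v where "v = \<xi> p c"
  define T where "T = transition d c"
  define Q where "Q = coord d ` (fst d \<inter> fst c)"
  have Q: "open Q"
    unfolding Q_def using chd(1,6) chc(1) by blast
  define W1 where "W1 = (fst d \<inter> fst c) \<times> (UNIV :: real set)"
  have W1: "openin MR W1"
    using chd(1) chc(1) by (auto simp: W1_def openin_prod_Times_iff)
  \<comment> \<open>The bump function is left out: the push is \<open>F\<close> at the time
    \<open>t * \<rho> q\<close>, which is at most \<open>t\<close>.\<close>
  define F where "F z = coord d (fst z) + snd z *\<^sub>R \<xi> (fst z) d" for z :: "'a \<times> real"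
  have F: "continuous_map (subtopology MR W1) euclidean F"
    unfolding F_def
    by (intro continuous_map_add continuous_map_scaleR continuous_MR_snd
        continuous_MR_of_fst[of "fst d"] chd(3) continuous_field d)
      (auto simp: W1_def)
  define W2 where "W2 = {z \<in> topspace MR \<inter> W1. F z \<in> Q}"
  have W2: "openin MR W2"
    unfolding W2_def by (rule openin_continuous_map_preimage_subtopology[OF F W1]) (use Q in simp)
  have F2: "continuous_map (subtopology MR W2) (top_of_set Q) F"
    unfolding continuous_map_in_subtopology
    using continuous_map_from_subtopology_mono[OF F, of W2] by (auto simp: W2_def)
  \<comment> \<open>The derivative of the potential along the segment, expanded in a basis:
    smoothness gives continuity of the derivative only in each fixed direction, whereas the
    direction \<open>\<xi> q d\<close> varies with \<open>q\<close>.\<close>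
  define B where "B z = (\<Sum>b\<in>Basis. (\<xi> (fst z) d \<bullet> b) * (frechet_derivative T (at (F z)) b \<bullet> v))"
    for z :: "'a \<times> real"
  have B_eq: "B z = frechet_derivative T (at (F z)) (\<xi> (fst z) d) \<bullet> v" if "F z \<in> Q" for z
  proof -
    interpret lin: linear "frechet_derivative T (at (F z))"
      unfolding T_def
      by (rule linear_frechet_derivative[OF smooth_transition(1)[OF c(1) d that[unfolded Q_def]]])
    have "frechet_derivative T (at (F z)) (\<xi> (fst z) d) =
        frechet_derivative T (at (F z)) (\<Sum>b\<in>Basis. (\<xi> (fst z) d \<bullet> b) *\<^sub>R b)"
      by (simp add: euclidean_representation)
    also have "\<dots> = (\<Sum>b\<in>Basis. (\<xi> (fst z) d \<bullet> b) *\<^sub>R frechet_derivative T (at (F z)) b)"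
      by (simp add: lin.sum lin.scale)
    finally show ?thesis
      by (simp add: B_def inner_sum_left)
  qed
  have dB: "continuous_map (subtopology MR W2) euclideanreal (\<lambda>z. frechet_derivative T (at (F z)) b \<bullet> v)" for b
  proof -
    have "continuous_on Q (\<lambda>y. frechet_derivative T (at y) b \<bullet> v)"
      using smooth_transition(2)[OF c(1) d, of "coord d p" b] True c(2) unfolding T_def Q_def
      by (intro continuous_intros) auto
    then have "continuous_map (top_of_set Q) euclideanreal (\<lambda>y. frechet_derivative T (at y) b \<bullet> v)"
      by simp
    from continuous_map_compose[OF F2 this] show ?thesis by (simp add: o_def)
  qed
  have B: "continuous_map (subtopology MR W2) euclideanreal B"
    unfolding B_def
    by (intro continuous_map_sum continuous_map_real_mult dB continuous_map_inner
        continuous_MR_of_fst[of "fst d"] continuous_field d)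
      (auto simp: W2_def W1_def)
  define W3 where "W3 = {z \<in> topspace MR \<inter> W2. B z \<in> {0<..}}"
  have W3: "openin MR W3"
    unfolding W3_def by (rule openin_continuous_map_preimage_subtopology[OF B W2]) simp
  have pM: "p \<in> topspace M" using chc(1) c(2) openin_subset by blast
  have "F (p, 0) \<in> Q"
    using True c(2) by (simp add: F_def Q_def)
  moreover have "B (p, 0) = v \<bullet> v"
    using field_transition[OF c(1) d c(2) True] calculation by (simp add: B_eq) (simp add: F_def T_def v_def)
  ultimately have "(p, 0) \<in> W3"
    using True c pM by (simp add: W3_def W2_def W1_def v_def)
  \<comment> \<open>A box is taken so that with \<open>(q, t)\<close> the whole segment of earlier
    times \<open>(q, s)\<close> lies in \<open>W3\<close>.\<close>
  then obtain N J where NJ: "openin M N" "open J" "p \<in> N" "0 \<in> J" "N \<times> J \<subseteq> W3"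
    using W3 unfolding openin_prod_topology_alt by (metis open_openin)
  obtain e where e: "0 < e" "ball 0 e \<subseteq> J"
    using NJ(2,4) open_contains_ball by blast
  let ?W = "N \<times> ball (0::real) e"
  have "openin MR ?W" using NJ(1) by (simp add: openin_prod_Times_iff)
  moreover have "(p, 0) \<in> ?W" using NJ(3) e(1) by simp
  moreover have "q \<in> fst c \<and> push d \<rho> (q, t) \<in> fst c \<and>
      (0 < \<rho> q \<longrightarrow> coord c q \<bullet> v < coord c (push d \<rho> (q, t)) \<bullet> v)"
    if qt: "(q, t) \<in> ?W" "0 < t" for q t
  proof -
    have W3': "(q, s) \<in> W3" if "0 \<le> s" "s \<le> t" for s
      using qt that NJ(5) e(2) by (force simp: dist_real_def)
    have qcd: "q \<in> fst c" "q \<in> fst d"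
      using W3'[of 0] qt by (auto simp: W3_def W2_def W1_def)
    have FQ: "F (q, s) \<in> Q" if "0 \<le> s" "s \<le> t" for s
      using W3'[OF that] by (simp add: W3_def W2_def)
    define a where "a = t * \<rho> q"
    have a: "0 \<le> a" "a \<le> t"
      using \<rho>[of q] qt(2) by (auto simp: a_def intro: mult_left_le)
    obtain x where x: "x \<in> fst d" "x \<in> fst c" "F (q, a) = coord d x"
      using FQ[OF a] by (auto simp: Q_def)
    have px: "push d \<rho> (q, t) = x"
      using x qcd chd(5) by (auto simp: push_def Let_def F_def a_def)
    have "coord c q \<bullet> v < coord c (push d \<rho> (q, t)) \<bullet> v" if "0 < \<rho> q"
    proof -
      have "T (F (q, 0)) \<bullet> v < T (F (q, a)) \<bullet> v"
      proof (rule DERIV_pos_imp_increasing[where f = "\<lambda>s. T (F (q, s)) \<bullet> v"])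
        show "0 < a" using that qt by (simp add: a_def)
        fix s assume s: "0 \<le> s" "s \<le> a"
        then have st: "0 \<le> s" "s \<le> t" using a by auto
        have diff: "T differentiable at (F (q, s))"
          unfolding T_def by (rule smooth_transition(1)[OF c(1) d FQ[OF st, unfolded Q_def]])
        then have "(T has_derivative frechet_derivative T (at (F (q, s)))) (at (F (q, s)))"
          by (rule frechet_derivative_works[THEN iffD1])
        then have "(T has_derivative frechet_derivative T (at (F (q, s)))) (at (coord d q + s *\<^sub>R \<xi> q d))"
          by (simp add: F_def)
        moreover have "((\<lambda>s. coord d q + s *\<^sub>R \<xi> q d) has_derivative (\<lambda>h. h *\<^sub>R \<xi> q d)) (at s)"
          by (auto intro!: derivative_eq_intros)
        ultimately have D: "((\<lambda>s. T (coord d q + s *\<^sub>R \<xi> q d) \<bullet> v) has_derivative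
            (\<lambda>h. frechet_derivative T (at (F (q, s))) (h *\<^sub>R \<xi> q d) \<bullet> v)) (at s)"
          by (intro has_derivative_inner_left) (rule has_derivative_compose)
        interpret lin: linear "frechet_derivative T (at (F (q, s)))"
          using diff by (rule linear_frechet_derivative)
        have "((\<lambda>s. T (coord d q + s *\<^sub>R \<xi> q d) \<bullet> v) has_real_derivative B (q, s)) (at s)"
          by (rule has_derivative_imp_has_field_derivative[OF D]) (simp add: B_eq[OF FQ[OF st]] lin.scale)
        then have "((\<lambda>s. T (F (q, s)) \<bullet> v) has_real_derivative B (q, s)) (at s)"
          by (simp add: F_def)
        moreover have "0 < B (q, s)"
          using W3'[OF st] by (simp add: W3_def)
        ultimately show "\<exists>y. ((\<lambda>s. T (F (q, s)) \<bullet> v) has_real_derivative y) (at s) \<and> 0 < y"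
          by blast
      qed
      moreover have "T (F (q, 0)) = coord c q"
        using qcd chd(5) by (simp add: T_def transition_def F_def)
      moreover have "T (F (q, a)) = coord c x"
        using x chd(5) by (simp add: T_def transition_def)
      ultimately show ?thesis by (simp add: px)
    qed
    then show ?thesis using qcd x px by blast
  qed
  ultimately show ?thesis unfolding v_def by blast
next
  case False
  let ?W = "((topspace M - K) \<inter> fst c) \<times> (UNIV :: real set)"
  have "openin MR ?W"
    using openin_diff[OF openin_topspace K(1)] open_chart_domain[OF c(1)]
    by (auto simp: openin_prod_Times_iff)
  moreover have "(p, 0) \<in> ?W"
    using False K(2) c(2) openin_subset[OF open_chart_domain[OF c(1)]] by auto
  moreover have "push d \<rho> (q, t) = q \<and> \<rho> q = 0" if "(q, t) \<in> ?W" for q t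
    using that K(3) push_fixed[OF d] by auto
  ultimately show ?thesis
    by (intro exI[of _ ?W]) auto
qed

text \<open>Near \<open>(p, 0)\<close> only finitely many pushes move anything, and each active one
  strictly increases the same linear potential \<open>u\<close>, so the pushes cannot cancel. At
  least one is active at every point. This settles small times, with a bound depending on the point;
  a continuous \<epsilon> below the bounds rescales time.\<close>

lemma fixed_point_free_deformation:
  obtains \<Phi> :: "'a \<times> real \<Rightarrow> 'a"
  where "continuous_map (prod_topology M (top_of_set {0..1})) M \<Phi>"
    and "\<And>x. x \<in> topspace M \<Longrightarrow> \<Phi> (x, 0) = x"
    and "\<And>x t. x \<in> topspace M \<Longrightarrow> 0 < t \<Longrightarrow> t \<le> 1 \<Longrightarrow> \<Phi> (x, t) \<noteq> x"
proof (cases "topspace M = {}")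
  case True
  show ?thesis
    by (rule that[of fst]) (use True in \<open>auto intro: continuous_map_fst\<close>)
next
  case False
  have Lin: "Lindelof_space M"
    using second_countable by (rule second_countable_imp_Lindelof_space)
  have "\<exists>c \<rho> K. c \<in> A \<and> continuous_map M euclideanreal \<rho> \<and> (\<forall>q. 0 \<le> \<rho> q \<and> \<rho> q \<le> 1) \<and> \<rho> p = 1 \<and>
    closedin M K \<and> K \<subseteq> fst c \<and> (\<forall>q. q \<notin> K \<longrightarrow> \<rho> q = 0)" if "p \<in> topspace M" for p
    using chart_bump[OF openin_topspace that] by blast
  then obtain C R KK where CR: "\<And>p. p \<in> topspace M \<Longrightarrow> C p \<in> A \<and> continuous_map M euclideanreal (R p) \<and>
      (\<forall>q. 0 \<le> R p q \<and> R p q \<le> 1) \<and> R p p = 1 \<and> closedin M (KK p) \<and> KK p \<subseteq> fst (C p) \<and>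
      (\<forall>q. q \<notin> KK p \<longrightarrow> R p q = 0)"
    by metis
  define f where "f p = (if p \<in> topspace M then R p else (\<lambda>q. 0))" for p
  have f: "p \<in> topspace M \<Longrightarrow> continuous_map M euclideanreal (f p)" "0 \<le> f p x" "f p x \<le> 1"
    "p \<in> topspace M \<Longrightarrow> 0 < f p p" for p x
    using CR[of p] by (auto simp: f_def)
  obtain P :: "nat \<Rightarrow> 'a" and \<rho> :: "nat \<Rightarrow> 'a \<Rightarrow> real" where
    P: "\<And>k. P k \<in> topspace M" and cont\<rho>: "\<And>k. continuous_map M euclideanreal (\<rho> k)"
    and \<rho>0: "\<And>k x. 0 \<le> \<rho> k x" and \<rho>f: "\<And>k x. \<rho> k x \<le> f (P k) x"
    and act: "\<And>x. x \<in> topspace M \<Longrightarrow> \<exists>k. 0 < \<rho> k x"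
    and lf: "\<And>x. x \<in> topspace M \<Longrightarrow> \<exists>U K. openin M U \<and> x \<in> U \<and> (\<forall>k\<ge>K. \<forall>y\<in>U. \<rho> k y = 0)"
    by (rule locally_finite_bumps[OF Lin False f]) (assumption, assumption, (rule that; assumption))
  define c where "c k = C (P k)" for k
  define K where "K k = KK (P k)" for k
  have cA: "c k \<in> A" and K: "closedin M (K k)" "K k \<subseteq> fst (c k)" for k
    using CR[OF P[of k]] by (auto simp: c_def K_def)
  have \<rho>K: "\<rho> k q = 0" if "q \<notin> K k" for k q
  proof -
    have "f (P k) q = 0"
      using CR[OF P[of k]] P[of k] that by (auto simp: f_def K_def)
    then show ?thesis
      using \<rho>0[of k q] \<rho>f[of k q] by simp
  qed
  have \<rho>1: "\<rho> k q \<le> 1" for k q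
    using \<rho>f[of k q] f(3)[of "P k" q] by linarith
  define X where "X = rec_nat fst (\<lambda>k g z. push (c k) (\<rho> k) (g z, snd z))"
  have X_0: "X 0 z = fst z" and X_Suc: "X (Suc k) z = push (c k) (\<rho> k) (X k z, snd z)" for k z
    by (simp_all add: X_def)
  have Xt0: "X k (q, 0) = q" for k q
    by (induction k) (simp_all add: X_0 X_Suc push_fixed cA)
  have contX: "\<exists>W. openin MR W \<and> (p, 0) \<in> W \<and> continuous_map (subtopology MR W) M (X k)"
    if p: "p \<in> topspace M" for p k
  proof (induction k)
    case 0
    have "continuous_map (subtopology MR (topspace MR)) M fst"
      by (intro continuous_map_from_subtopology continuous_map_fst)
    then have "continuous_map (subtopology MR (topspace MR)) M (X 0)"
      by (simp add: X_def)
    with p show ?case by (intro exI[of _ "topspace MR"] conjI openin_topspace) auto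
  next
    case (Suc k)
    then obtain W where W: "openin MR W" "(p, 0) \<in> W" "continuous_map (subtopology MR W) M (X k)"
      by blast
    obtain W' where W': "openin MR W'" "(p, 0) \<in> W'"
        "continuous_map (subtopology MR W') M (push (c k) (\<rho> k))"
      using push_continuous[OF cA cont\<rho> K \<rho>K p] by blast
    define g where "g z = (X k z, snd z)" for z
    have g: "continuous_map (subtopology MR W) MR g"
      unfolding g_def by (intro continuous_map_pairedI W(3) continuous_MR_snd)
    define W'' where "W'' = {z \<in> topspace MR \<inter> W. g z \<in> W'}"
    have "openin MR W''"
      unfolding W''_def by (rule openin_continuous_map_preimage_subtopology[OF g W(1) W'(1)])
    moreover have "(p, 0) \<in> W''"
      using p W W' by (simp add: W''_def g_def Xt0)
    moreover have "continuous_map (subtopology MR W'') (subtopology MR W') g"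
      unfolding continuous_map_in_subtopology
      using continuous_map_from_subtopology_mono[OF g, of W''] by (auto simp: W''_def)
    from continuous_map_compose[OF this W'(3)]
    have "continuous_map (subtopology MR W'') M (X (Suc k))"
      by (rule continuous_map_eq) (simp add: X_Suc g_def)
    ultimately show ?case by blast
  qed
  \<comment> \<open>The eventually constant value of the stages \<open>X k z\<close>. It is
    arbitrary where they do not stabilise, which does not happen on the neighbourhoods constructed
    below.\<close>
  define \<Phi> where "\<Phi> z = (SOME y. \<exists>m. \<forall>k\<ge>m. X k z = y)" for z
  have \<Phi>_eq: "\<Phi> z = X m z" if "\<And>k. m \<le> k \<Longrightarrow> X k z = X m z" for m z
    unfolding \<Phi>_def
  proof (rule some_equality)
    show "\<exists>m'. \<forall>k\<ge>m'. X k z = X m z" using that by blast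
    fix y assume "\<exists>m'. \<forall>k\<ge>m'. X k z = y"
    then obtain m' where "\<forall>k\<ge>m'. X k z = y" by blast
    then show "y = X m z" using that[of "max m m'"] by simp
  qed
  have \<Phi>0: "\<Phi> (q, 0) = q" for q
    using \<Phi>_eq[of 0 "(q, 0)"] by (simp add: Xt0)
  have local: "\<exists>W. openin MR W \<and> (p, 0) \<in> W \<and> continuous_map (subtopology MR W) M \<Phi> \<and>
      (\<forall>q t. (q, t) \<in> W \<and> 0 < t \<longrightarrow> \<Phi> (q, t) \<noteq> q)" if p: "p \<in> topspace M" for p
  proof -
    obtain U m where U: "openin M U" "p \<in> U" "\<And>k y. m \<le> k \<Longrightarrow> y \<in> U \<Longrightarrow> \<rho> k y = 0"
      using lf[OF p] by blast
    have "\<xi> p \<in> extensional (charts_at A p)" "\<xi> p \<noteq> zero_tangent A p"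
      using field nonvanishing p by (auto simp: vector_field_def nowhere_vanishing_def tangent_space_def)
    then have "\<exists>d\<in>charts_at A p. \<xi> p d \<noteq> 0"
      using extensionalityI[of "\<xi> p" "charts_at A p" "zero_tangent A p"]
      by (auto simp: zero_tangent_def)
    then obtain d where d: "d \<in> A" "p \<in> fst d" "\<xi> p d \<noteq> 0"
      unfolding charts_at_def by blast
    define u where "u y = coord d y \<bullet> \<xi> p d" for y
    have "\<exists>W. openin MR W \<and> (p, 0) \<in> W \<and> (\<forall>q t. (q, t) \<in> W \<and> 0 < t \<longrightarrow> q \<in> fst d \<and>
        push (c k) (\<rho> k) (q, t) \<in> fst d \<and> (0 < \<rho> k q \<longrightarrow> u q < u (push (c k) (\<rho> k) (q, t))))" for k
      unfolding u_def by (rule push_increases_potential[OF d cA \<rho>0 \<rho>1 K \<rho>K])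
    then have "\<exists>Wm. \<forall>k. openin MR (Wm k) \<and> (p, 0) \<in> Wm k \<and> (\<forall>q t. (q, t) \<in> Wm k \<and> 0 < t \<longrightarrow> q \<in> fst d \<and>
        push (c k) (\<rho> k) (q, t) \<in> fst d \<and> (0 < \<rho> k q \<longrightarrow> u q < u (push (c k) (\<rho> k) (q, t))))"
      by (intro choice allI)
    then obtain Wm where Wm: "\<And>k. openin MR (Wm k)" "\<And>k. (p, 0) \<in> Wm k"
        "\<And>k q t. (q, t) \<in> Wm k \<Longrightarrow> 0 < t \<Longrightarrow> 0 < \<rho> k q \<Longrightarrow> u q < u (push (c k) (\<rho> k) (q, t))"
      by blast
    obtain Wc where Wc: "\<And>k. openin MR (Wc k)" "\<And>k. (p, 0) \<in> Wc k"
        "\<And>k. continuous_map (subtopology MR (Wc k)) M (X k)"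
      using contX[OF p] by metis
    \<comment> \<open>Three demands on stage \<open>k\<close>: it is continuous, it lies in
      \<open>U\<close>, where the pushes from \<open>m\<close> on are switched off, and it lies in
      \<open>Wm k\<close>, where the next push raises the potential.\<close>
    define S where "S k = {z \<in> topspace MR \<inter> Wc k. (X k z, snd z) \<in> (U \<times> UNIV) \<inter> Wm k}" for k
    have S: "openin MR (S k)" for k
      unfolding S_def
      by (rule openin_continuous_map_preimage_subtopology[OF _ Wc(1)])
        (use U(1) Wm(1) in \<open>auto intro!: continuous_map_pairedI Wc(3) continuous_MR_snd openin_Int
          simp: openin_prod_Times_iff\<close>)
    define W where "W = (\<Inter>k\<le>m. S k)"
    have "openin MR W"
      unfolding W_def by (rule openin_INT2) (use S in auto)
    moreover have "(p, 0) \<in> W"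
      using p U Wm Wc by (auto simp: W_def S_def Xt0)
    moreover have zU: "X k z \<in> U" "(X k z, snd z) \<in> Wm k" if "z \<in> W" "k \<le> m" for k z
      using that by (auto simp: W_def S_def)
    have stat: "X k z = X m z" if "z \<in> W" "m \<le> k" for k z
      using that(2)
    proof (induction k rule: dec_induct)
      case (step k)
      then show ?case
        using zU(1)[OF that(1), of m] U(3)[of k "X m z"] by (simp add: X_Suc push_fixed cA)
    qed simp
    moreover have "continuous_map (subtopology MR W) M \<Phi>"
    proof (rule continuous_map_eq)
      show "continuous_map (subtopology MR W) M (X m)"
        by (rule continuous_map_from_subtopology_mono[OF Wc(3)]) (auto simp: W_def S_def)
      show "X m z = \<Phi> z" if "z \<in> topspace (subtopology MR W)" for z
      proof -
        have "z \<in> W" using that by simp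
        from \<Phi>_eq[OF stat[OF this]] show ?thesis by simp
      qed
    qed
    moreover have "\<Phi> (q, t) \<noteq> q" if z: "(q, t) \<in> W" "0 < t" for q t
    proof -
      have q: "q \<in> topspace M" using z(1) by (auto simp: W_def S_def)
      \<comment> \<open>Either the potential has already risen, or nothing has moved and all bumps
        so far vanish at \<open>q\<close>. At \<open>k = m\<close> the second case puts
        \<open>q\<close> in \<open>U\<close>, so that all bumps vanish at \<open>q\<close>, which is
        impossible.\<close>
      have "u q < u (X k (q, t)) \<or> X k (q, t) = q \<and> (\<forall>j<k. \<rho> j q = 0)" if "k \<le> m" for k
        using that
      proof (induction k)
        case (Suc k)
        have mem: "(X k (q, t), t) \<in> Wm k"
          using zU(2)[OF z(1), of k] Suc.prems by simp
        show ?case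
        proof (cases "\<rho> k (X k (q, t)) = 0")
          case True
          then have "X (Suc k) (q, t) = X k (q, t)"
            by (simp add: X_Suc push_fixed cA)
          with Suc True show ?thesis by (auto simp: less_Suc_eq)
        next
          case False
          then have "u (X k (q, t)) < u (X (Suc k) (q, t))"
            using Wm(3)[OF mem z(2)] \<rho>0[of k "X k (q, t)"] by (simp add: X_Suc less_le)
          with Suc show ?thesis by force
        qed
      qed (simp add: X_0)
      from this[of m] consider "u q < u (X m (q, t))" | "X m (q, t) = q" "\<forall>j<m. \<rho> j q = 0"
        by blast
      then have "X m (q, t) \<noteq> q"
      proof cases
        case 2
        then have "q \<in> U" using zU(1)[OF z(1), of m] by simp
        then have "\<rho> k q = 0" for k
          using 2(2) U(3)[of k q] by (cases "k < m") auto
        with act[OF q] show ?thesis by simp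
      qed auto
      moreover have "\<Phi> (q, t) = X m (q, t)"
        by (rule \<Phi>_eq[OF stat[OF z(1)]])
      ultimately show ?thesis by simp
    qed
    ultimately show ?thesis by blast
  qed
  then obtain W where W: "\<And>p. p \<in> topspace M \<Longrightarrow> openin MR (W p)"
      "\<And>p. p \<in> topspace M \<Longrightarrow> (p, 0) \<in> W p"
      "\<And>p. p \<in> topspace M \<Longrightarrow> continuous_map (subtopology MR (W p)) M \<Phi>"
      "\<And>p q t. p \<in> topspace M \<Longrightarrow> (q, t) \<in> W p \<Longrightarrow> 0 < t \<Longrightarrow> \<Phi> (q, t) \<noteq> q"
    by metis
  obtain \<epsilon> where \<epsilon>: "continuous_map M euclideanreal \<epsilon>" "\<And>x. x \<in> topspace M \<Longrightarrow> 0 < \<epsilon> x"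
    "\<And>x t. x \<in> topspace M \<Longrightarrow> 0 < t \<Longrightarrow> t \<le> \<epsilon> x \<Longrightarrow> \<exists>p\<in>topspace M. (x, t) \<in> W p"
  proof (rule continuous_positive_below[OF Lin completely_regular, of "\<lambda>x t. \<exists>p\<in>topspace M. (x, t) \<in> W p"])
    fix x assume x: "x \<in> topspace M"
    obtain V J where VJ: "openin M V" "open J" "x \<in> V" "0 \<in> J" "V \<times> J \<subseteq> W x"
      using W(1)[OF x] W(2)[OF x] unfolding openin_prod_topology_alt by (metis open_openin)
    obtain e where e: "0 < e" "cball 0 e \<subseteq> J"
      using VJ(2,4) open_contains_cball by blast
    have "(y, t) \<in> W x" if "y \<in> V" "0 < t" "t \<le> e" for y t
      using that VJ(5) e by (force simp: dist_real_def)
    with x VJ(1,3) e(1) show "\<exists>V \<delta>. openin M V \<and> x \<in> V \<and> 0 < \<delta> \<and>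
        (\<forall>y\<in>V. \<forall>t. 0 < t \<and> t \<le> \<delta> \<longrightarrow> (\<exists>p\<in>topspace M. (y, t) \<in> W p))"
      by blast
  qed blast
  \<comment> \<open>Slowing time by \<epsilon> keeps \<open>h z\<close> inside some
    \<open>W p\<close>, the only region where \<Phi> is under control.\<close>
  define h where "h z = (fst z, snd z * \<epsilon> (fst z))" for z :: "'a \<times> real"
  let ?MI = "prod_topology M (top_of_set {0..1::real})"
  have "continuous_map ?MI euclideanreal (\<lambda>z. \<epsilon> (fst z))"
    using continuous_map_compose[OF continuous_map_fst \<epsilon>(1)] by (simp add: o_def)
  moreover have "continuous_map ?MI euclideanreal snd"
    using continuous_map_snd[of M "top_of_set {0..1::real}"] by (simp add: continuous_map_in_subtopology)
  ultimately have h: "continuous_map ?MI MR h"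
    unfolding h_def by (intro continuous_map_pairedI continuous_map_fst continuous_map_real_mult)
  have hW: "\<exists>p\<in>topspace M. h z \<in> W p" if "z \<in> topspace ?MI" for z
  proof (cases "snd z = 0")
    case True
    then show ?thesis using that W(2)[of "fst z"] by (auto simp: h_def)
  next
    case False
    then show ?thesis
      unfolding h_def using that \<epsilon>(2)[of "fst z"]
      by (intro \<epsilon>(3)) (auto simp: mult_le_cancel_right1)
  qed
  show ?thesis
  proof (rule that[of "\<Phi> \<circ> h"])
    show "continuous_map ?MI M (\<Phi> \<circ> h)"
    proof (rule continuous_map_locally)
      fix z assume z: "z \<in> topspace ?MI"
      obtain p where p: "p \<in> topspace M" "h z \<in> W p" using hW[OF z] by blast
      let ?V = "{z \<in> topspace ?MI. h z \<in> W p}"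
      have "openin ?MI ?V"
        by (rule openin_continuous_map_preimage[OF h W(1)[OF p(1)]])
      moreover have "continuous_map (subtopology ?MI ?V) (subtopology MR (W p)) h"
        using h by (auto simp: continuous_map_in_subtopology continuous_map_from_subtopology)
      from continuous_map_compose[OF this W(3)[OF p(1)]]
      have "continuous_map (subtopology ?MI ?V) M (\<Phi> \<circ> h)" .
      ultimately show "\<exists>U. openin ?MI U \<and> z \<in> U \<and> continuous_map (subtopology ?MI U) M (\<Phi> \<circ> h)"
        using z p(2) by blast
    qed
    show "(\<Phi> \<circ> h) (x, 0) = x" for x by (simp add: h_def \<Phi>0)
    show "(\<Phi> \<circ> h) (x, t) \<noteq> x" if "x \<in> topspace M" "0 < t" "t \<le> 1" for x t
      using hW[of "(x, t)"] that \<epsilon>(2)[of x] W(4) by (auto simp: h_def)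
  qed
qed

end

section \<open>Lifting singular simplices to ordered configurations\<close>

lemma topspace_PConf:
  "f \<in> topspace (PConf n X) \<longleftrightarrow> f \<in> extensional {..<n} \<and> (\<forall>i<n. f i \<in> topspace X) \<and> inj_on f {..<n}"
  unfolding PConf_def topspace_subtopology topspace_product_topology by (auto simp: PiE_iff)

lemma continuous_map_into_PConf:
  "continuous_map T (PConf n X) g \<longleftrightarrow>
    (\<forall>i<n. continuous_map T X (\<lambda>x. g x i)) \<and>
    (\<forall>x\<in>topspace T. g x \<in> extensional {..<n} \<and> inj_on (g x) {..<n})"
  unfolding PConf_def continuous_map_in_subtopology continuous_map_componentwise
  by (simp add: Pi_iff image_subset_iff Ball_def) blast

lemma continuous_map_PConf_point: "i < n \<Longrightarrow> continuous_map (PConf n X) X (\<lambda>f. f i)"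
  unfolding PConf_def
  using continuous_map_product_projection[of i "{..<n}" "\<lambda>_. X"]
  by (intro continuous_map_from_subtopology) simp

lemma Hausdorff_PConf: "Hausdorff_space X \<Longrightarrow> Hausdorff_space (PConf n X)"
  unfolding PConf_def by (intro Hausdorff_space_subtopology) (simp add: Hausdorff_space_product_topology)

lemma continuous_map_permute_PConf:
  assumes "\<sigma> permutes {..<n}"
  shows "continuous_map (PConf n X) (PConf n X) (\<lambda>f. f \<circ> \<sigma>)"
  unfolding continuous_map_into_PConf
proof (intro conjI allI impI ballI)
  fix i assume "i < n"
  then have "\<sigma> i < n" using permutes_in_image[OF assms, of i] by simp
  then show "continuous_map (PConf n X) X (\<lambda>f. (f \<circ> \<sigma>) i)"
    by (simp add: continuous_map_PConf_point)
next
  fix f assume f: "f \<in> topspace (PConf n X)"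
  show "f \<circ> \<sigma> \<in> extensional {..<n}"
    using f permutes_not_in[OF assms] by (auto simp: topspace_PConf extensional_def)
  show "inj_on (f \<circ> \<sigma>) {..<n}"
    using f by (intro comp_inj_on) (auto simp: topspace_PConf permutes_inj_on[OF assms] permutes_image[OF assms])
qed

lemma permute_in_PConf:
  "\<sigma> permutes {..<n} \<Longrightarrow> f \<in> topspace (PConf n X) \<Longrightarrow> f \<circ> \<sigma> \<in> topspace (PConf n X)"
  using continuous_map_permute_PConf[of \<sigma> n X] by (auto simp: continuous_map_def)

text \<open>Freeness of the permutation action: the points are distinct, and both permutations fix
  the indices from \<open>n\<close> on.\<close>

lemma permute_PConf_cancel:
  assumes "f \<in> topspace (PConf n X)" "\<sigma> permutes {..<n}" "\<tau> permutes {..<n}" "f \<circ> \<sigma> = f \<circ> \<tau>"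
  shows "\<sigma> = \<tau>"
proof
  fix i
  show "\<sigma> i = \<tau> i"
  proof (cases "i < n")
    case True
    then have "\<sigma> i \<in> {..<n}" "\<tau> i \<in> {..<n}"
      using permutes_in_image[OF assms(2), of i] permutes_in_image[OF assms(3), of i] by auto
    moreover have "f (\<sigma> i) = f (\<tau> i)" using fun_cong[OF assms(4), of i] by simp
    ultimately show ?thesis using assms(1) by (auto simp: topspace_PConf dest: inj_onD)
  next
    case False
    then show ?thesis using permutes_not_in[OF assms(2), of i] permutes_not_in[OF assms(3), of i] by simp
  qed
qed

lemma perm_orbit_eq_iff: "perm_orbit n f = perm_orbit n g \<longleftrightarrow> (\<exists>\<sigma>. \<sigma> permutes {..<n} \<and> g = f \<circ> \<sigma>)"
proof
  assume "perm_orbit n f = perm_orbit n g"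
  moreover have "g \<in> perm_orbit n g"
    unfolding perm_orbit_def by (auto intro!: exI[of _ id])
  ultimately show "\<exists>\<sigma>. \<sigma> permutes {..<n} \<and> g = f \<circ> \<sigma>"
    by (auto simp: perm_orbit_def)
next
  assume "\<exists>\<sigma>. \<sigma> permutes {..<n} \<and> g = f \<circ> \<sigma>"
  then obtain \<sigma> where \<sigma>: "\<sigma> permutes {..<n}" "g = f \<circ> \<sigma>" by blast
  show "perm_orbit n f = perm_orbit n g"
  proof (intro equalityI subsetI)
    fix h assume "h \<in> perm_orbit n f"
    then obtain \<tau> where \<tau>: "\<tau> permutes {..<n}" "h = f \<circ> \<tau>" by (auto simp: perm_orbit_def)
    have "h = g \<circ> (inv_into UNIV \<sigma> \<circ> \<tau>)"
      using permutes_inv_o[OF \<sigma>(1)] by (simp add: \<sigma>(2) \<tau>(2) fun_eq_iff)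
    moreover have "inv_into UNIV \<sigma> \<circ> \<tau> permutes {..<n}"
      using \<tau>(1) permutes_inv[OF \<sigma>(1)] by (rule permutes_compose)
    ultimately show "h \<in> perm_orbit n g" by (auto simp: perm_orbit_def)
  next
    fix h assume "h \<in> perm_orbit n g"
    then obtain \<tau> where "\<tau> permutes {..<n}" "h = f \<circ> (\<sigma> \<circ> \<tau>)"
      by (auto simp: perm_orbit_def \<sigma>(2) o_assoc)
    then show "h \<in> perm_orbit n f"
      using permutes_compose[of \<tau> _ \<sigma>] \<sigma>(1) by (auto simp: perm_orbit_def)
  qed
qed

lemma perm_orbit_eq_if_same_points:
  assumes "f \<in> topspace (PConf n X)" "g \<in> topspace (PConf n X)" "f ` {..<n} = g ` {..<n}"
  shows "perm_orbit n f = perm_orbit n g"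
  unfolding perm_orbit_eq_iff
proof (intro exI conjI)
  define \<sigma> where "\<sigma> i = (if i < n then inv_into {..<n} f (g i) else i)" for i
  have f: "bij_betw f {..<n} (f ` {..<n})" and g: "bij_betw g {..<n} (f ` {..<n})"
    using assms by (auto simp: topspace_PConf bij_betw_def)
  have "bij_betw (inv_into {..<n} f \<circ> g) {..<n} {..<n}"
    by (rule bij_betw_trans[OF g bij_betw_inv_into[OF f]])
  then have "bij_betw \<sigma> {..<n} {..<n}"
    by (rule iffD1[OF bij_betw_cong, rotated]) (simp add: \<sigma>_def)
  then show "\<sigma> permutes {..<n}"
    by (rule bij_imp_permutes) (simp add: \<sigma>_def)
  show "g = f \<circ> \<sigma>"
  proof
    fix i
    show "g i = (f \<circ> \<sigma>) i"
    proof (cases "i < n")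
      case True
      then have "g i \<in> f ` {..<n}" using assms(3) by blast
      then show ?thesis using True by (simp add: \<sigma>_def f_inv_into_f)
    next
      case False
      then show ?thesis using assms(1,2) by (auto simp: \<sigma>_def topspace_PConf extensional_def)
    qed
  qed
qed

lemma topspace_Conf: "topspace (Conf n X) = perm_orbit n ` topspace (PConf n X)"
  by (simp add: Conf_def topspace_quotient_topology)

lemma continuous_map_perm_orbit: "continuous_map (PConf n X) (Conf n X) (perm_orbit n)"
  unfolding Conf_def by (intro quotient_imp_continuous_map quotient_map_quotient_topology)

lemma open_map_perm_orbit: "open_map (PConf n X) (Conf n X) (perm_orbit n)"
  unfolding open_map_def
proof (intro allI impI)
  fix W assume W: "openin (PConf n X) W"
  then have sub: "W \<subseteq> topspace (PConf n X)" by (rule openin_subset)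
  have "{x \<in> topspace (PConf n X). perm_orbit n x \<in> perm_orbit n ` W} =
      (\<Union>\<sigma>\<in>{\<sigma>. \<sigma> permutes {..<n}}. {x \<in> topspace (PConf n X). x \<circ> \<sigma> \<in> W})"
    by (auto simp: perm_orbit_eq_iff image_iff)
  moreover have "openin (PConf n X) {x \<in> topspace (PConf n X). x \<circ> \<sigma> \<in> W}"
    if "\<sigma> permutes {..<n}" for \<sigma>
    by (rule openin_continuous_map_preimage[OF continuous_map_permute_PConf[OF that] W])
  ultimately have "openin (PConf n X) {x \<in> topspace (PConf n X). perm_orbit n x \<in> perm_orbit n ` W}"
    by auto
  with sub show "openin (Conf n X) (perm_orbit n ` W)"
    unfolding Conf_def openin_quotient_topology by blast
qed

section \<open>Lifting maps through the orbit map\<close>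

text \<open>The sets where the lifts differ by a given \<sigma> are closed because
  \<open>PConf n X\<close> is Hausdorff, disjoint because the action is free, and finitely many
  cover \<open>T\<close>. So each is clopen, and connectedness leaves only one.\<close>

lemma lifts_differ_by_permutation:
  assumes "Hausdorff_space X" "connected_space T"
    and g1: "continuous_map T (PConf n X) g1" and g2: "continuous_map T (PConf n X) g2"
    and eq: "\<And>x. x \<in> topspace T \<Longrightarrow> perm_orbit n (g1 x) = perm_orbit n (g2 x)"
  shows "\<exists>\<sigma>. \<sigma> permutes {..<n} \<and> (\<forall>x\<in>topspace T. g2 x = g1 x \<circ> \<sigma>)"
proof -
  define E where "E \<sigma> = {x \<in> topspace T. g2 x = (g1 x \<circ> \<sigma>)}" for \<sigma>
  define P where "P = {\<sigma>. \<sigma> permutes {..<n}}"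
  have fin: "finite P" unfolding P_def by (intro finite_permutations) simp
  have closed: "closedin T (E \<sigma>)" if "\<sigma> \<in> P" for \<sigma>
    unfolding E_def
    using that continuous_map_compose[OF g1 continuous_map_permute_PConf[of \<sigma> n X]]
    by (intro closedin_continuous_maps_eq[OF Hausdorff_PConf[OF assms(1)] g2]) (simp add: P_def o_def)
  have gX: "g1 x \<in> topspace (PConf n X)" if "x \<in> topspace T" for x
    using g1 that by (auto simp: continuous_map_def)
  have cover: "\<exists>\<sigma>\<in>P. x \<in> E \<sigma>" if "x \<in> topspace T" for x
    using eq[OF that] that by (auto simp: perm_orbit_eq_iff E_def P_def)
  have disj: "\<sigma> = \<tau>" if "x \<in> E \<sigma>" "x \<in> E \<tau>" "\<sigma> \<in> P" "\<tau> \<in> P" for x \<sigma> \<tau>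
    using that permute_PConf_cancel[OF gX] by (auto simp: E_def P_def)
  have op: "openin T (E \<sigma>)" if \<sigma>: "\<sigma> \<in> P" for \<sigma>
  proof -
    have "closedin T (\<Union>\<tau>\<in>P - {\<sigma>}. E \<tau>)"
      using fin closed by (intro closedin_Union) auto
    moreover have "E \<sigma> = topspace T - (\<Union>\<tau>\<in>P - {\<sigma>}. E \<tau>)"
    proof (intro equalityI subsetI)
      fix x assume x: "x \<in> E \<sigma>"
      then have "x \<in> topspace T" by (simp add: E_def)
      moreover have "x \<notin> E \<tau>" if "\<tau> \<in> P - {\<sigma>}" for \<tau>
        using disj[OF x _ \<sigma>, of \<tau>] that by auto
      ultimately show "x \<in> topspace T - (\<Union>\<tau>\<in>P - {\<sigma>}. E \<tau>)" by blast
    next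
      fix x assume x: "x \<in> topspace T - (\<Union>\<tau>\<in>P - {\<sigma>}. E \<tau>)"
      then obtain \<tau> where "\<tau> \<in> P" "x \<in> E \<tau>" using cover by blast
      with x show "x \<in> E \<sigma>" by blast
    qed
    ultimately show ?thesis by auto
  qed
  show ?thesis
  proof (cases "topspace T = {}")
    case True
    then show ?thesis by (intro exI[of _ id]) auto
  next
    case False
    then obtain x where x: "x \<in> topspace T" by blast
    then obtain \<sigma> where \<sigma>: "\<sigma> \<in> P" "x \<in> E \<sigma>" using cover by blast
    then have "E \<sigma> = topspace T"
      using assms(2) op closed unfolding connected_space_clopen_in by blast
    with \<sigma> show ?thesis by (auto simp: E_def P_def)
  qed
qed

text \<open>Disjoint neighbourhoods of the points of a configuration \<open>y\<close> give an open
  set \<open>W\<close> on which the orbit map is injective: a permutation that stays in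
  \<open>W\<close> must fix every index. As the orbit map is open, its inverse on the image of
  \<open>W\<close> is a continuous section.\<close>

lemma Conf_local_lift:
  assumes "Hausdorff_space X" and f: "continuous_map T (Conf n X) f" and z: "z \<in> topspace T"
  shows "\<exists>U g. openin T U \<and> z \<in> U \<and> continuous_map (subtopology T U) (PConf n X) g \<and>
    (\<forall>x\<in>U. perm_orbit n (g x) = f x)"
proof -
  have "f z \<in> topspace (Conf n X)" using f z by (auto simp: continuous_map_def)
  then obtain y where y: "y \<in> topspace (PConf n X)" "f z = perm_orbit n y"
    by (auto simp: topspace_Conf)
  have "\<exists>R. i < n \<longrightarrow> j < n \<longrightarrow> i \<noteq> j \<longrightarrow> openin X (fst R) \<and> openin X (snd R) \<and>
      y i \<in> fst R \<and> y j \<in> snd R \<and> disjnt (fst R) (snd R)" for i j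
  proof (cases "i < n \<and> j < n \<and> i \<noteq> j")
    case True
    then have "y i \<noteq> y j" "y i \<in> topspace X" "y j \<in> topspace X"
      using y(1) by (auto simp: topspace_PConf dest: inj_onD)
    then obtain P Q where "openin X P" "openin X Q" "y i \<in> P" "y j \<in> Q" "disjnt P Q"
      using assms(1) unfolding Hausdorff_space_def by blast
    then show ?thesis by (intro exI[of _ "(P, Q)"]) simp
  qed auto
  then have "\<exists>R. \<forall>i j. i < n \<longrightarrow> j < n \<longrightarrow> i \<noteq> j \<longrightarrow> openin X (fst (R i j)) \<and> openin X (snd (R i j)) \<and>
      y i \<in> fst (R i j) \<and> y j \<in> snd (R i j) \<and> disjnt (fst (R i j)) (snd (R i j))"
    by (intro choice allI)
  then obtain R where R: "\<And>i j. i < n \<Longrightarrow> j < n \<Longrightarrow> i \<noteq> j \<Longrightarrow> openin X (fst (R i j)) \<and>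
      openin X (snd (R i j)) \<and> y i \<in> fst (R i j) \<and> y j \<in> snd (R i j) \<and> disjnt (fst (R i j)) (snd (R i j))"
    by blast
  define P Q where "P i j = fst (R i j)" and "Q i j = snd (R i j)" for i j
  have PQ: "\<And>i j. i < n \<Longrightarrow> j < n \<Longrightarrow> i \<noteq> j \<Longrightarrow>
      openin X (P i j) \<and> openin X (Q i j) \<and> y i \<in> P i j \<and> y j \<in> Q i j \<and> disjnt (P i j) (Q i j)"
    unfolding P_def Q_def by (rule R)
  \<comment> \<open>The separating pairs for \<open>(i, j)\<close> and \<open>(j, i)\<close> are
    chosen independently, so each \<open>N i\<close> takes part in both. The factor
    \<open>topspace X\<close> covers a configuration of one point, where the intersection has no
    members.\<close>
  define N where "N i = topspace X \<inter> (\<Inter>j\<in>{..<n} - {i}. P i j \<inter> Q j i)" for i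
  have N: "openin X (N i)" "y i \<in> N i" if "i < n" for i
  proof -
    show "openin X (N i)"
    proof (cases "{..<n} - {i} = {}")
      case False
      then show ?thesis
        unfolding N_def using PQ that by (intro openin_Int openin_topspace openin_INT2) auto
    next
      case True
      then have "N i = topspace X" unfolding N_def by (simp only: image_empty Inter_empty Int_UNIV_right)
      then show ?thesis by simp
    qed
    show "y i \<in> N i"
      using PQ that y(1) by (auto simp: N_def topspace_PConf)
  qed
  have Ndisj: "i = j" if "x \<in> N i" "x \<in> N j" "i < n" "j < n" for i j x
  proof (rule ccontr)
    assume "i \<noteq> j"
    with that have "x \<in> P i j" "x \<in> Q i j" by (auto simp: N_def)
    with PQ[OF that(3,4) \<open>i \<noteq> j\<close>] show False by (auto simp: disjnt_iff)
  qed
  define W where "W = {x \<in> topspace (PConf n X). \<forall>i\<in>{..<n}. x i \<in> N i}"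
  have W: "openin (PConf n X) W"
  proof -
    have "W = topspace (PConf n X) \<inter> (\<Inter>i\<in>{..<n}. {x \<in> topspace (PConf n X). x i \<in> N i})"
      by (auto simp: W_def)
    moreover have "openin (PConf n X) {x \<in> topspace (PConf n X). x i \<in> N i}" if "i < n" for i
      by (rule openin_continuous_map_preimage[OF continuous_map_PConf_point[OF that] N(1)[OF that]])
    ultimately show ?thesis
      by (cases "n = 0") (auto intro!: openin_Int openin_INT2)
  qed
  have inj: "inj_on (perm_orbit n) W"
  proof (rule inj_onI)
    fix x x' assume x: "x \<in> W" "x' \<in> W" "perm_orbit n x = perm_orbit n x'"
    then obtain \<sigma> where \<sigma>: "\<sigma> permutes {..<n}" "x' = x \<circ> \<sigma>" by (auto simp: perm_orbit_eq_iff)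
    have "\<sigma> i = i" for i
    proof (cases "i < n")
      case True
      then have "\<sigma> i < n" using permutes_in_image[OF \<sigma>(1), of i] by simp
      moreover have "x (\<sigma> i) \<in> N i" "x (\<sigma> i) \<in> N (\<sigma> i)"
        using x True calculation by (auto simp: W_def \<sigma>(2))
      ultimately show ?thesis using Ndisj True by blast
    qed (use permutes_not_in[OF \<sigma>(1)] in simp)
    then show "x = x'" by (simp add: \<sigma>(2) fun_eq_iff)
  qed
  define V where "V = perm_orbit n ` W"
  define s where "s = inv_into W (perm_orbit n)"
  have V: "openin (Conf n X) V"
    using W open_map_perm_orbit by (auto simp: V_def open_map_def)
  have s: "continuous_map (subtopology (Conf n X) V) (PConf n X) s"
    unfolding continuous_map_def
  proof (intro conjI allI impI)
    show "s \<in> topspace (subtopology (Conf n X) V) \<rightarrow> topspace (PConf n X)"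
      using openin_subset[OF W] by (auto simp: s_def V_def inj)
    fix N assume N: "openin (PConf n X) N"
    have "openin (Conf n X) (perm_orbit n ` (W \<inter> N))"
      using open_map_perm_orbit openin_Int[OF W N] unfolding open_map_def by blast
    moreover have "{x \<in> topspace (subtopology (Conf n X) V). s x \<in> N} = perm_orbit n ` (W \<inter> N)"
      using openin_subset[OF V] by (auto simp: s_def V_def inj)
    ultimately show "openin (subtopology (Conf n X) V) {x \<in> topspace (subtopology (Conf n X) V). s x \<in> N}"
      using V by (auto simp: openin_open_subtopology V_def)
  qed
  define U where "U = {x \<in> topspace T. f x \<in> V}"
  have "openin T U"
    unfolding U_def by (rule openin_continuous_map_preimage[OF f V])
  moreover have "z \<in> U"
  proof -
    have "y \<in> W" using y(1) N(2) by (simp add: W_def)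
    with z y(2) show ?thesis by (simp add: U_def V_def)
  qed
  moreover have "continuous_map (subtopology T U) (subtopology (Conf n X) V) f"
    using continuous_map_from_subtopology[OF f, of U] by (auto simp: continuous_map_in_subtopology U_def)
  from continuous_map_compose[OF this s]
  have "continuous_map (subtopology T U) (PConf n X) (s \<circ> f)" .
  moreover have "perm_orbit n ((s \<circ> f) x) = f x" if "x \<in> U" for x
    using that by (simp add: U_def V_def s_def f_inv_into_f)
  ultimately show ?thesis by blast
qed

lemma connectedin_convex_powertop:
  assumes "\<And>x y u. x \<in> C \<Longrightarrow> y \<in> C \<Longrightarrow> 0 \<le> u \<Longrightarrow> u \<le> 1 \<Longrightarrow> (\<lambda>i. (1 - u) * x i + u * y i) \<in> C"
  shows "connectedin (powertop_real UNIV) (C :: (nat \<Rightarrow> real) set)"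
proof -
  have "path_connectedin (powertop_real UNIV) C"
    unfolding path_connectedin_def path_connected_space_def
  proof (intro conjI ballI)
    fix x y assume xy: "x \<in> topspace (subtopology (powertop_real UNIV) C)" "y \<in> topspace (subtopology (powertop_real UNIV) C)"
    define g where "g = (\<lambda>u i. (1 - u) * x i + u * y i)"
    have "continuous_map (top_of_set {0..1}) (powertop_real UNIV) g"
      unfolding continuous_map_componentwise_UNIV g_def by (auto intro!: continuous_intros)
    moreover have "g \<in> {0..1} \<rightarrow> C"
      using xy assms by (auto simp: g_def)
    ultimately have "pathin (subtopology (powertop_real UNIV) C) g"
      by (simp add: pathin_def continuous_map_in_subtopology)
    moreover have "g 0 = x" "g 1 = y" by (auto simp: g_def)
    ultimately show "\<exists>g. pathin (subtopology (powertop_real UNIV) C) g \<and> g 0 = x \<and> g 1 = y" by blast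
  qed auto
  then show ?thesis by (rule path_connectedin_imp_connectedin)
qed

text \<open>Coordinatewise bisection: the lift is extended from small boxes to slabs that are unbounded in
  the coordinates below \<open>k\<close>, by induction on \<open>k\<close>. Two lifts over adjacent slabs differ on the common
  face, which is connected, by a permutation.\<close>

lemma Conf_lift_over_simplex:
  fixes f :: "(nat \<Rightarrow> real) \<Rightarrow> (nat \<Rightarrow> 'a) set"
  assumes X: "Hausdorff_space X"
    and f: "continuous_map (subtopology (powertop_real UNIV) (standard_simplex p)) (Conf n X) f"
  shows "\<exists>g. continuous_map (subtopology (powertop_real UNIV) (standard_simplex p)) (PConf n X) g \<and>
    (\<forall>x\<in>standard_simplex p. perm_orbit n (g x) = f x)"
proof -
  let ?R = "powertop_real UNIV :: (nat \<Rightarrow> real) topology"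
  let ?S = "standard_simplex p"
  define L where "L C \<longleftrightarrow> (\<exists>g. continuous_map (subtopology ?R C) (PConf n X) g \<and>
    (\<forall>x\<in>C. perm_orbit n (g x) = f x))" for C
  have mono: "L C" if "L D" "C \<subseteq> D" for C D
    using that unfolding L_def by (meson continuous_map_from_subtopology_mono subsetD)
  have glue: "L C" if C: "C = C1 \<union> C2" "closedin (subtopology ?R C) C1" "closedin (subtopology ?R C) C2"
    and con: "connectedin ?R (C1 \<inter> C2)" and L: "L C1" "L C2" for C C1 C2
  proof -
    obtain g1 where g1: "continuous_map (subtopology ?R C1) (PConf n X) g1" "\<forall>x\<in>C1. perm_orbit n (g1 x) = f x"
      using L unfolding L_def by blast
    obtain g2 where g2: "continuous_map (subtopology ?R C2) (PConf n X) g2" "\<forall>x\<in>C2. perm_orbit n (g2 x) = f x"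
      using L unfolding L_def by blast
    have "\<exists>\<sigma>. \<sigma> permutes {..<n} \<and> (\<forall>x\<in>topspace (subtopology ?R (C1 \<inter> C2)). g1 x = g2 x \<circ> \<sigma>)"
      using con g1 g2 continuous_map_from_subtopology_mono[OF g1(1), of "C1 \<inter> C2"]
        continuous_map_from_subtopology_mono[OF g2(1), of "C1 \<inter> C2"]
      by (intro lifts_differ_by_permutation[OF X]) (auto simp: connectedin_def)
    then obtain \<sigma> where \<sigma>: "\<sigma> permutes {..<n}" "\<forall>x\<in>C1 \<inter> C2. g1 x = g2 x \<circ> \<sigma>" by auto
    define g2' where "g2' x = g2 x \<circ> \<sigma>" for x
    have g2': "continuous_map (subtopology ?R C2) (PConf n X) g2'"
      using continuous_map_compose[OF g2(1) continuous_map_permute_PConf[OF \<sigma>(1)]]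
      by (simp add: g2'_def[abs_def] o_def)
    have orb: "perm_orbit n (g2' x) = f x" if "x \<in> C2" for x
      using g2(2) that \<sigma>(1) perm_orbit_eq_iff[of n "g2 x" "g2' x"] by (auto simp: g2'_def)
    define g where "g x = (if x \<in> C1 then g1 x else g2' x)" for x
    have "continuous_map (subtopology ?R C) (PConf n X) g"
    proof (rule pasting_lemma_closed[where I = "{True, False}" and T = "\<lambda>b. if b then C1 else C2"
          and f = "\<lambda>b. if b then g1 else g2'"])
      show "closedin (subtopology ?R C) (if b then C1 else C2)" for b using C by simp
      have "subtopology (subtopology ?R C) C1 = subtopology ?R C1"
        "subtopology (subtopology ?R C) C2 = subtopology ?R C2"
        using C(1) by (simp_all add: subtopology_subtopology Int_absorb1)
      then show "continuous_map (subtopology (subtopology ?R C) (if b then C1 else C2)) (PConf n X)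
          (if b then g1 else g2')" for b
        using g1(1) g2' by simp
      show "(if i then g1 else g2') x = (if j then g1 else g2') x"
        if "x \<in> topspace (subtopology ?R C) \<inter> (if i then C1 else C2) \<inter> (if j then C1 else C2)" for i j x
        using that \<sigma>(2) by (auto simp: g2'_def split: if_splits)
      show "\<exists>j. j \<in> {True, False} \<and> x \<in> (if j then C1 else C2) \<and> g x = (if j then g1 else g2') x"
        if "x \<in> topspace (subtopology ?R C)" for x
      proof (cases "x \<in> C1")
        case True then show ?thesis by (intro exI[of _ True]) (simp add: g_def)
      next
        case False then show ?thesis using that C(1) by (intro exI[of _ False]) (auto simp: g_def)
      qed
    qed auto
    moreover have "perm_orbit n (g x) = f x" if "x \<in> C" for x
      using that C(1) g1(2) orb by (auto simp: g_def)
    ultimately show ?thesis unfolding L_def by blast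
  qed
  \<comment> \<open>\<open>B 0\<close> is a small box, \<open>B (Suc p)\<close> is the whole
    simplex, and each step in \<open>k\<close> frees one coordinate.\<close>
  define B where "B k z e = {x \<in> ?S. \<forall>i\<in>{k..p}. \<bar>x i - z i\<bar> \<le> e}" for k :: nat and z :: "nat \<Rightarrow> real" and e :: real
  \<comment> \<open>Points of the simplex vanish in the coordinates above \<open>p\<close>, so
    \<open>z\<close> is cut off there and only finitely many radii enter the minimum.\<close>
  have box: "\<exists>e>0. B 0 z e \<subseteq> N" if N: "openin ?R N" and z: "(\<lambda>i. if i \<le> p then z i else 0) \<in> N" for N z
  proof -
    obtain Y where Y: "\<forall>i. open (Y i)" "(\<lambda>i. if i \<le> p then z i else 0) \<in> Pi\<^sub>E UNIV Y" "Pi\<^sub>E UNIV Y \<subseteq> N"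
      using product_topology_open_contains_basis[OF N z] by auto
    have "\<exists>e. \<forall>i. i \<le> p \<longrightarrow> 0 < e i \<and> cball (z i) (e i) \<subseteq> Y i"
    proof (intro choice allI)
      fix i show "\<exists>e. i \<le> p \<longrightarrow> 0 < e \<and> cball (z i) e \<subseteq> Y i"
      proof (cases "i \<le> p")
        case True
        then have "z i \<in> Y i" using PiE_mem[OF Y(2), of i] by simp
        with Y(1) show ?thesis by (metis open_contains_cball)
      qed simp
    qed
    then obtain e where e: "\<And>i. i \<le> p \<Longrightarrow> 0 < e i \<and> cball (z i) (e i) \<subseteq> Y i" by blast
    have "0 < Min (e ` {..p})" using e by simp
    moreover have "B 0 z (Min (e ` {..p})) \<subseteq> N"
    proof
      fix x assume x: "x \<in> B 0 z (Min (e ` {..p}))"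
      have "x i \<in> Y i" for i
      proof (cases "i \<le> p")
        case True
        then have "\<bar>x i - z i\<bar> \<le> Min (e ` {..p})" using x by (simp add: B_def)
        also have "\<dots> \<le> e i" using True by simp
        finally have "x i \<in> cball (z i) (e i)" by (simp add: dist_real_def abs_minus_commute)
        with e[OF True] show ?thesis by blast
      next
        case False
        then have "x i = 0" using x by (simp add: B_def standard_simplex_def)
        then show ?thesis using PiE_mem[OF Y(2), of i] False by simp
      qed
      with Y(3) show "x \<in> N" by blast
    qed
    ultimately show ?thesis by blast
  qed
  \<comment> \<open>A centre outside the simplex is allowed, as the bisection does not keep
    \<open>z\<close> inside it; the simplex is closed, so a small box around such a centre misses
    it.\<close>
  have base: "\<exists>e>0. L (B 0 z e)" for z
  proof (cases "(\<lambda>i. if i \<le> p then z i else 0) \<in> ?S")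
    case True
    then obtain U g where U: "openin (subtopology ?R ?S) U" "(\<lambda>i. if i \<le> p then z i else 0) \<in> U"
        "continuous_map (subtopology (subtopology ?R ?S) U) (PConf n X) g" "\<forall>x\<in>U. perm_orbit n (g x) = f x"
      using Conf_local_lift[OF X f, of "\<lambda>i. if i \<le> p then z i else 0"] by auto
    obtain N where N: "openin ?R N" "U = N \<inter> ?S" using U(1) by (auto simp: openin_subtopology)
    then obtain e where e: "0 < e" "B 0 z e \<subseteq> N" using box[OF N(1), of z] U(2) by blast
    have "subtopology (subtopology ?R ?S) U = subtopology ?R U"
      using N(2) by (simp add: subtopology_subtopology Int_absorb1)
    with U have "L U" unfolding L_def by auto
    moreover have "B 0 z e \<subseteq> U" using e N(2) by (auto simp: B_def)
    ultimately show ?thesis using e(1) mono by blast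
  next
    case False
    have "openin ?R (topspace ?R - ?S)"
      by (rule openin_diff[OF openin_topspace closedin_standard_simplex])
    then obtain e where e: "0 < e" "B 0 z e \<subseteq> topspace ?R - ?S"
      using box[of "topspace ?R - ?S" z] False by auto
    then have "B 0 z e = {}" by (auto simp: B_def)
    then have "L (B 0 z e)" by (simp add: L_def)
    with e(1) show ?thesis by blast
  qed
  have "\<exists>e>0. L (B k z e)" if "k \<le> Suc p" for k z
    using that
  proof (induction k arbitrary: z)
    case 0
    show ?case by (rule base)
  next
    case (Suc k)
    then have k: "k \<le> p" by simp
    define D where "D a b e = {x \<in> ?S. a \<le> x k \<and> x k \<le> b \<and> (\<forall>i\<in>{Suc k..p}. \<bar>x i - z i\<bar> \<le> e)}" for a b e
    have Dmono: "D a b e \<subseteq> D a b e'" if "e \<le> e'" for a b e e'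
      using that by (auto simp: D_def)
    have D_closed: "closedin (subtopology ?R C) {x \<in> C. x k \<in> I}" if "closed I" for C I
    proof -
      have "continuous_map (subtopology ?R C) euclideanreal (\<lambda>x. x k)"
        using continuous_map_product_projection[of k UNIV "\<lambda>_. euclideanreal"]
        by (intro continuous_map_from_subtopology) simp
      from closedin_continuous_map_preimage[OF this, of I] that show ?thesis by simp
    qed
    \<comment> \<open>Bisection of the range of coordinate \<open>k\<close>. The radius
      \<open>e\<close> in the later coordinates belongs to the bisected property, since it shrinks
      to a minimum at each gluing.\<close>
    have "\<exists>e>0. L (D 0 1 e)"
    proof (rule Bolzano[of 0 1 "\<lambda>a b. \<exists>e>0. L (D a b e)"])
      fix a b c assume "\<exists>e>0. L (D a b e)" "\<exists>e>0. L (D b c e)" and abc: "a \<le> b" "b \<le> c"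
      then obtain e1 e2 where e12: "0 < e1" "0 < e2" "L (D a b e1)" "L (D b c e2)" by blast
      define e where "e = min e1 e2"
      have "L (D a c e)"
      proof (rule glue)
        show "D a c e = D a b e \<union> D b c e" using abc by (auto simp: D_def)
        have "D a b e = {x \<in> D a c e. x k \<in> {..b}}" "D b c e = {x \<in> D a c e. x k \<in> {b..}}"
          using abc by (auto simp: D_def)
        then show "closedin (subtopology ?R (D a c e)) (D a b e)" "closedin (subtopology ?R (D a c e)) (D b c e)"
          using D_closed[of "{..b}" "D a c e"] D_closed[of "{b..}" "D a c e"] by simp_all
        show "L (D a b e)" "L (D b c e)"
          using mono[OF e12(3) Dmono] mono[OF e12(4) Dmono] by (simp_all add: e_def)
        have DI: "D a b e \<inter> D b c e = {x \<in> ?S. x k = b \<and> (\<forall>i\<in>{Suc k..p}. \<bar>x i - z i\<bar> \<le> e)}"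
          using abc by (auto simp: D_def)
        show "connectedin ?R (D a b e \<inter> D b c e)"
          unfolding DI
        proof (rule connectedin_convex_powertop)
          fix x y and u :: real
          assume x: "x \<in> {x \<in> ?S. x k = b \<and> (\<forall>i\<in>{Suc k..p}. \<bar>x i - z i\<bar> \<le> e)}"
            and y: "y \<in> {x \<in> ?S. x k = b \<and> (\<forall>i\<in>{Suc k..p}. \<bar>x i - z i\<bar> \<le> e)}"
            and u: "0 \<le> u" "u \<le> 1"
          have "(\<lambda>i. (1 - u) * x i + u * y i) \<in> ?S"
            using x y u by (intro convex_standard_simplex) auto
          moreover have "(1 - u) * x k + u * y k = b"
            using x y by (simp add: algebra_simps)
          moreover have "\<bar>(1 - u) * x i + u * y i - z i\<bar> \<le> e" if "i \<in> {Suc k..p}" for i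
          proof -
            have "(1 - u) * x i + u * y i - z i = (1 - u) * (x i - z i) + u * (y i - z i)"
              by (simp add: algebra_simps)
            also have "\<bar>\<dots>\<bar> \<le> (1 - u) * \<bar>x i - z i\<bar> + u * \<bar>y i - z i\<bar>"
              using u by (intro order_trans[OF abs_triangle_ineq]) (simp add: abs_mult)
            also have "\<dots> \<le> e"
              using x y u that by (intro convex_bound_le) auto
            finally show ?thesis .
          qed
          ultimately show "(\<lambda>i. (1 - u) * x i + u * y i) \<in>
              {x \<in> ?S. x k = b \<and> (\<forall>i\<in>{Suc k..p}. \<bar>x i - z i\<bar> \<le> e)}"
            by blast
        qed
      qed
      moreover have "0 < e" using e12 by (simp add: e_def)
      ultimately show "\<exists>e>0. L (D a c e)" by blast
    next
      fix w :: real
      obtain e where e: "0 < e" "L (B k (z(k := w)) e)"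
        using Suc.IH[of "z(k := w)"] k le_SucI by blast
      have "L (D a b e)" if ab: "a \<le> w" "w \<le> b" "b - a < e" for a b
      proof (rule mono[OF e(2)], rule subsetI)
        fix x assume x: "x \<in> D a b e"
        have "\<bar>x i - (z(k := w)) i\<bar> \<le> e" if "i \<in> {k..p}" for i
        proof (cases "i = k")
          case True
          then show ?thesis using x ab by (auto simp: D_def)
        next
          case False
          then show ?thesis using x that by (auto simp: D_def)
        qed
        then show "x \<in> B k (z(k := w)) e" using x by (auto simp: B_def D_def)
      qed
      then show "\<exists>d>0. \<forall>a b. a \<le> w \<and> w \<le> b \<and> b - a < d \<longrightarrow> (\<exists>e>0. L (D a b e))"
        using e(1) by blast
    qed simp
    then obtain e where e: "0 < e" "L (D 0 1 e)" by blast
    have "B (Suc k) z e \<subseteq> D 0 1 e"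
      by (auto simp: B_def D_def standard_simplex_def)
    with e mono show ?case by blast
  qed
  then obtain e where "L (B (Suc p) (\<lambda>_. 0) e)" by blast
  then have "L ?S" by (simp add: B_def)
  then show ?thesis unfolding L_def .
qed

lemma singular_simplex_Conf_lift:
  assumes "Hausdorff_space X" "singular_simplex p (Conf n X) s"
  shows "\<exists>t. singular_simplex p (PConf n X) t \<and> simplex_map p (perm_orbit n) t = s"
proof -
  have s: "continuous_map (subtopology (powertop_real UNIV) (standard_simplex p)) (Conf n X) s"
    "s \<in> extensional (standard_simplex p)"
    using assms(2) by (auto simp: singular_simplex_def)
  obtain g where g: "continuous_map (subtopology (powertop_real UNIV) (standard_simplex p)) (PConf n X) g"
    "\<And>x. x \<in> standard_simplex p \<Longrightarrow> perm_orbit n (g x) = s x"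
    using Conf_lift_over_simplex[OF assms(1) s(1)] by blast
  have "singular_simplex p (PConf n X) (restrict g (standard_simplex p))"
    using g(1) by (simp add: singular_simplex_def)
  moreover have "simplex_map p (perm_orbit n) (restrict g (standard_simplex p)) = s"
    using g(2) s(2) by (auto simp: simplex_map_def fun_eq_iff extensional_def)
  ultimately show ?thesis by blast
qed

lemma singular_simplex_lifts_permuted:
  assumes "Hausdorff_space X" "singular_simplex p (PConf n X) s" "singular_simplex p (PConf n X) t"
    and "simplex_map p (perm_orbit n) s = simplex_map p (perm_orbit n) t"
  shows "\<exists>\<sigma>. \<sigma> permutes {..<n} \<and> t = simplex_map p (\<lambda>f. f \<circ> \<sigma>) s"
proof -
  let ?T = "subtopology (powertop_real UNIV) (standard_simplex p)"
  have "perm_orbit n (s x) = perm_orbit n (t x)" if "x \<in> standard_simplex p" for x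
    using fun_cong[OF assms(4), of x] that by (simp add: simplex_map_def)
  then obtain \<sigma> where \<sigma>: "\<sigma> permutes {..<n}" "\<forall>x\<in>standard_simplex p. t x = s x \<circ> \<sigma>"
    using lifts_differ_by_permutation[OF assms(1), of ?T n s t] assms(2,3) connectedin_standard_simplex[of p]
    by (auto simp: singular_simplex_def connectedin_def)
  have "t = simplex_map p (\<lambda>f. f \<circ> \<sigma>) s"
    using \<sigma>(2) assms(3) by (auto simp: simplex_map_def fun_eq_iff singular_simplex_def extensional_def)
  with \<sigma>(1) show ?thesis by blast
qed

section \<open>Chains on unordered configurations and transfer\<close>

lemma chain_induct [consumes 1, case_names simplex diff]:
  assumes "singular_chain p X c"
    and "\<And>s. singular_simplex p X s \<Longrightarrow> P (frag_of s)"
    and "\<And>a b. singular_chain p X a \<Longrightarrow> singular_chain p X b \<Longrightarrow> P a \<Longrightarrow> P b \<Longrightarrow> P (a - b)"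
    and zero: "P 0"
  shows "P c"
proof -
  have "Poly_Mapping.keys c \<subseteq> singular_simplex_set p X"
    using assms(1) by (simp add: singular_chain_def)
  then have "singular_chain p X c \<and> P c"
  proof (induction c rule: frag_induction)
    case (diff a b)
    then show ?case using assms(3) singular_chain_diff by blast
  qed (use assms(2) zero in \<open>auto simp: singular_chain_of\<close>)
  then show ?thesis ..
qed

lemma singular_chain_Conf_lift:
  assumes "Hausdorff_space X" "singular_chain p (Conf n X) c"
  shows "\<exists>d. singular_chain p (PConf n X) d \<and> chain_map p (perm_orbit n) d = c"
  using assms(2)
proof (induction rule: chain_induct)
  case (simplex s)
  then obtain t where "singular_simplex p (PConf n X) t" "simplex_map p (perm_orbit n) t = s"
    using singular_simplex_Conf_lift[OF assms(1)] by blast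
  then show ?case by (intro exI[of _ "frag_of t"]) (simp add: singular_chain_of)
next
  case (diff a b)
  then obtain d e where "singular_chain p (PConf n X) d" "chain_map p (perm_orbit n) d = a"
    "singular_chain p (PConf n X) e" "chain_map p (perm_orbit n) e = b" by blast
  then show ?case by (intro exI[of _ "d - e"]) (simp add: singular_chain_diff chain_map_diff)
qed (auto intro: exI[of _ 0])

text \<open>Well defined because singular simplices lift to \<open>PConf n X\<close> uniquely up to permutations of the points.\<close>

lemma invariant_sum_descends_to_Conf:
  fixes h :: "'j \<Rightarrow> (nat \<Rightarrow> 'a) \<Rightarrow> 'b"
  assumes X: "Hausdorff_space X"
    and h: "\<And>j. j \<in> J \<Longrightarrow> continuous_map (PConf n X) Z (h j)"
    and inv: "\<And>q s \<sigma>. singular_simplex q (PConf n X) s \<Longrightarrow> \<sigma> permutes {..<n} \<Longrightarrow>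
      (\<Sum>j\<in>J. frag_of (simplex_map q (h j) (simplex_map q (\<lambda>f. f \<circ> \<sigma>) s))) =
      (\<Sum>j\<in>J. frag_of (simplex_map q (h j) s))"
  obtains \<tau> :: "nat \<Rightarrow> (nat \<Rightarrow> 'a) set chain \<Rightarrow> 'b chain" where
    "\<And>q a b. \<tau> q (a - b) = \<tau> q a - \<tau> q b"
    "\<And>q c. singular_chain q (Conf n X) c \<Longrightarrow> singular_chain q Z (\<tau> q c)"
    "\<And>q c. singular_chain (Suc q) (Conf n X) c \<Longrightarrow>
      chain_boundary (Suc q) (\<tau> (Suc q) c) = \<tau> q (chain_boundary (Suc q) c)"
    "\<And>q c. singular_chain q (PConf n X) c \<Longrightarrow>
      \<tau> q (chain_map q (perm_orbit n) c) = (\<Sum>j\<in>J. chain_map q (h j) c)"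
proof -
  define lift where "lift q s = (SOME t. singular_simplex q (PConf n X) t \<and> simplex_map q (perm_orbit n) t = s)"
    for q s
  define \<tau> where "\<tau> q = frag_extend (\<lambda>s. \<Sum>j\<in>J. frag_of (simplex_map q (h j) (lift q s)))" for q
  define K where "K q c = (\<Sum>j\<in>J. chain_map q (h j) c)" for q c
  have \<tau>_diff: "\<tau> q (a - b) = \<tau> q a - \<tau> q b" for q a b
    by (simp add: \<tau>_def frag_extend_diff)
  have K_chain: "singular_chain q Z (K q c)" if "singular_chain q (PConf n X) c" for q c
    unfolding K_def using that h by (intro singular_chain_sum singular_chain_chain_map)
  have K_boundary: "chain_boundary (Suc q) (K (Suc q) c) = K q (chain_boundary (Suc q) c)"
    if "singular_chain (Suc q) (PConf n X) c" for q c
    unfolding K_def chain_boundary_sum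
    by (rule sum.cong) (simp_all add: chain_boundary_chain_map[OF that])
  \<comment> \<open>The faces of a chosen lift need not be the chosen lifts of the faces, so
    compatibility with boundaries is not visible from the definition of \<tau>. This formula holds
    for every chain upstairs, whatever lifts it consists of, and carries the boundary relation
    down.\<close>
  have \<tau>_K: "\<tau> q (chain_map q (perm_orbit n) c) = K q c" if "singular_chain q (PConf n X) c" for q c
    using that
  proof (induction rule: chain_induct)
    case (simplex s)
    let ?t = "lift q (simplex_map q (perm_orbit n) s)"
    have "singular_simplex q (PConf n X) ?t \<and> simplex_map q (perm_orbit n) ?t = simplex_map q (perm_orbit n) s"
      unfolding lift_def by (rule someI[of _ s]) (use simplex in simp)
    then obtain \<sigma> where \<sigma>: "\<sigma> permutes {..<n}" "?t = simplex_map q (\<lambda>f. f \<circ> \<sigma>) s"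
      using singular_simplex_lifts_permuted[OF X simplex, of ?t] by auto
    have "\<tau> q (chain_map q (perm_orbit n) (frag_of s)) = (\<Sum>j\<in>J. frag_of (simplex_map q (h j) ?t))"
      by (simp add: \<tau>_def)
    also have "\<dots> = (\<Sum>j\<in>J. frag_of (simplex_map q (h j) s))"
      unfolding \<sigma>(2) by (rule inv[OF simplex \<sigma>(1)])
    finally show ?case by (simp add: K_def)
  next
    case (diff a b)
    then show ?case by (simp add: chain_map_diff \<tau>_diff K_def sum_subtractf)
  qed (simp add: \<tau>_def K_def)
  show ?thesis
  proof (rule that[of \<tau>])
    fix q c assume c: "singular_chain q (Conf n X) c"
    obtain d where d: "singular_chain q (PConf n X) d" "chain_map q (perm_orbit n) d = c"
      using singular_chain_Conf_lift[OF X c] by blast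
    show "singular_chain q Z (\<tau> q c)"
      using K_chain[OF d(1)] \<tau>_K[OF d(1)] by (simp add: d(2))
  next
    fix q c assume c: "singular_chain (Suc q) (Conf n X) c"
    obtain d where d: "singular_chain (Suc q) (PConf n X) d" "chain_map (Suc q) (perm_orbit n) d = c"
      using singular_chain_Conf_lift[OF X c] by blast
    have "chain_boundary (Suc q) (\<tau> (Suc q) c) = K q (chain_boundary (Suc q) d)"
      by (simp add: d(2)[symmetric] \<tau>_K[OF d(1)] K_boundary[OF d(1)])
    also have "\<dots> = \<tau> q (chain_map q (perm_orbit n) (chain_boundary (Suc q) d))"
      by (rule \<tau>_K[symmetric]) (rule singular_chain_boundary_alt[OF d(1)])
    also have "\<dots> = \<tau> q (chain_boundary (Suc q) c)"
      using chain_boundary_chain_map[OF d(1), of "perm_orbit n"] by (simp add: d(2))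
    finally show "chain_boundary (Suc q) (\<tau> (Suc q) c) = \<tau> q (chain_boundary (Suc q) c)" .
  qed (use \<tau>_diff \<tau>_K in \<open>auto simp: K_def\<close>)
qed

text \<open>A lift \<open>d\<close> of a cycle need not be a cycle. The sum over all permutations of
  the lift is one, being the value of a chain map at \<open>c\<close>, and each of its
  \<open>n!\<close> summands projects to \<open>c\<close>.\<close>

lemma Conf_cycle_transfer:
  assumes X: "Hausdorff_space X" and c: "singular_relcycle p (Conf n X) {} c"
  shows "\<exists>d. singular_relcycle p (PConf n X) {} d \<and> chain_map p (perm_orbit n) d = frag_cmul (fact n) c"
proof -
  define P where "P = {\<sigma>. \<sigma> permutes {..<n}}"
  have finP: "finite P" and cardP: "card P = fact n"
    unfolding P_def by (auto intro: finite_permutations simp: card_permutations)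
  have inv: "(\<Sum>\<tau>\<in>P. frag_of (simplex_map q (\<lambda>f. f \<circ> \<tau>) (simplex_map q (\<lambda>f. f \<circ> \<sigma>) s))) =
      (\<Sum>\<tau>\<in>P. frag_of (simplex_map q (\<lambda>f. f \<circ> \<tau>) s))" 
    if "singular_simplex q (PConf n X) s" and \<sigma>: "\<sigma> permutes {..<n}" for q \<sigma> s
  proof -
    have *: "simplex_map q (\<lambda>f. f \<circ> \<tau>) (simplex_map q (\<lambda>f. f \<circ> \<sigma>) s) = simplex_map q (\<lambda>f. f \<circ> (\<sigma> \<circ> \<tau>)) s" for \<tau>
      by (auto simp: simplex_map_def fun_eq_iff)
    show ?thesis
      unfolding P_def * by (rule setum_permutations_compose_left[OF \<sigma>, symmetric])
  qed
  have cont: "continuous_map (PConf n X) (PConf n X) (\<lambda>f. f \<circ> \<sigma>)" if "\<sigma> \<in> P" for \<sigma>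
    using that by (simp add: P_def continuous_map_permute_PConf)
  obtain \<tau> :: "nat \<Rightarrow> (nat \<Rightarrow> 'a) set chain \<Rightarrow> (nat \<Rightarrow> 'a) chain"
    where \<tau>: "\<And>q a b. \<tau> q (a - b) = \<tau> q a - \<tau> q b"
    "\<And>q c. singular_chain q (Conf n X) c \<Longrightarrow> singular_chain q (PConf n X) (\<tau> q c)"
    "\<And>q c. singular_chain (Suc q) (Conf n X) c \<Longrightarrow>
      chain_boundary (Suc q) (\<tau> (Suc q) c) = \<tau> q (chain_boundary (Suc q) c)"
    "\<And>q c. singular_chain q (PConf n X) c \<Longrightarrow>
      \<tau> q (chain_map q (perm_orbit n) c) = (\<Sum>\<sigma>\<in>P. chain_map q (\<lambda>f. f \<circ> \<sigma>) c)"
    by (rule invariant_sum_descends_to_Conf[OF X, where J = P and h = "\<lambda>\<sigma> f. f \<circ> \<sigma>", OF cont inv]) blast+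
  have cc: "singular_chain p (Conf n X) c" "chain_boundary p c = 0"
    using c by (auto simp: singular_cycle)
  obtain d where d: "singular_chain p (PConf n X) d" "chain_map p (perm_orbit n) d = c"
    using singular_chain_Conf_lift[OF X cc(1)] by blast
  have "chain_boundary p (\<tau> p c) = 0"
  proof (cases p)
    case (Suc q)
    then show ?thesis using \<tau>(3)[of q c] cc \<tau>(1)[of q 0 0] by simp
  qed (simp add: chain_boundary_def)
  then have "singular_relcycle p (PConf n X) {} (\<tau> p c)"
    using \<tau>(2)[OF cc(1)] by (simp add: singular_cycle)
  moreover have "chain_map p (perm_orbit n) (\<tau> p c) = frag_cmul (fact n) c"
  proof -
    have "chain_map p (perm_orbit n) (chain_map p (\<lambda>f. f \<circ> \<sigma>) d) = c" if "\<sigma> \<in> P" for \<sigma>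
    proof -
      have "chain_map p (perm_orbit n \<circ> (\<lambda>f. f \<circ> \<sigma>)) d = chain_map p (perm_orbit n) d"
        using that perm_orbit_eq_iff by (intro chain_map_eq[OF d(1)]) (auto simp: P_def)
      then show ?thesis by (simp add: chain_map_compose d(2))
    qed
    then have "chain_map p (perm_orbit n) (\<tau> p c) = (\<Sum>\<sigma>\<in>P. c)"
      using finP by (simp add: \<tau>(4)[OF d(1)] chain_map_sum flip: d(2))
    also have "\<dots> = frag_cmul (int (card P)) c"
      using finP by (induction P rule: finite_induct) (simp_all add: frag_cmul_distrib add.commute)
    also have "\<dots> = frag_cmul (fact n) c"
      by (simp add: cardP)
    finally show ?thesis .
  qed
  ultimately show ?thesis by blast
qed

section \<open>Dropping and doubling points\<close>

text \<open>Gives the Lindelof property of \<open>PConf n X\<close>. Second countability is carried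
  along because the Lindelof property itself does not pass to products.\<close>

lemma second_countable_product:
  assumes "second_countable X" "finite I"
  shows "second_countable (product_topology (\<lambda>_. X) I)"
proof -
  obtain \<B> where \<B>: "countable \<B>" "\<And>V. V \<in> \<B> \<Longrightarrow> openin X V"
      "\<And>U x. openin X U \<Longrightarrow> x \<in> U \<Longrightarrow> \<exists>V\<in>\<B>. x \<in> V \<and> V \<subseteq> U"
    using assms(1) unfolding second_countable_def by metis
  show ?thesis
    unfolding second_countable_def
  proof (intro exI[of _ "Pi\<^sub>E I ` (I \<rightarrow>\<^sub>E \<B>)"] conjI ballI allI impI)
    show "countable (Pi\<^sub>E I ` (I \<rightarrow>\<^sub>E \<B>))"
      using \<B>(1) assms(2) by (intro countable_image countable_PiE) auto
    show "openin (product_topology (\<lambda>_. X) I) V" if V: "V \<in> Pi\<^sub>E I ` (I \<rightarrow>\<^sub>E \<B>)" for V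
    proof -
      obtain B where B: "B \<in> I \<rightarrow>\<^sub>E \<B>" "V = Pi\<^sub>E I B" using V by blast
      have "finite {i \<in> I. B i \<noteq> topspace X}" using assms(2) by simp
      moreover have "openin X (B i)" if "i \<in> I" for i
        using \<B>(2) PiE_mem[OF B(1) that] .
      ultimately show ?thesis
        unfolding B(2) openin_PiE_gen by blast
    qed
    fix U x assume "openin (product_topology (\<lambda>_. X) I) U \<and> x \<in> U"
    then obtain Y where Y: "\<And>i. i \<in> I \<Longrightarrow> openin X (Y i)" "x \<in> Pi\<^sub>E I Y" "Pi\<^sub>E I Y \<subseteq> U"
      unfolding openin_product_topology_alt by metis
    have "\<exists>V\<in>\<B>. x i \<in> V \<and> V \<subseteq> Y i" if "i \<in> I" for i
      using \<B>(3)[OF Y(1)[OF that] PiE_mem[OF Y(2) that]] .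
    then obtain V where V: "\<And>i. i \<in> I \<Longrightarrow> V i \<in> \<B> \<and> x i \<in> V i \<and> V i \<subseteq> Y i" by metis
    have "Pi\<^sub>E I (restrict V I) \<in> Pi\<^sub>E I ` (I \<rightarrow>\<^sub>E \<B>)"
      using V by (intro imageI) (simp add: PiE_iff extensional_def)
    moreover have "x \<in> Pi\<^sub>E I (restrict V I)"
      using V Y(2) by (simp add: PiE_iff)
    moreover have "Pi\<^sub>E I (restrict V I) \<subseteq> U"
      by (rule order_trans[OF PiE_mono Y(3)]) (use V in simp)
    ultimately show "\<exists>V\<in>Pi\<^sub>E I ` (I \<rightarrow>\<^sub>E \<B>). x \<in> V \<and> V \<subseteq> U" by blast
  qed
qed

lemma homotopy_imp_homologous:
  assumes H: "continuous_map (prod_topology (top_of_set {0..1::real}) S) U H"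
    and f: "\<And>x. x \<in> topspace S \<Longrightarrow> H (0, x) = f x" and g: "\<And>x. x \<in> topspace S \<Longrightarrow> H (1, x) = g x"
    and c: "singular_relcycle p S {} c"
  shows "homologous_rel p U {} (chain_map p f c) (chain_map p g c)"
proof -
  have "homotopic_with (\<lambda>h. h \<in> {} \<rightarrow> {}) S U (\<lambda>x. H (0, x)) (\<lambda>x. H (1, x))"
    unfolding homotopic_with_def using H by (intro exI[of _ H]) simp
  from homotopic_imp_homologous_rel_chain_maps[OF this c]
  have "homologous_rel p U {} (chain_map p (\<lambda>x. H (0, x)) c) (chain_map p (\<lambda>x. H (1, x)) c)" .
  moreover have "singular_chain p S c" using c by (simp add: singular_cycle)
  ultimately show ?thesis
    using chain_map_eq[of p S c "\<lambda>x. H (0, x)" f] chain_map_eq[of p S c "\<lambda>x. H (1, x)" g] f g by simp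
qed

section \<open>Index combinatorics of dropping and doubling\<close>

definition drop_point :: "nat \<Rightarrow> nat \<Rightarrow> (nat \<Rightarrow> 'a) \<Rightarrow> nat \<Rightarrow> 'a" where
  "drop_point n k y = (\<lambda>i. if i < n then (if i < k then y i else y (Suc i)) else undefined)"

lemma continuous_map_drop_point:
  "continuous_map (PConf (Suc n) X) (PConf n X) (drop_point n k)"
  unfolding continuous_map_into_PConf
proof (intro conjI allI impI ballI)
  fix i assume "i < n"
  then show "continuous_map (PConf (Suc n) X) X (\<lambda>y. drop_point n k y i)"
    by (auto simp: drop_point_def intro!: continuous_map_PConf_point)
next
  fix y assume "y \<in> topspace (PConf (Suc n) X)"
  then have inj: "inj_on y {..<Suc n}" by (simp add: topspace_PConf)
  show "inj_on (drop_point n k y) {..<n}"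
  proof (rule inj_onI)
    fix a b assume ab: "a \<in> {..<n}" "b \<in> {..<n}" "drop_point n k y a = drop_point n k y b"
    then have "y (if a < k then a else Suc a) = y (if b < k then b else Suc b)"
      by (auto simp: drop_point_def split: if_splits)
    with ab have "(if a < k then a else Suc a) = (if b < k then b else Suc b)"
      by (intro inj_onD[OF inj]) auto
    then show "a = b" by (auto split: if_splits)
  qed
qed (auto simp: drop_point_def extensional_def)

lemma drop_point_image:
  assumes "k \<le> n"
  shows "drop_point n k y ` {..<n} = y ` ({..<Suc n} - {k})"
proof -
  have "drop_point n k y ` {..<n} = y ` ((\<lambda>i. if i < k then i else Suc i) ` {..<n})"
    unfolding image_image by (rule image_cong) (auto simp: drop_point_def)
  also have "(\<lambda>i. if i < k then i else Suc i) ` {..<n} = {..<Suc n} - {k}"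
  proof (intro equalityI subsetI)
    fix j assume j: "j \<in> {..<Suc n} - {k}"
    show "j \<in> (\<lambda>i. if i < k then i else Suc i) ` {..<n}"
    proof (cases "j < k")
      case True then show ?thesis using assms by (intro image_eqI[of _ _ j]) auto
    next
      case False then show ?thesis using j by (intro image_eqI[of _ _ "j - 1"]) auto
    qed
  qed (use assms in \<open>auto split: if_splits\<close>)
  finally show ?thesis .
qed

text \<open>An orbit is determined by its set of points, and both sides consist of the points of
  \<open>y\<close> other than \<open>y (\<sigma> k)\<close>.\<close>

lemma perm_orbit_drop_permute:
  assumes y: "y \<in> topspace (PConf (Suc n) X)" and \<sigma>: "\<sigma> permutes {..<Suc n}" and k: "k \<le> n"
  shows "perm_orbit n (drop_point n k (y \<circ> \<sigma>)) = perm_orbit n (drop_point n (\<sigma> k) y)"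
proof (rule perm_orbit_eq_if_same_points)
  have mem: "drop_point n k' z \<in> topspace (PConf n X)" if "z \<in> topspace (PConf (Suc n) X)" for k' z
    using continuous_map_drop_point[of n X k'] that by (auto simp: continuous_map_def)
  show "drop_point n k (y \<circ> \<sigma>) \<in> topspace (PConf n X)" "drop_point n (\<sigma> k) y \<in> topspace (PConf n X)"
    using y permute_in_PConf[OF \<sigma> y] mem by auto
  have "\<sigma> k \<le> n" using permutes_in_image[OF \<sigma>, of k] k by simp
  moreover have "\<sigma> ` ({..<Suc n} - {k}) = {..<Suc n} - {\<sigma> k}"
    using permutes_image[OF \<sigma>] permutes_inj[OF \<sigma>] by (simp add: image_set_diff)
  ultimately show "drop_point n k (y \<circ> \<sigma>) ` {..<n} = drop_point n (\<sigma> k) y ` {..<n}"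
    using k image_comp[of y \<sigma> "{..<Suc n} - {k}"] by (simp add: drop_point_image)
qed

text \<open>The new point is inserted directly behind \<open>y j\<close>, so that dropping either
  half restores the indices of all other points.\<close>

definition double_point :: "('a \<times> real \<Rightarrow> 'a) \<Rightarrow> nat \<Rightarrow> nat \<Rightarrow> real \<Rightarrow> (nat \<Rightarrow> 'a) \<Rightarrow> nat \<Rightarrow> 'a" where
  "double_point \<Phi> n j t y = (\<lambda>i. if i \<le> j then y i else if i = Suc j then \<Phi> (y j, t)
    else if i \<le> n then y (i - 1) else undefined)"

lemma drop_double_same:
  assumes "y \<in> extensional {..<n}" "j < n"
  shows "drop_point n (Suc j) (double_point \<Phi> n j t y) = y"
    and "drop_point n j (double_point \<Phi> n j t y) = y(j := \<Phi> (y j, t))"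
  using assms by (auto simp: drop_point_def double_point_def fun_eq_iff extensional_def)

lemma drop_double_less:
  assumes "k < j" "j < Suc n"
  shows "drop_point (Suc n) k (double_point \<Phi> (Suc n) j t y) = double_point \<Phi> n (j - 1) t (drop_point n k y)"
  using assms by (auto simp: drop_point_def double_point_def fun_eq_iff)

lemma drop_double_greater:
  assumes "Suc j < k" "k \<le> Suc n"
  shows "drop_point (Suc n) k (double_point \<Phi> (Suc n) j t y) = double_point \<Phi> n j t (drop_point n (k - 1) y)"
  using assms by (auto simp: drop_point_def double_point_def fun_eq_iff)

text \<open>The bookkeeping of \<open>T D = D T + 2 n\<close>. For each \<open>j\<close> the indices
  \<open>j\<close> and \<open>Suc j\<close> contribute \<open>c\<close>. The pairs with
  \<open>k < j\<close> become the pairs with \<open>k\<close> at most the new \<open>j\<close>,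
  those with \<open>k > Suc j\<close> become the pairs with \<open>k\<close> above \<open>j\<close>,
  and together they exhaust the sum for \<open>D T\<close>.\<close>

lemma sum_drop_double:
  fixes G :: "nat \<Rightarrow> nat \<Rightarrow> 'b :: ab_group_add"
  shows "(\<Sum>j<Suc m. \<Sum>k\<le>Suc m. if k < j then G k (j - 1) else if Suc j < k then G (k - 1) j else c) =
    (\<Sum>j<Suc m. c + c) + (\<Sum>j<m. \<Sum>k\<le>m. G k j)"
proof -
  have split: "(\<Sum>k\<le>Suc m. if k < j then G k (j - 1) else if Suc j < k then G (k - 1) j else c) =
      (\<Sum>k<j. G k (j - 1)) + (c + c) + (\<Sum>k\<in>{Suc j..m}. G k j)" if "j < Suc m" for j
  proof -
    define H where "H k = (if k < j then G k (j - 1) else if Suc j < k then G (k - 1) j else c)" for k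
    have "{..Suc m} = {..<j} \<union> ({j, Suc j} \<union> {Suc (Suc j)..Suc m})" using that by auto
    then have "sum H {..Suc m} = sum H ({..<j} \<union> ({j, Suc j} \<union> {Suc (Suc j)..Suc m}))" by simp
    also have "\<dots> = sum H {..<j} + (sum H {j, Suc j} + sum H {Suc (Suc j)..Suc m})"
      by (subst sum.union_disjoint, (auto)[3], subst sum.union_disjoint) auto
    also have "sum H {..<j} = (\<Sum>k<j. G k (j - 1))"
      by (rule sum.cong) (auto simp: H_def)
    also have "sum H {j, Suc j} = c + c"
      by (simp add: H_def)
    also have "sum H {Suc (Suc j)..Suc m} = (\<Sum>k\<in>{Suc j..m}. G k j)"
      by (subst sum.atLeast_Suc_atMost_Suc_shift) (auto simp: H_def intro!: sum.cong)
    finally have "sum H {..Suc m} = (\<Sum>k<j. G k (j - 1)) + (c + c) + (\<Sum>k\<in>{Suc j..m}. G k j)"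
      by (simp only: add.assoc)
    then show ?thesis unfolding H_def .
  qed
  have "(\<Sum>j<Suc m. \<Sum>k\<le>Suc m. if k < j then G k (j - 1) else if Suc j < k then G (k - 1) j else c) =
      (\<Sum>j<Suc m. \<Sum>k<j. G k (j - 1)) + (\<Sum>j<Suc m. c + c) + (\<Sum>j<Suc m. \<Sum>k\<in>{Suc j..m}. G k j)"
    by (subst sum.cong[OF refl split]) (simp_all only: lessThan_iff sum.distrib)
  also have "(\<Sum>j<Suc m. \<Sum>k<j. G k (j - 1)) = (\<Sum>j<m. \<Sum>k\<le>j. G k j)"
    by (subst sum.lessThan_Suc_shift) (simp add: lessThan_Suc_atMost)
  also have "(\<Sum>j<Suc m. \<Sum>k\<in>{Suc j..m}. G k j) = (\<Sum>j<m. \<Sum>k\<in>{Suc j..m}. G k j)"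
    by simp
  finally have eq: "(\<Sum>j<Suc m. \<Sum>k\<le>Suc m. if k < j then G k (j - 1) else if Suc j < k then G (k - 1) j else c) =
      (\<Sum>j<m. \<Sum>k\<le>j. G k j) + (\<Sum>j<Suc m. c + c) + (\<Sum>j<m. \<Sum>k\<in>{Suc j..m}. G k j)" .
  have "(\<Sum>j<m. \<Sum>k\<le>m. G k j) = (\<Sum>j<m. \<Sum>k\<le>j. G k j) + (\<Sum>j<m. \<Sum>k\<in>{Suc j..m}. G k j)"
    unfolding sum.distrib[symmetric]
  proof (rule sum.cong[OF refl])
    fix j assume "j \<in> {..<m}"
    then have "{..m} = {..j} \<union> {Suc j..m}" by auto
    then show "(\<Sum>k\<le>m. G k j) = (\<Sum>k\<le>j. G k j) + (\<Sum>k\<in>{Suc j..m}. G k j)"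
      by (simp add: sum.union_disjoint)
  qed
  then show ?thesis unfolding eq by (simp only: ac_simps)
qed

section \<open>Doubling maps and their homotopies\<close>

locale fixed_point_free_homotopy =
  fixes X :: "'a topology" and \<Phi> :: "'a \<times> real \<Rightarrow> 'a"
  assumes Hausdorff: "Hausdorff_space X"
    and second_countable: "second_countable X"
    and completely_regular: "completely_regular_space X"
    and continuous_\<Phi>: "continuous_map (prod_topology X (top_of_set {0..1})) X \<Phi>"
    and \<Phi>_0: "x \<in> topspace X \<Longrightarrow> \<Phi> (x, 0) = x"
    and \<Phi>_neq: "x \<in> topspace X \<Longrightarrow> 0 < t \<Longrightarrow> t \<le> 1 \<Longrightarrow> \<Phi> (x, t) \<noteq> x"
begin

lemma continuous_\<Phi>_compose:
  assumes "continuous_map T X g" "continuous_map T euclideanreal e" "\<And>x. x \<in> topspace T \<Longrightarrow> 0 \<le> e x \<and> e x \<le> 1"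
  shows "continuous_map T X (\<lambda>x. \<Phi> (g x, e x))"
proof -
  have "continuous_map T (prod_topology X (top_of_set {0..1})) (\<lambda>x. (g x, e x))"
    using assms by (intro continuous_map_pairedI) (auto simp: continuous_map_in_subtopology)
  from continuous_map_compose[OF this continuous_\<Phi>] show ?thesis by (simp add: o_def)
qed

text \<open>The condition for every point to be doubled at time \<open>t\<close>. The case
  \<open>j = k\<close> is included: the new point must also avoid its own source.\<close>

definition admissible :: "nat \<Rightarrow> (nat \<Rightarrow> 'a) \<Rightarrow> real \<Rightarrow> bool" where
  "admissible n y t \<longleftrightarrow> 0 < t \<and> t \<le> 1 \<and> (\<forall>j<n. \<forall>k<n. \<Phi> (y j, t) \<noteq> y k)"

text \<open>For \<open>j \<noteq> k\<close> the inequality holds at time 0 and is an open condition,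
  the diagonal being closed. For \<open>j = k\<close> it fails at time 0, and there the absence of
  fixed points at positive times takes over.\<close>

lemma admissible_nearby:
  assumes y: "y \<in> topspace (PConf n X)"
  shows "\<exists>V \<delta>. openin (PConf n X) V \<and> y \<in> V \<and> 0 < \<delta> \<and> (\<forall>z\<in>V. \<forall>t. 0 < t \<and> t \<le> \<delta> \<longrightarrow> admissible n z t)"
proof -
  let ?PI = "prod_topology (PConf n X) (top_of_set {0..1::real})"
  define W where "W = topspace ?PI \<inter> (\<Inter>(j, k)\<in>{(j, k). j < n \<and> k < n \<and> j \<noteq> k}.
    {z \<in> topspace ?PI. (\<Phi> (fst z j, snd z), fst z k) \<in> topspace (prod_topology X X) - (\<lambda>x. (x, x)) ` topspace X})"
  have op: "openin (prod_topology X X) (topspace (prod_topology X X) - (\<lambda>x. (x, x)) ` topspace X)"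
    using Hausdorff unfolding Hausdorff_space_closedin_diagonal by (rule openin_diff[OF openin_topspace])
  have pt: "continuous_map ?PI X (\<lambda>z. fst z j)" if "j < n" for j
    using continuous_map_compose[OF continuous_map_fst continuous_map_PConf_point[OF that]] by (simp add: o_def)
  have sn: "continuous_map ?PI euclideanreal snd"
    using continuous_map_snd[of "PConf n X" "top_of_set {0..1::real}"] by (simp add: continuous_map_in_subtopology)
  have "openin ?PI {z \<in> topspace ?PI. (\<Phi> (fst z j, snd z), fst z k) \<in>
      topspace (prod_topology X X) - (\<lambda>x. (x, x)) ` topspace X}" if "j < n" "k < n" for j k
    by (rule openin_continuous_map_preimage[OF _ op])
      (intro continuous_map_pairedI continuous_\<Phi>_compose pt sn that, auto)
  moreover have "finite {(j, k). j < n \<and> k < n \<and> j \<noteq> k}"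
    by (rule finite_subset[of _ "{..<n} \<times> {..<n}"]) auto
  ultimately have "openin ?PI W"
    unfolding W_def
    by (cases "{(j, k). j < n \<and> k < n \<and> j \<noteq> k} = {}")
      (simp only: image_empty Inter_empty Int_UNIV_right openin_topspace, intro openin_Int openin_topspace openin_INT2, auto)
  moreover have "(y, 0) \<in> W"
    using y by (auto simp: W_def topspace_PConf \<Phi>_0 dest: inj_onD)
  ultimately obtain V J where VJ: "openin (PConf n X) V" "openin (top_of_set {0..1::real}) J" "y \<in> V" "0 \<in> J"
      "V \<times> J \<subseteq> W"
    unfolding openin_prod_topology_alt by metis
  obtain e where e: "0 < e" "ball 0 e \<inter> {0..1} \<subseteq> J"
    using VJ(2,4) unfolding openin_contains_ball by blast
  have "admissible n z t" if z: "z \<in> V" and t: "0 < t" "t \<le> min 1 (e / 2)" for z t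
  proof -
    have "t \<in> J" using t e by (intro subsetD[OF e(2)]) (auto simp: dist_real_def)
    then have zW: "(z, t) \<in> W" using VJ(5) z by blast
    have zX: "z \<in> topspace (PConf n X)" using VJ(1) z openin_subset by blast
    have "\<Phi> (z j, t) \<noteq> z k" if "j < n" "k < n" for j k
    proof (cases "j = k")
      case True
      then show ?thesis using zX t that \<Phi>_neq[of "z k" t] by (simp add: topspace_PConf)
    next
      case False
      have "(\<Phi> (z j, t), z k) \<in> topspace (prod_topology X X) - (\<lambda>x. (x, x)) ` topspace X"
        using zW that False unfolding W_def by fastforce
      then show ?thesis by auto
    qed
    with t show ?thesis by (simp add: admissible_def)
  qed
  moreover have "0 < min 1 (e / 2)" using e by simp
  ultimately show ?thesis using VJ(1,3) by blast
qed

lemma continuous_admissible: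
  "\<exists>\<epsilon>. continuous_map (PConf n X) euclideanreal \<epsilon> \<and>
    (\<forall>y\<in>topspace (PConf n X). admissible n y (\<epsilon> y) \<and> (\<forall>t. 0 < t \<and> t \<le> \<epsilon> y \<longrightarrow> admissible n y t))"
proof -
  have "Lindelof_space (PConf n X)"
    unfolding PConf_def
    by (intro second_countable_imp_Lindelof_space second_countable_subtopology second_countable_product
        second_countable) simp
  moreover have "completely_regular_space (PConf n X)"
    unfolding PConf_def
    by (intro completely_regular_space_subtopology)
      (simp add: completely_regular_space_product_topology completely_regular)
  ultimately obtain \<epsilon> where "continuous_map (PConf n X) euclideanreal \<epsilon>"
      "\<And>y. y \<in> topspace (PConf n X) \<Longrightarrow> 0 < \<epsilon> y"
      "\<And>y t. y \<in> topspace (PConf n X) \<Longrightarrow> 0 < t \<Longrightarrow> t \<le> \<epsilon> y \<Longrightarrow> admissible n y t"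
    by (rule continuous_positive_below[of "PConf n X" "admissible n", OF _ _ admissible_nearby]) blast+
  then show ?thesis by (intro exI[of _ \<epsilon>]) auto
qed

text \<open>The functions for different \<open>n\<close> are chosen independently and bear no
  relation to each other; this is why dropping and doubling commute only up to homotopy.\<close>

definition eps :: "nat \<Rightarrow> (nat \<Rightarrow> 'a) \<Rightarrow> real" where
  "eps n = (SOME \<epsilon>. continuous_map (PConf n X) euclideanreal \<epsilon> \<and>
    (\<forall>y\<in>topspace (PConf n X). admissible n y (\<epsilon> y) \<and> (\<forall>t. 0 < t \<and> t \<le> \<epsilon> y \<longrightarrow> admissible n y t)))"

lemma continuous_eps: "continuous_map (PConf n X) euclideanreal (eps n)"
  and eps: "y \<in> topspace (PConf n X) \<Longrightarrow> admissible n y (eps n y)"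
  and below_eps: "y \<in> topspace (PConf n X) \<Longrightarrow> 0 < t \<Longrightarrow> t \<le> eps n y \<Longrightarrow> admissible n y t"
  using someI_ex[OF continuous_admissible[of n], folded eps_def] by simp_all

text \<open>Configuration and time depend on a common parameter space, so that the lemma serves both
  the doubling maps and the homotopies between them.\<close>

lemma continuous_double_point:
  assumes g: "continuous_map T (PConf n X) g" and e: "continuous_map T euclideanreal e"
    and adm: "\<And>x. x \<in> topspace T \<Longrightarrow> admissible n (g x) (e x)" and j: "j < n"
  shows "continuous_map T (PConf (Suc n) X) (\<lambda>x. double_point \<Phi> n j (e x) (g x))"
  unfolding continuous_map_into_PConf
proof (intro conjI allI impI ballI)
  fix i assume i: "i < Suc n"
  have pt: "continuous_map T X (\<lambda>x. g x i)" if "i < n" for i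
    using g that by (simp add: continuous_map_into_PConf)
  consider "i \<le> j" | "i = Suc j" | "Suc j < i" by linarith
  then show "continuous_map T X (\<lambda>x. double_point \<Phi> n j (e x) (g x) i)"
  proof cases
    case 1
    then show ?thesis using pt[of i] j by (simp add: double_point_def)
  next
    case 2
    have "continuous_map T X (\<lambda>x. \<Phi> (g x j, e x))"
      using adm by (intro continuous_\<Phi>_compose pt j e) (auto simp: admissible_def less_imp_le)
    with 2 show ?thesis by (simp add: double_point_def)
  next
    case 3
    then show ?thesis using pt[of "i - 1"] i by (simp add: double_point_def)
  qed
next
  fix x assume x: "x \<in> topspace T"
  show "double_point \<Phi> n j (e x) (g x) \<in> extensional {..<Suc n}"
    using j by (auto simp: double_point_def extensional_def)
  have inj: "inj_on (g x) {..<n}"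
    using g x by (simp add: continuous_map_into_PConf)
  have new: "\<Phi> (g x j, e x) \<noteq> g x k" if "k < n" for k
    using adm[OF x] j that by (simp add: admissible_def)
  show "inj_on (double_point \<Phi> n j (e x) (g x)) {..<Suc n}"
  proof (rule inj_onI)
    fix a b assume ab: "a \<in> {..<Suc n}" "b \<in> {..<Suc n}"
      "double_point \<Phi> n j (e x) (g x) a = double_point \<Phi> n j (e x) (g x) b"
    have val: "double_point \<Phi> n j (e x) (g x) i = g x (if i \<le> j then i else i - 1)"
      if "i \<noteq> Suc j" "i < Suc n" for i
      using that by (auto simp: double_point_def)
    have lt: "(if i \<le> j then i else i - 1) < n" if "i < Suc n" for i
      using that j by auto
    have valj: "double_point \<Phi> n j (e x) (g x) (Suc j) = \<Phi> (g x j, e x)"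
      by (simp add: double_point_def)
    consider "a = Suc j" "b = Suc j" | "a = Suc j" "b \<noteq> Suc j" | "a \<noteq> Suc j" "b = Suc j" | "a \<noteq> Suc j" "b \<noteq> Suc j"
      by blast
    then show "a = b"
    proof cases
      case 2
      then show ?thesis using ab val[of b] valj new[OF lt[of b]] by simp
    next
      case 3
      then show ?thesis using ab val[of a] valj new[OF lt[of a]] by simp
    next
      case 4
      then have "(if a \<le> j then a else a - 1) = (if b \<le> j then b else b - 1)"
        using ab val[of a] val[of b] lt[of a] lt[of b] by (intro inj_onD[OF inj]) auto
      with 4 show ?thesis by (auto split: if_splits)
    qed simp
  qed
qed

definition dbl :: "nat \<Rightarrow> nat \<Rightarrow> (nat \<Rightarrow> 'a) \<Rightarrow> nat \<Rightarrow> 'a" where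
  "dbl n j y = double_point \<Phi> n j (eps n y) y"

lemma continuous_dbl: "j < n \<Longrightarrow> continuous_map (PConf n X) (PConf (Suc n) X) (dbl n j)"
  unfolding dbl_def
  using continuous_double_point[where g = "\<lambda>y. y" and T = "PConf n X" and e = "eps n"] continuous_eps eps by simp

text \<open>Only one point is moved and none is added, so time 0 is allowed; it is the end of the
  homotopy to the identity.\<close>

lemma continuous_update_point:
  assumes g: "continuous_map T (PConf n X) g" and e: "continuous_map T euclideanreal e"
    and adm: "\<And>x. x \<in> topspace T \<Longrightarrow> e x = 0 \<or> admissible n (g x) (e x)" and j: "j < n"
  shows "continuous_map T (PConf n X) (\<lambda>x. (g x)(j := \<Phi> (g x j, e x)))"
  unfolding continuous_map_into_PConf
proof (intro conjI allI impI ballI)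
  fix i assume i: "i < n"
  have pt: "continuous_map T X (\<lambda>x. g x i)" if "i < n" for i
    using g that by (simp add: continuous_map_into_PConf)
  have "continuous_map T X (\<lambda>x. \<Phi> (g x j, e x))"
    using adm by (intro continuous_\<Phi>_compose pt j e) (force simp: admissible_def)
  with pt[OF i] show "continuous_map T X (\<lambda>x. ((g x)(j := \<Phi> (g x j, e x))) i)"
    by (cases "i = j") simp_all
next
  fix x assume x: "x \<in> topspace T"
  have gx: "g x \<in> topspace (PConf n X)" using g x by (auto simp: continuous_map_def)
  then show "(g x)(j := \<Phi> (g x j, e x)) \<in> extensional {..<n}"
    using j by (auto simp: topspace_PConf extensional_def)
  have new: "\<Phi> (g x j, e x) \<noteq> g x k" if "k < n" "k \<noteq> j" for k
    using adm[OF x] gx j that by (auto simp: admissible_def topspace_PConf \<Phi>_0 dest: inj_onD)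
  show "inj_on ((g x)(j := \<Phi> (g x j, e x))) {..<n}"
    using gx new not_sym[OF new] by (auto simp: topspace_PConf inj_on_def)
qed

text \<open>Dropping the new half undoes the doubling exactly. Dropping the old half leaves the new
  one in its place, and it slides back along \<Phi> as the time decreases from \<open>eps\<close> to
  0; all times in between are admissible.\<close>

lemma drop_dbl_homologous_id:
  assumes j: "j < n" and c: "singular_relcycle p (PConf n X) {} c"
  shows "homologous_rel p (PConf n X) {} (chain_map p (drop_point n j \<circ> dbl n j) c) c"
    and "chain_map p (drop_point n (Suc j) \<circ> dbl n j) c = c"
proof -
  have ch: "singular_chain p (PConf n X) c" using c by (simp add: singular_cycle)
  show "chain_map p (drop_point n (Suc j) \<circ> dbl n j) c = c"
    by (rule chain_map_id_gen[OF ch]) (simp add: dbl_def drop_double_same j topspace_PConf)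
  let ?IP = "prod_topology (top_of_set {0..1::real}) (PConf n X)"
  define H where "H z = (snd z)(j := \<Phi> (snd z j, (1 - fst z) * eps n (snd z)))" for z :: "real \<times> (nat \<Rightarrow> 'a)"
  have fs: "continuous_map ?IP euclideanreal fst"
    using continuous_map_fst[of "top_of_set {0..1::real}" "PConf n X"] by (simp add: continuous_map_in_subtopology)
  have ep: "continuous_map ?IP euclideanreal (\<lambda>z. eps n (snd z))"
    using continuous_map_compose[OF continuous_map_snd continuous_eps] by (simp add: o_def)
  have "continuous_map ?IP (PConf n X) H"
    unfolding H_def
  proof (rule continuous_update_point[OF continuous_map_snd _ _ j])
    show "continuous_map ?IP euclideanreal (\<lambda>z. (1 - fst z) * eps n (snd z))"
      by (intro continuous_map_real_mult continuous_map_diff fs ep) simp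
    fix z assume z: "z \<in> topspace ?IP"
    then have zt: "0 \<le> fst z" "fst z \<le> 1" "snd z \<in> topspace (PConf n X)" by auto
    then have "0 < eps n (snd z)" using eps by (simp add: admissible_def)
    then have "fst z \<noteq> 1 \<Longrightarrow> admissible n (snd z) ((1 - fst z) * eps n (snd z))"
      using zt by (intro below_eps) (auto simp: mult_left_le_one_le)
    then show "(1 - fst z) * eps n (snd z) = 0 \<or> admissible n (snd z) ((1 - fst z) * eps n (snd z))"
      by (cases "fst z = 1") auto
  qed
  then have "homologous_rel p (PConf n X) {} (chain_map p (drop_point n j \<circ> dbl n j) c) (chain_map p id c)"
  proof (rule homotopy_imp_homologous[OF _ _ _ c])
    show "H (0, y) = (drop_point n j \<circ> dbl n j) y" if "y \<in> topspace (PConf n X)" for y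
      using that by (simp add: H_def dbl_def drop_double_same j topspace_PConf)
    show "H (1, y) = id y" if "y \<in> topspace (PConf n X)" for y
      using that j by (simp add: H_def \<Phi>_0 topspace_PConf)
  qed
  then show "homologous_rel p (PConf n X) {} (chain_map p (drop_point n j \<circ> dbl n j) c) c"
    using chain_map_ident[OF ch] by simp
qed

text \<open>Both maps double point \<open>j\<close> of the reduced configuration, only at different
  times, and the homotopy interpolates linearly between these. Leaving \<open>f\<close> abstract
  covers dropping a point before and behind the doubled pair.\<close>

lemma double_drop_homologous:
  assumes j: "j < m" and k: "k \<le> m" and c: "singular_relcycle p (PConf (Suc m) X) {} c"
    and f: "\<And>y. f y = double_point \<Phi> m j (eps (Suc m) y) (drop_point m k y)"
  shows "homologous_rel p (PConf (Suc m) X) {} (chain_map p f c) (chain_map p (dbl m j \<circ> drop_point m k) c)"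
proof -
  let ?IP = "prod_topology (top_of_set {0..1::real}) (PConf (Suc m) X)"
  define e where "e z = (1 - fst z) * eps (Suc m) (snd z) + fst z * eps m (drop_point m k (snd z))"
    for z :: "real \<times> (nat \<Rightarrow> 'a)"
  define H where "H z = double_point \<Phi> m j (e z) (drop_point m k (snd z))" for z
  have fs: "continuous_map ?IP euclideanreal fst"
    using continuous_map_fst[of "top_of_set {0..1::real}" "PConf (Suc m) X"] by (simp add: continuous_map_in_subtopology)
  have ep: "continuous_map ?IP euclideanreal (\<lambda>z. eps (Suc m) (snd z))"
    using continuous_map_compose[OF continuous_map_snd continuous_eps] by (simp add: o_def)
  have dp: "continuous_map ?IP (PConf m X) (\<lambda>z. drop_point m k (snd z))"
    using continuous_map_compose[OF continuous_map_snd continuous_map_drop_point] by (simp add: o_def)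
  have ep': "continuous_map ?IP euclideanreal (\<lambda>z. eps m (drop_point m k (snd z)))"
    using continuous_map_compose[OF dp continuous_eps] by (simp add: o_def)
  have "continuous_map ?IP (PConf (Suc m) X) H"
    unfolding H_def
  proof (rule continuous_double_point[OF dp _ _ j])
    show "continuous_map ?IP euclideanreal e"
      unfolding e_def
      by (intro continuous_map_add continuous_map_real_mult continuous_map_diff fs ep ep') simp
    fix z assume z: "z \<in> topspace ?IP"
    define a b where "a = eps (Suc m) (snd z)" and "b = eps m (drop_point m k (snd z))"
    have zt: "0 \<le> fst z" "fst z \<le> 1" "snd z \<in> topspace (PConf (Suc m) X)" using z by auto
    have dz: "drop_point m k (snd z) \<in> topspace (PConf m X)"
      using continuous_map_drop_point[of m X k] zt(3) by (auto simp: continuous_map_def)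
    have ab: "0 < a" "0 < b"
      using eps[OF zt(3)] eps[OF dz] by (auto simp: a_def b_def admissible_def)
    have e: "e z = (1 - fst z) * a + fst z * b" by (simp add: e_def a_def b_def)
    \<comment> \<open>The lower bound for a convex combination is the upper bound applied to the
      negatives.\<close>
    have "min a b \<le> e z"
      unfolding e using zt ab convex_bound_le[of "- a" "- min a b" "- b" "1 - fst z" "fst z"] by simp
    then have pos: "0 < e z" using ab by simp
    have max: "e z \<le> max a b"
      unfolding e using zt by (intro convex_bound_le) auto
    show "admissible m (drop_point m k (snd z)) (e z)"
    \<comment> \<open>A time between \<open>a\<close> and \<open>b\<close> is below one of the two.
      Below \<open>b\<close> it is admissible for the reduced configuration; below \<open>a\<close>
      it is admissible for the full one, and hence for the points that remain after
      dropping.\<close>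
    proof (cases "e z \<le> b")
      case True
      then show ?thesis using below_eps[OF dz pos] by (simp add: b_def)
    next
      case False
      then have "admissible (Suc m) (snd z) (e z)"
        using max by (intro below_eps[OF zt(3) pos]) (simp add: a_def)
      then show ?thesis by (auto simp: admissible_def drop_point_def)
    qed
  qed
  then show ?thesis
    by (rule homotopy_imp_homologous[OF _ _ _ c]) (simp_all add: H_def e_def f dbl_def)
qed

section \<open>The operators \<open>T\<close> and \<open>D\<close> on chains\<close>

definition drop_chain :: "nat \<Rightarrow> nat \<Rightarrow> (nat \<Rightarrow> 'a) chain \<Rightarrow> (nat \<Rightarrow> 'a) chain" where
  "drop_chain p n c = (\<Sum>k\<le>n. chain_map p (drop_point n k) c)"

definition double_chain :: "nat \<Rightarrow> nat \<Rightarrow> (nat \<Rightarrow> 'a) chain \<Rightarrow> (nat \<Rightarrow> 'a) chain" where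
  "double_chain p n c = (\<Sum>j<n. chain_map p (dbl n j) c)"

lemma drop_chain_cycle:
  "singular_relcycle p (PConf (Suc n) X) {} c \<Longrightarrow> singular_relcycle p (PConf n X) {} (drop_chain p n c)"
  unfolding drop_chain_def
  by (intro singular_relcycle_sum singular_relcycle_chain_map) (auto intro: continuous_map_drop_point)

lemma double_chain_cycle:
  "singular_relcycle p (PConf n X) {} c \<Longrightarrow> singular_relcycle p (PConf (Suc n) X) {} (double_chain p n c)"
  unfolding double_chain_def
  by (intro singular_relcycle_sum singular_relcycle_chain_map) (auto intro: continuous_dbl)

lemma homologous_chain_map:
  assumes "continuous_map S U f" "homologous_rel p S {} a b"
  shows "homologous_rel p U {} (chain_map p f a) (chain_map p f b)"
  using singular_relboundary_chain_map[OF _ assms(1), of p "{}" "a - b" "{}"] assms(2)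
  by (simp add: homologous_rel_def chain_map_diff)

lemma homologous_double_chain:
  "homologous_rel p (PConf n X) {} a b \<Longrightarrow> homologous_rel p (PConf (Suc n) X) {} (double_chain p n a) (double_chain p n b)"
  unfolding double_chain_def
  by (intro homologous_rel_sum homologous_chain_map) (auto intro: continuous_dbl)

text \<open>Composing doubling of \<open>j\<close> with dropping of \<open>k\<close> gives four
  cases: the two halves of the doubled point yield the class of \<open>c\<close>, and a point before
  or behind the pair is dropped up to homotopy before the doubling.\<close>

lemma drop_double_commutator:
  assumes c: "singular_relcycle p (PConf (Suc m) X) {} c"
  shows "homologous_rel p (PConf (Suc m) X) {} (drop_chain p (Suc m) (double_chain p (Suc m) c))
    (frag_cmul (2 * int (Suc m)) c + double_chain p m (drop_chain p m c))"
proof -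
  define G where "G k j = chain_map p (dbl m j \<circ> drop_point m k) c" for k j
  have "drop_chain p (Suc m) (double_chain p (Suc m) c) =
      (\<Sum>j<Suc m. \<Sum>k\<le>Suc m. chain_map p (drop_point (Suc m) k \<circ> dbl (Suc m) j) c)"
    unfolding drop_chain_def double_chain_def chain_map_compose
    by (subst sum.swap) (simp add: chain_map_sum del: sum.atMost_Suc sum.lessThan_Suc)
  moreover have "homologous_rel p (PConf (Suc m) X) {}
      (\<Sum>j<Suc m. \<Sum>k\<le>Suc m. chain_map p (drop_point (Suc m) k \<circ> dbl (Suc m) j) c)
      (\<Sum>j<Suc m. \<Sum>k\<le>Suc m. if k < j then G k (j - 1) else if Suc j < k then G (k - 1) j else c)"
  proof (intro homologous_rel_sum)
    fix j k assume jk: "j \<in> {..<Suc m}" "k \<in> {..Suc m}"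
    consider "k < j" | "k = j" | "k = Suc j" | "Suc j < k" by linarith
    then show "homologous_rel p (PConf (Suc m) X) {} (chain_map p (drop_point (Suc m) k \<circ> dbl (Suc m) j) c)
        (if k < j then G k (j - 1) else if Suc j < k then G (k - 1) j else c)"
    proof cases
      case 1
      then have "homologous_rel p (PConf (Suc m) X) {} (chain_map p (drop_point (Suc m) k \<circ> dbl (Suc m) j) c) (G k (j - 1))"
        unfolding G_def using jk by (intro double_drop_homologous[OF _ _ c]) (auto simp: dbl_def drop_double_less)
      with 1 show ?thesis by simp
    next
      case 2
      then show ?thesis using drop_dbl_homologous_id(1)[OF _ c, of j] jk by simp
    next
      case 3
      then show ?thesis using drop_dbl_homologous_id(2)[OF _ c, of j] jk by simp
    next
      case 4
      then have "homologous_rel p (PConf (Suc m) X) {} (chain_map p (drop_point (Suc m) k \<circ> dbl (Suc m) j) c) (G (k - 1) j)"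
        unfolding G_def using jk by (intro double_drop_homologous[OF _ _ c]) (auto simp: dbl_def drop_double_greater)
      with 4 show ?thesis by simp
    qed
  qed auto
  moreover have "(\<Sum>j<Suc m. \<Sum>k\<le>Suc m. if k < j then G k (j - 1) else if Suc j < k then G (k - 1) j else c) =
      frag_cmul (2 * int (Suc m)) c + double_chain p m (drop_chain p m c)"
  proof -
    have "(\<Sum>j<m. \<Sum>k\<le>m. G k j) = double_chain p m (drop_chain p m c)"
      by (simp add: double_chain_def drop_chain_def chain_map_sum G_def chain_map_compose)
    moreover have "(\<Sum>j<N. c + c) = frag_cmul (2 * int N) c" for N
    proof (induction N)
      case (Suc N)
      have "frag_cmul (2 * int (Suc N)) c = frag_cmul (2 * int N + (1 + 1)) c"
        by (simp add: algebra_simps)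
      also have "\<dots> = frag_cmul (2 * int N) c + (c + c)"
        by (simp only: frag_cmul_distrib frag_cmul_one)
      finally show ?case by (simp add: Suc.IH)
    qed simp
    ultimately show ?thesis
      unfolding sum_drop_double by simp
  qed
  ultimately show ?thesis by simp
qed

text \<open>Write \<open>D\<close> and \<open>T\<close> for doubling and dropping. If \<open>(T D + s) g = N T c\<close> with one point fewer, where
  \<open>s = 2 n + r\<close>, then \<open>d = N c - D g\<close> solves \<open>(T D + r) d = (D T + s) d = s N c\<close>.\<close>

lemma drop_double_rationally_surjective:
  assumes "0 < n + r" "singular_relcycle p (PConf n X) {} c"
  shows "\<exists>N d. N \<noteq> 0 \<and> singular_relcycle p (PConf n X) {} d \<and>
    homologous_rel p (PConf n X) {} (drop_chain p n (double_chain p n d) + frag_cmul (int r) d) (frag_cmul N c)"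
  using assms
proof (induction n arbitrary: r c)
  case 0
  \<comment> \<open>There is no point to double, so \<open>D\<close> vanishes and the hypothesis
    leaves \<open>r > 0\<close>.\<close>
  have "drop_chain p 0 (double_chain p 0 c) = 0"
    by (simp add: drop_chain_def double_chain_def)
  with 0 show ?case by (intro exI[of _ "int r"] exI[of _ c]) simp
next
  case (Suc m)
  \<comment> \<open>The shift for one point fewer: \<open>T D + r\<close> on \<open>D g\<close>
    becomes \<open>D (T D + s) g\<close>, with the \<open>2 (m + 1)\<close> from the commutator. As
    \<open>s\<close> is positive, the induction hypothesis applies even for
    \<open>m = 0\<close>.\<close>
  define s where "s = 2 * Suc m + r"
  let ?D = "double_chain p m" and ?T = "drop_chain p m"
  note c = Suc.prems(2)
  obtain N g where N: "N \<noteq> 0" and g: "singular_relcycle p (PConf m X) {} g"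
    and Ng: "homologous_rel p (PConf m X) {} (?T (?D g) + frag_cmul (int s) g) (frag_cmul N (?T c))"
    using Suc.IH[of s "?T c"] drop_chain_cycle[OF c] by (auto simp: s_def)
  define d where "d = frag_cmul N c - ?D g"
  have d: "singular_relcycle p (PConf (Suc m) X) {} d"
    unfolding d_def by (intro singular_relcycle_diff singular_relcycle_cmul c double_chain_cycle g)
  have cmul_diff: "frag_cmul k (a - b) = frag_cmul k a - frag_cmul k b" for k and a b :: "(nat \<Rightarrow> 'a) chain"
    using frag_cmul_distrib2[of k "a - b" b] by simp
  have D_add: "?D (a + b) = ?D a + ?D b" and D_diff: "?D (a - b) = ?D a - ?D b"
    and D_cmul: "?D (frag_cmul k a) = frag_cmul k (?D a)" for a b k
    by (simp_all add: double_chain_def chain_map_add chain_map_diff sum.distrib sum_subtractf frag_cmul_sum)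
  have T_diff: "?T (a - b) = ?T a - ?T b" and T_cmul: "?T (frag_cmul k a) = frag_cmul k (?T a)" for a b k
    by (simp_all add: drop_chain_def chain_map_diff sum_subtractf frag_cmul_sum)
  let ?h = "homologous_rel p (PConf (Suc m) X) {}"
  have "?h (drop_chain p (Suc m) (double_chain p (Suc m) d) + frag_cmul (int r) d)
      ((frag_cmul (2 * int (Suc m)) d + ?D (?T d)) + frag_cmul (int r) d)"
    by (intro homologous_rel_add drop_double_commutator d) simp
  also have "(frag_cmul (2 * int (Suc m)) d + ?D (?T d)) + frag_cmul (int r) d = frag_cmul (int s) d + ?D (?T d)"
    by (simp add: s_def frag_cmul_distrib algebra_simps)
  \<comment> \<open>Expanding \<open>d = N c - D g\<close> gathers all terms with \<open>g\<close>
    into \<open>D (T D g + s g)\<close>, which by the choice of \<open>g\<close> is homologous to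
    \<open>N D T c\<close> and cancels.\<close>
  also have "\<dots> = frag_cmul (int s * N) c + frag_cmul N (?D (?T c)) - ?D (?T (?D g) + frag_cmul (int s) g)"
    by (simp add: d_def D_add D_diff D_cmul T_diff T_cmul cmul_diff)
  finally have 1: "?h (drop_chain p (Suc m) (double_chain p (Suc m) d) + frag_cmul (int r) d)
      (frag_cmul (int s * N) c + frag_cmul N (?D (?T c)) - ?D (?T (?D g) + frag_cmul (int s) g))" .
  have 2: "?h (frag_cmul (int s * N) c + frag_cmul N (?D (?T c)) - ?D (?T (?D g) + frag_cmul (int s) g))
      (frag_cmul (int s * N) c + frag_cmul N (?D (?T c)) - ?D (frag_cmul N (?T c)))"
    by (intro homologous_rel_diff homologous_double_chain Ng) simp
  have "?h (drop_chain p (Suc m) (double_chain p (Suc m) d) + frag_cmul (int r) d) (frag_cmul (int s * N) c)"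
    using homologous_rel_trans[OF 2 1] by (simp add: D_cmul)
  moreover have "int s * N \<noteq> 0" using N by (simp add: s_def)
  ultimately show ?case using d by blast
qed

text \<open>For \<open>n > 0\<close> this is the case \<open>r = 0\<close> of the previous result.
  For \<open>n = 0\<close> nothing can be doubled, but \<open>PConf 0 X\<close> is a single point
  and placing one point \<open>a\<close> is a section of dropping it.\<close>

lemma drop_rationally_surjective:
  assumes "topspace X \<noteq> {}" and c: "singular_relcycle p (PConf n X) {} c"
  shows "\<exists>N d. N \<noteq> 0 \<and> singular_relcycle p (PConf (Suc n) X) {} d \<and>
    homologous_rel p (PConf n X) {} (drop_chain p n d) (frag_cmul N c)"
proof (cases "n = 0")
  case True
  obtain a where a: "a \<in> topspace X" using assms(1) by blast
  define s :: "(nat \<Rightarrow> 'a) \<Rightarrow> nat \<Rightarrow> 'a" where "s y = (\<lambda>i. if i = 0 then a else undefined)" for y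
  have s: "continuous_map (PConf 0 X) (PConf 1 X) s"
    using a by (auto simp: continuous_map_into_PConf s_def extensional_def inj_on_def)
  have "drop_chain p 0 (chain_map p s c) = chain_map p (drop_point 0 0 \<circ> s) c"
    by (simp add: drop_chain_def chain_map_compose)
  also have "\<dots> = c"
    using c by (intro chain_map_id_gen[of p "PConf 0 X"])
      (auto simp: True singular_cycle topspace_PConf drop_point_def extensional_def fun_eq_iff)
  finally have "drop_chain p 0 (chain_map p s c) = frag_cmul 1 c" by simp
  moreover have "singular_relcycle p (PConf 1 X) {} (chain_map p s c)"
    using c s by (intro singular_relcycle_chain_map[of p "PConf 0 X" "{}"]) (auto simp: True)
  ultimately show ?thesis
    unfolding True by (intro exI[of _ 1] exI[of _ "chain_map p s c"]) simp
next
  case False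
  then obtain N d where "N \<noteq> 0" "singular_relcycle p (PConf n X) {} d"
      "homologous_rel p (PConf n X) {} (drop_chain p n (double_chain p n d)) (frag_cmul N c)"
    using drop_double_rationally_surjective[of n 0 p c] c by auto
  then show ?thesis using double_chain_cycle by blast
qed

text \<open>On \<open>Conf\<close>, the operator \<open>T\<close> sends a configuration to the sum
  of its subconfigurations with one point fewer. For surjectivity, \<open>n!\<close> times a cycle
  lifts to a cycle on \<open>PConf n X\<close>; a multiple of this lift is hit by \<open>T\<close>
  up to homology, and the preimage is projected to \<open>Conf (Suc n) X\<close>.\<close>

theorem betti_Conf_mono:
  assumes "topspace X \<noteq> {}"
  shows "betti p (Conf n X) \<le> betti p (Conf (Suc n) X)"
proof -
  have cont: "continuous_map (PConf (Suc n) X) (Conf n X) (perm_orbit n \<circ> drop_point n k)" for k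
    by (rule continuous_map_compose[OF continuous_map_drop_point continuous_map_perm_orbit])
  have inv: "(\<Sum>k\<in>{..n}. frag_of (simplex_map q (perm_orbit n \<circ> drop_point n k) (simplex_map q (\<lambda>f. f \<circ> \<sigma>) s))) =
      (\<Sum>k\<in>{..n}. frag_of (simplex_map q (perm_orbit n \<circ> drop_point n k) s))"
    if s: "singular_simplex q (PConf (Suc n) X) s" and \<sigma>: "\<sigma> permutes {..<Suc n}" for q s \<sigma>
  proof -
    have eq: "simplex_map q (perm_orbit n \<circ> drop_point n k) (simplex_map q (\<lambda>f. f \<circ> \<sigma>) s) =
        simplex_map q (perm_orbit n \<circ> drop_point n (\<sigma> k)) s" if "k \<le> n" for k
    proof
      fix x
      show "simplex_map q (perm_orbit n \<circ> drop_point n k) (simplex_map q (\<lambda>f. f \<circ> \<sigma>) s) x =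
          simplex_map q (perm_orbit n \<circ> drop_point n (\<sigma> k)) s x"
      proof (cases "x \<in> standard_simplex q")
        case True
        then have "s x \<in> topspace (PConf (Suc n) X)"
          using s by (auto simp: singular_simplex_def continuous_map_def)
        with True show ?thesis
          using perm_orbit_drop_permute[OF _ \<sigma> that] by (simp add: simplex_map_def)
      qed (simp add: simplex_map_def)
    qed
    \<comment> \<open>A permutation of the points only permutes the summands: index \<open>k\<close>
      becomes index \<open>\<sigma> k\<close>.\<close>
    have "bij_betw \<sigma> {..n} {..n}"
      using permutes_imp_bij[OF \<sigma>] by (simp add: lessThan_Suc_atMost)
    from sum.reindex_bij_betw[OF this, of "\<lambda>k. frag_of (simplex_map q (perm_orbit n \<circ> drop_point n k) s)"]
    show ?thesis using eq by simp
  qed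
  obtain \<tau> :: "nat \<Rightarrow> (nat \<Rightarrow> 'a) set chain \<Rightarrow> (nat \<Rightarrow> 'a) set chain"
    where \<tau>: "\<And>q a b. \<tau> q (a - b) = \<tau> q a - \<tau> q b"
    "\<And>q c. singular_chain q (Conf (Suc n) X) c \<Longrightarrow> singular_chain q (Conf n X) (\<tau> q c)"
    "\<And>q c. singular_chain (Suc q) (Conf (Suc n) X) c \<Longrightarrow>
      chain_boundary (Suc q) (\<tau> (Suc q) c) = \<tau> q (chain_boundary (Suc q) c)"
    "\<And>q c. singular_chain q (PConf (Suc n) X) c \<Longrightarrow>
      \<tau> q (chain_map q (perm_orbit (Suc n)) c) = (\<Sum>k\<in>{..n}. chain_map q (perm_orbit n \<circ> drop_point n k) c)"
    by (rule invariant_sum_descends_to_Conf[OF Hausdorff, where J = "{..n}" and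
          h = "\<lambda>k. perm_orbit n \<circ> drop_point n k", OF cont inv]) blast+
  show ?thesis
  proof (rule betti_le_if_rationally_surjective[where \<tau> = \<tau>, OF \<tau>(1-3)])
    fix c assume "singular_relcycle p (Conf n X) {} c"
    then obtain d where d: "singular_relcycle p (PConf n X) {} d" "chain_map p (perm_orbit n) d = frag_cmul (fact n) c"
      using Conf_cycle_transfer[OF Hausdorff] by blast
    obtain N e where N: "N \<noteq> 0" and e: "singular_relcycle p (PConf (Suc n) X) {} e"
      and h: "homologous_rel p (PConf n X) {} (drop_chain p n e) (frag_cmul N d)"
      using drop_rationally_surjective[OF assms d(1)] by blast
    have "\<tau> p (chain_map p (perm_orbit (Suc n)) e) = chain_map p (perm_orbit n) (drop_chain p n e)"
      using e by (subst \<tau>(4)) (auto simp: singular_cycle drop_chain_def chain_map_sum chain_map_compose)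
    moreover have "homologous_rel p (Conf n X) {} (chain_map p (perm_orbit n) (drop_chain p n e))
        (frag_cmul (N * fact n) c)"
      using homologous_chain_map[OF continuous_map_perm_orbit h] by (simp add: d(2))
    moreover have "singular_relcycle p (Conf (Suc n) X) {} (chain_map p (perm_orbit (Suc n)) e)"
      using e continuous_map_perm_orbit by (rule singular_relcycle_chain_map) simp
    ultimately show "\<exists>N c'. N \<noteq> 0 \<and> singular_relcycle p (Conf (Suc n) X) {} c' \<and>
        homologous_rel p (Conf n X) {} (\<tau> p c') (frag_cmul N c)"
      using N by (intro exI[of _ "N * fact n"] exI[of _ "chain_map p (perm_orbit (Suc n)) e"]) simp
  qed
qed

end

section \<open>The inequality\<close>

theorem corollary8:
  fixes M :: "'a topology"
    and A :: "('a, 'n::finite) chart set"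
    and i n :: nat
  assumes "smooth_manifold M A"
    and "orientable_manifold M A"
    and "connected_space M"
    and "topspace M \<noteq> {}"
    and "finite_type M"
    and "CARD('n) \<ge> 2"
    and "\<exists>\<xi>. vector_field M A \<xi> \<and> nowhere_vanishing M A \<xi>"
  shows "betti i (Conf n M) \<le> betti i (Conf (Suc n) M)"
proof -
  obtain \<xi> where \<xi>: "vector_field M A \<xi>" "nowhere_vanishing M A \<xi>"
    using assms(7) by blast
  interpret field: nonvanishing_vector_field M A \<xi>
    by unfold_locales (use assms(1) \<xi> in auto)
  obtain \<Phi> :: "'a \<times> real \<Rightarrow> 'a" where \<Phi>: "continuous_map (prod_topology M (top_of_set {0..1})) M \<Phi>"
    "\<And>x. x \<in> topspace M \<Longrightarrow> \<Phi> (x, 0) = x"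
    "\<And>x t. x \<in> topspace M \<Longrightarrow> 0 < t \<Longrightarrow> t \<le> 1 \<Longrightarrow> \<Phi> (x, t) \<noteq> x"
    using field.fixed_point_free_deformation by blast
  interpret fixed_point_free_homotopy M \<Phi>
    using field.Hausdorff field.second_countable field.completely_regular \<Phi> by unfold_locales
  show ?thesis
    by (rule betti_Conf_mono[OF assms(4)])
qed

end
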